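(* Let $0<\lambda\le\frac{1}{23.46}$. Consider asynchronous tatonnement with update rule $p_j^{t+}=p_j^t\big(1+\lambda\min\{\tilde z_j,1\}(t-\tau_j)\big)$ starting from strictly positive prices. (i) If every buyer has a complementary-CES utility function, then the prices converge to the market equilibrium. (ii) If every buyer has a Leontief utility function, then the prices converge toward the set of market equilibria: every limit point of the price trajectory $(p^t)_{t\ge0}$ is a market equilibrium.
   Context: A Fisher market has $n$ goods, each with supply $1$, and buyers $i$ with budgets $e_i>0$ and utility functions $u_i$. At prices $p\ge0$, buyer $i$ demands a utility-maximizing bundle $(x_{ij}(p))_j$ of cost at most $e_i$; the demand for good $j$ is $x_j(p)=\sum_ix_{ij}(p)$ and the excess demand is $z_j(p)=x_j(p)-1$. Prices $p^*$ form a market equilibrium if $z_j(p^* )=0$ whenever $p^*_j>0$ and $z_j(p^* )\le0$ whenever $p^*_j=0$. A complementary-CES utility is $u_i(x)=(\sum_ja_{ij}x_{ij}^{\rho_i})^{1/\rho_i}$ with $\rho_i\le 0$ and $a_{ij}\ge0$. A Leontief utility is $u_i(x)=\min_{j\in S_i}b_{ij}x_{ij}$ for a nonempty set $S_i$ of goods and $b_{ij}>0$. Asynchronous tatonnement: time $t\ge0$ is continuous; each price $p_j$ is changed only at discrete update times, no two updates occur simultaneously, and consecutive updates to the same price are at most one time unit apart; $p^t$ denotes current prices just before any update at time $t$ and $p_j^{t+}$ the value just after. At an update to $p_j$ at time $t$, $\tau_j$ is the time of the previous update to $p_j$ ($0$ if none), and $\tilde z_j$ is any value between the minimum and maximum of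 the excess demands $z_j(p^{t'})$ over $t'\in(\tau_j,t]$. *)

theory Defs
  imports "HOL-Analysis.Analysis"
begin

text \<open>Fisher market with goods of type 'g (finite, supply 1 each) and buyers of type 'b.
  A bundle / price vector is a function 'g \<Rightarrow> real.\<close>

text \<open>Complementary-CES utility with weights a and exponent rho \<le> 0.
  For rho < 0 we use the standard convention that x^rho = +infinity at x = 0 for a
  valued good (a_j > 0), so the utility is 0 then; goods with a_j = 0 are ignored.
  For rho = 0 the formula is read as its limit, the Cobb-Douglas utility
  (weighted geometric mean with weights a_j / sum a).\<close>
definition ces_utility :: "('g::finite \<Rightarrow> real) \<Rightarrow> real \<Rightarrow> ('g \<Rightarrow> real) \<Rightarrow> real" where
  "ces_utility a \<rho> x =
     (if \<rho> = 0 then (\<Prod>j\<in>{j. a j > 0}. x j powr (a j / (\<Sum>k\<in>UNIV. a k)))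
      else if (\<exists>j. a j > 0 \<and> x j = 0) then 0
      else (\<Sum>j\<in>{j. a j > 0}. a j * x j powr \<rho>) powr (1 / \<rho>))"

definition leontief_utility :: "'g set \<Rightarrow> ('g \<Rightarrow> real) \<Rightarrow> ('g \<Rightarrow> real) \<Rightarrow> real" where
  "leontief_utility S b x = Min ((\<lambda>j. b j * x j) ` S)"

definition demand_set :: "(('g::finite \<Rightarrow> real) \<Rightarrow> real) \<Rightarrow> real \<Rightarrow> ('g \<Rightarrow> real) \<Rightarrow> ('g \<Rightarrow> real) set" where
  "demand_set u e p =
     {x. (\<forall>j. x j \<ge> 0) \<and> (\<Sum>j\<in>UNIV. p j * x j) \<le> e \<and>
         (\<forall>y. (\<forall>j. y j \<ge> 0) \<and> (\<Sum>j\<in>UNIV. p j * y j) \<le> e \<longrightarrow> u y \<le> u x)}"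

definition market_equilibrium ::
  "('b::finite \<Rightarrow> ('g::finite \<Rightarrow> real) \<Rightarrow> real) \<Rightarrow> ('b \<Rightarrow> real) \<Rightarrow> ('g \<Rightarrow> real) \<Rightarrow> bool" where
  "market_equilibrium u e p \<longleftrightarrow>
     (\<forall>j. p j \<ge> 0) \<and>
     (\<exists>X. (\<forall>i. X i \<in> demand_set (u i) (e i) p) \<and>
          (\<forall>j. (p j > 0 \<longrightarrow> (\<Sum>i\<in>UNIV. X i j) - 1 = 0) \<and>
               (p j = 0 \<longrightarrow> (\<Sum>i\<in>UNIV. X i j) - 1 \<le> 0)))"

definition excess_demand :: "('b::finite \<Rightarrow> ('g \<Rightarrow> real) \<Rightarrow> 'g \<Rightarrow> real) \<Rightarrow> ('g \<Rightarrow> real) \<Rightarrow> 'g \<Rightarrow> real" where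
  "excess_demand x p j = (\<Sum>i\<in>UNIV. x i p j) - 1"

text \<open>Asynchronous tatonnement run.
  T j k is the time of the k-th update of price j (T j 0 = 0 is the start, the
  updates are at T j k for k \<ge> 1); q j k is the value of p_j just after its k-th update
  (q j 0 the initial price); p t is the price vector just before any update at time t.
  z is the excess demand function.  The value z~ used at each update lies between the
  minimum and maximum of z_j(p^t') over t' in (tau_j, t] (expressed by two witnesses).\<close>
definition async_tatonnement ::
  "real \<Rightarrow> (('g::finite \<Rightarrow> real) \<Rightarrow> 'g \<Rightarrow> real) \<Rightarrow> ('g \<Rightarrow> nat \<Rightarrow> real) \<Rightarrow>
   ('g \<Rightarrow> nat \<Rightarrow> real) \<Rightarrow> (real \<Rightarrow> 'g \<Rightarrow> real) \<Rightarrow> bool" where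
  "async_tatonnement lam z T q p \<longleftrightarrow>
     (\<forall>j. T j 0 = 0) \<and>
     (\<forall>j k. T j k < T j (Suc k) \<and> T j (Suc k) - T j k \<le> 1) \<and>
     (\<forall>j. filterlim (T j) at_top sequentially) \<and>
     (\<forall>j j' k k'. k \<ge> 1 \<longrightarrow> k' \<ge> 1 \<longrightarrow> T j k = T j' k' \<longrightarrow> j = j') \<and>
     (\<forall>j. q j 0 > 0) \<and>
     (\<forall>j. p 0 j = q j 0) \<and>
     (\<forall>j k t. T j k < t \<longrightarrow> t \<le> T j (Suc k) \<longrightarrow> p t j = q j k) \<and>
     (\<forall>j k. \<exists>zt.
        (\<exists>t1 t2. T j k < t1 \<and> t1 \<le> T j (Suc k) \<and> T j k < t2 \<and> t2 \<le> T j (Suc k) \<and>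
                 z (p t1) j \<le> zt \<and> zt \<le> z (p t2) j) \<and>
        q j (Suc k) = q j k * (1 + lam * min zt 1 * (T j (Suc k) - T j k)))"

end

theory Submission
  imports Defs
begin

text \<open>
  CES buyers with substitution elasticity \<open>\<sigma> = 1 / (1 - \<rho>)\<close> and Leontief buyers are treated uniformly:
  buyer \<open>i\<close> spends on good \<open>j\<close> the share \<open>s\<^sub>i\<^sub>j = c\<^sub>i\<^sub>j p\<^sub>j\<^sup>\<theta> / Y\<^sub>i\<close> of the budget, where \<open>Y\<^sub>i = \<Sum>\<^sub>k c\<^sub>i\<^sub>k p\<^sub>k\<^sup>\<theta>\<close> and
  \<open>\<theta> = 1 - \<sigma>\<close> lies in \<open>[0, 1]\<close>; \<open>\<theta> = 0\<close> is Cobb-Douglas and \<open>\<theta> = 1\<close> is Leontief.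

  The convex potential \<open>\<Phi> = \<Sum>\<^sub>j p\<^sub>j - \<Sum>\<^sub>i e\<^sub>i ln Y\<^sub>i / \<theta>\<^sub>i\<close> has gradient \<open>-z\<close>.  An update of \<open>p\<^sub>j\<close> by the factor
  \<open>1 + \<delta>\<close> changes \<open>\<Phi>\<close> by at most \<open>p\<^sub>j (\<delta> - x\<^sub>j ln (1 + \<delta>))\<close>, and changes the spending on \<open>k \<noteq> j\<close> by about
  \<open>\<Sum>\<^sub>i e\<^sub>i s\<^sub>i\<^sub>j s\<^sub>i\<^sub>k \<bar>\<delta>\<bar>\<close>, an expression symmetric in \<open>j\<close> and \<open>k\<close>.  The loss caused by outdated demands is
  therefore split by AM-GM between the two updates involved: each update is charged for at most two
  units of update time per other good before it and one unit after it.  Hence, although \<open>\<Phi>\<close> need not decrease at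
  every update, the sum of \<open>p\<^sub>j min(z, 1)\<^sup>2 \<Delta>t\<close> over all updates is finite, and the prices move
  ever more slowly.  At every limit point a good of positive price then has zero excess demand.

  For CES buyers the prices of all desired goods stay away from zero and the equilibrium is unique, which
  gives convergence.  For Leontief buyers the demand at a limit point depends only on the set of goods
  with positive price, so it takes finitely many values; since it moves ever more slowly, a good with positive
  excess demand at one limit point would eventually have it forever, and its price would be unbounded.
\<close>

section \<open>Spending shares and the potential\<close>

text \<open>\<open>y powr \<theta>\<close> lies between 1 and \<open>y\<close>, so an exponent in
  [0, 1] only moves \<open>y\<close> closer to 1.\<close>

lemma powr_deviation_le:
  fixes y :: real
  assumes "0 < y" "0 \<le> \<theta>" "\<theta> \<le> 1"
  shows "\<bar>y powr \<theta> - 1\<bar> \<le> \<bar>y - 1\<bar>"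
proof (cases "1 \<le> y")
  case True
  then have "1 \<le> y powr \<theta>" using assms by (simp add: ge_one_powr_ge_zero)
  moreover have "y powr \<theta> \<le> y powr 1" using True assms by (intro powr_mono) auto
  ultimately show ?thesis using True assms by simp
next
  case False
  then have "y powr \<theta> \<le> 1" using assms by (simp add: powr_le1)
  moreover have "y powr 1 \<le> y powr \<theta>" using False assms by (intro powr_mono') auto
  ultimately show ?thesis using False assms by simp
qed

text \<open>Concavity of \<open>ln\<close> between 1 and \<open>y\<close>. With
  \<open>y = (1 + \<delta>) powr \<theta> i\<close> it bounds the growth of
  \<open>ln (agg i p)\<close> under one update from below.\<close>

lemma ln_convex_combination_ge:
  fixes s y :: real
  assumes "0 \<le> s" "s \<le> 1" "0 < y"
  shows "s * ln y \<le> ln (1 + s * (y - 1))"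
proof -
  have "ln ((1 - s) * 1 + s * y) \<ge> (1 - s) * ln 1 + s * ln y"
    using concave_onD[OF ln_concave, of s 1 y] assms by simp
  then show ?thesis by (simp add: algebra_simps)
qed

text \<open>CES buyers enter with \<open>c i j = a i j powr \<sigma> i\<close>, Leontief buyers with
  \<open>c i j = 1 / b i j\<close> on \<open>S i\<close> and 0 elsewhere.\<close>

locale ces_market =
  fixes e :: "'b::finite \<Rightarrow> real" and \<theta> :: "'b \<Rightarrow> real" and c :: "'b \<Rightarrow> 'g::finite \<Rightarrow> real"
  assumes e_pos: "0 < e i" and theta_nonneg: "0 \<le> \<theta> i" and theta_le_1: "\<theta> i \<le> 1"
    and c_nonneg: "0 \<le> c i j" and c_ex_pos: "\<exists>j. 0 < c i j"
begin

definition agg :: "'b \<Rightarrow> ('g \<Rightarrow> real) \<Rightarrow> real" where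
  "agg i p = (\<Sum>j\<in>UNIV. c i j * p j powr \<theta> i)"

definition share :: "'b \<Rightarrow> ('g \<Rightarrow> real) \<Rightarrow> 'g \<Rightarrow> real" where
  "share i p j = c i j * p j powr \<theta> i / agg i p"

definition spend :: "('g \<Rightarrow> real) \<Rightarrow> 'g \<Rightarrow> real" where
  "spend p j = (\<Sum>i\<in>UNIV. e i * share i p j)"

text \<open>For \<open>j \<noteq> k\<close> the derivative of \<open>spend p j\<close> in
  \<open>ln (p k)\<close> is this sum with a further factor \<open>- \<theta> i\<close> in each
  summand, so \<open>cross p j k\<close> bounds its absolute value.\<close>

definition cross :: "('g \<Rightarrow> real) \<Rightarrow> 'g \<Rightarrow> 'g \<Rightarrow> real" where
  "cross p j k = (\<Sum>i\<in>UNIV. e i * share i p j * share i p k)"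

text \<open>Chosen so that at positive prices its derivative in \<open>ln (p j)\<close> is
  \<open>share i p j\<close>. For \<open>\<theta> i = 0\<close> the shares are constant there, and a
  weighted mean of the \<open>ln (p j)\<close> takes the place of the quotient.\<close>

definition price_index :: "'b \<Rightarrow> ('g \<Rightarrow> real) \<Rightarrow> real" where
  "price_index i p =
     (if \<theta> i = 0 then (\<Sum>j\<in>UNIV. share i p j * ln (p j)) else ln (agg i p) / \<theta> i)"

definition potential :: "('g \<Rightarrow> real) \<Rightarrow> real" where
  "potential p = (\<Sum>j\<in>UNIV. p j) - (\<Sum>i\<in>UNIV. e i * price_index i p)"

text \<open>Positive prices are demanded only of goods with \<open>0 < c i j\<close>, which admits
  limit prices at which goods that nobody wants are free.\<close>

lemma agg_pos:
  assumes "\<And>j. 0 < c i j \<Longrightarrow> 0 < p j"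
  shows "0 < agg i p"
proof -
  obtain j where "0 < c i j" using c_ex_pos by blast
  then show ?thesis unfolding agg_def
    using assms[of j] by (intro sum_pos2[where i=j]) (auto simp: c_nonneg)
qed

lemma agg_nonneg: "0 \<le> agg i p"
  unfolding agg_def by (intro sum_nonneg) (simp add: c_nonneg)

lemma share_nonneg: "0 \<le> share i p j"
  unfolding share_def by (simp add: c_nonneg agg_nonneg)

lemma sum_share:
  assumes "\<And>j. 0 < c i j \<Longrightarrow> 0 < p j"
  shows "(\<Sum>j\<in>UNIV. share i p j) = 1"
proof -
  have "(\<Sum>j\<in>UNIV. share i p j) = agg i p / agg i p"
    unfolding share_def by (simp add: sum_divide_distrib[symmetric] agg_def)
  then show ?thesis using agg_pos[of i p] assms by force
qed

lemma share_le_1: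
  assumes "\<And>j. 0 < p j"
  shows "share i p j \<le> 1"
proof -
  have "share i p j \<le> (\<Sum>j\<in>UNIV. share i p j)"
    by (intro member_le_sum) (auto simp: share_nonneg)
  then show ?thesis using sum_share assms by simp
qed

lemma spend_nonneg: "0 \<le> spend p j"
  unfolding spend_def by (intro sum_nonneg mult_nonneg_nonneg share_nonneg) (simp add: e_pos less_imp_le)

lemma cross_nonneg: "0 \<le> cross p j k"
  unfolding cross_def by (intro sum_nonneg mult_nonneg_nonneg share_nonneg) (simp add: e_pos less_imp_le)

lemma cross_commute: "cross p j k = cross p k j"
  unfolding cross_def by (simp add: mult.assoc mult.commute[of "share _ _ j"])

lemma sum_cross:
  assumes "\<And>j. 0 < p j"
  shows "(\<Sum>k\<in>UNIV. cross p j k) = spend p j"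
proof -
  have "(\<Sum>k\<in>UNIV. cross p j k) = (\<Sum>i\<in>UNIV. e i * share i p j * (\<Sum>k\<in>UNIV. share i p k))"
    unfolding cross_def by (subst sum.swap) (simp add: sum_distrib_left)
  then show ?thesis using assms by (simp add: sum_share spend_def)
qed

lemma spend_le_budgets:
  assumes "\<And>j. 0 < p j"
  shows "spend p j \<le> (\<Sum>i\<in>UNIV. e i)"
  unfolding spend_def using share_le_1[OF assms] e_pos
  by (intro sum_mono) (simp add: less_imp_le mult_left_le)

text \<open>Since \<open>\<theta> i \<le> 1\<close>, the numerator and the denominator of the share
  each change by a factor of at most \<open>R\<close>.\<close>

lemma share_le_scaled:
  assumes p: "\<And>j. 0 < p j" and p': "\<And>j. 0 < p' j" and R: "1 \<le> R"
    and le: "\<And>j. p j \<le> R * p' j" "\<And>j. p' j \<le> R * p j"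
  shows "share i p j \<le> R\<^sup>2 * share i p' j"
proof -
  have scale: "a powr \<theta> i \<le> R * b powr \<theta> i" if "0 < a" "0 < b" "a \<le> R * b" for a b :: real
  proof -
    have "a powr \<theta> i \<le> (R * b) powr \<theta> i"
      using that theta_nonneg by (intro powr_mono2) auto
    also have "\<dots> = R powr \<theta> i * b powr \<theta> i" using that R by (simp add: powr_mult)
    also have "\<dots> \<le> R powr 1 * b powr \<theta> i"
      using R theta_le_1 by (intro mult_right_mono powr_mono) auto
    finally show ?thesis using R by simp
  qed
  have "agg i p' \<le> (\<Sum>j\<in>UNIV. c i j * (R * p j powr \<theta> i))"
    unfolding agg_def using scale[OF p' p le(2)] by (intro sum_mono mult_left_mono) (auto simp: c_nonneg)
  also have "\<dots> = R * agg i p" unfolding agg_def by (simp add: sum_distrib_left mult_ac)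
  finally have agg: "agg i p' \<le> R * agg i p" .
  have pos: "0 < agg i p" "0 < agg i p'" using agg_pos p p' by auto
  have "share i p j \<le> c i j * (R * p' j powr \<theta> i) / agg i p"
    unfolding share_def using scale[OF p p' le(1)] pos
    by (intro divide_right_mono mult_left_mono) (auto simp: c_nonneg)
  also have "\<dots> \<le> c i j * (R * p' j powr \<theta> i) / (agg i p' / R)"
    using agg pos R c_nonneg by (intro divide_left_mono) (auto simp: field_simps)
  also have "\<dots> = R\<^sup>2 * share i p' j"
    unfolding share_def by (simp add: power2_eq_square)
  finally show ?thesis .
qed

lemma cross_le_scaled:
  assumes p: "\<And>j. 0 < p j" and p': "\<And>j. 0 < p' j" and R: "1 \<le> R"
    and le: "\<And>j. p j \<le> R * p' j" "\<And>j. p' j \<le> R * p j"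
  shows "cross p j k \<le> R ^ 4 * cross p' j k"
proof -
  have "e i * share i p j * share i p k \<le> R ^ 4 * (e i * share i p' j * share i p' k)" for i
  proof -
    have "share i p j * share i p k \<le> (R\<^sup>2 * share i p' j) * (R\<^sup>2 * share i p' k)"
      using R share_nonneg by (intro mult_mono share_le_scaled[OF assms]) auto
    then have "e i * (share i p j * share i p k) \<le> e i * ((R\<^sup>2 * share i p' j) * (R\<^sup>2 * share i p' k))"
      using e_pos[of i] by simp
    then show ?thesis by (simp add: mult_ac power4_eq_xxxx power2_eq_square)
  qed
  then show ?thesis unfolding cross_def sum_distrib_left by (intro sum_mono)
qed

section \<open>Effect of a single price update on shares, spending and potential\<close>

lemma agg_update:
  assumes p: "\<And>j. 0 < p j" and d: "-1 < \<delta>"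
  shows "agg i (p(k := p k * (1 + \<delta>))) = agg i p * (1 + share i p k * ((1 + \<delta>) powr \<theta> i - 1))"
proof -
  have pos: "0 < agg i p" using agg_pos p by auto
  have "agg i (p(k := p k * (1 + \<delta>))) =
    c i k * (p k * (1 + \<delta>)) powr \<theta> i + (\<Sum>j\<in>UNIV - {k}. c i j * p j powr \<theta> i)"
    unfolding agg_def by (subst sum.remove[of _ k]) auto
  moreover have "agg i p = c i k * p k powr \<theta> i + (\<Sum>j\<in>UNIV - {k}. c i j * p j powr \<theta> i)"
    unfolding agg_def by (subst sum.remove[of _ k]) auto
  moreover have "(p k * (1 + \<delta>)) powr \<theta> i = p k powr \<theta> i * (1 + \<delta>) powr \<theta> i"
    using p d by (simp add: powr_mult less_imp_le)
  ultimately have "agg i (p(k := p k * (1 + \<delta>))) =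
    agg i p + c i k * p k powr \<theta> i * ((1 + \<delta>) powr \<theta> i - 1)"
    by (simp add: algebra_simps)
  also have "\<dots> = agg i p * (1 + share i p k * ((1 + \<delta>) powr \<theta> i - 1))"
    using pos by (simp add: share_def field_simps)
  finally show ?thesis .
qed

text \<open>The numerator of the share of \<open>j\<close> is untouched and the denominator is
  multiplied by \<open>1 + h\<close> with
  \<open>\<bar>h\<bar> \<le> share i p k * \<bar>\<delta>\<bar>\<close>. The factor
  \<open>share i p k\<close> is what makes the bound a summand of \<open>cross\<close>.\<close>

lemma share_update_diff_le:
  assumes p: "\<And>j. 0 < p j" and d: "\<bar>\<delta>\<bar> < 1" and "j \<noteq> k"
  shows "\<bar>share i (p(k := p k * (1 + \<delta>))) j - share i p j\<bar>
    \<le> share i p j * share i p k * (\<bar>\<delta>\<bar> / (1 - \<bar>\<delta>\<bar>))"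
proof -
  define h where "h = share i p k * ((1 + \<delta>) powr \<theta> i - 1)"
  have s: "0 \<le> share i p k" "share i p k \<le> 1" using share_nonneg share_le_1[OF p] by auto
  have dev: "\<bar>(1 + \<delta>) powr \<theta> i - 1\<bar> \<le> \<bar>\<delta>\<bar>"
    using powr_deviation_le[of "1 + \<delta>" "\<theta> i"] d theta_nonneg theta_le_1 by simp
  have h: "\<bar>h\<bar> \<le> share i p k * \<bar>\<delta>\<bar>"
    unfolding h_def abs_mult using s dev by (simp add: mult_left_mono)
  have "share i p k * \<bar>\<delta>\<bar> \<le> \<bar>\<delta>\<bar>" using s by (simp add: mult_left_le_one_le)
  then have h1: "1 - \<bar>\<delta>\<bar> \<le> 1 + h" using h by linarith
  then have hpos: "0 < 1 + h" using d by linarith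
  have "share i (p(k := p k * (1 + \<delta>))) j = share i p j / (1 + h)"
    unfolding share_def using agg_update[of p \<delta> i k] p d \<open>j \<noteq> k\<close> by (simp add: h_def share_def)
  then have "share i (p(k := p k * (1 + \<delta>))) j - share i p j = - share i p j * (h / (1 + h))"
    using hpos by (simp add: field_simps)
  then have "\<bar>share i (p(k := p k * (1 + \<delta>))) j - share i p j\<bar> = share i p j * (\<bar>h\<bar> / (1 + h))"
    using hpos share_nonneg[of i p j] by (simp add: abs_mult)
  also have "\<dots> \<le> share i p j * (share i p k * \<bar>\<delta>\<bar> / (1 - \<bar>\<delta>\<bar>))"
    using h h1 d s share_nonneg[of i p j] by (intro mult_left_mono frac_le) auto
  finally show ?thesis by simp
qed

lemma spend_update_diff_le:
  assumes p: "\<And>j. 0 < p j" and d: "\<bar>\<delta>\<bar> < 1" and "j \<noteq> k"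
  shows "\<bar>spend (p(k := p k * (1 + \<delta>))) j - spend p j\<bar> \<le> cross p j k * (\<bar>\<delta>\<bar> / (1 - \<bar>\<delta>\<bar>))"
proof -
  let ?p' = "p(k := p k * (1 + \<delta>))"
  have "\<bar>spend ?p' j - spend p j\<bar> = \<bar>\<Sum>i\<in>UNIV. e i * (share i ?p' j - share i p j)\<bar>"
    unfolding spend_def by (simp add: sum_subtractf right_diff_distrib)
  also have "\<dots> \<le> (\<Sum>i\<in>UNIV. e i * \<bar>share i ?p' j - share i p j\<bar>)"
    by (rule order.trans[OF sum_abs]) (simp add: abs_mult e_pos less_imp_le)
  also have "\<dots> \<le> (\<Sum>i\<in>UNIV. e i * (share i p j * share i p k * (\<bar>\<delta>\<bar> / (1 - \<bar>\<delta>\<bar>))))"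
    by (intro sum_mono mult_left_mono share_update_diff_le assms) (simp add: e_pos less_imp_le)
  also have "\<dots> = cross p j k * (\<bar>\<delta>\<bar> / (1 - \<bar>\<delta>\<bar>))"
    unfolding cross_def sum_distrib_right by (simp add: mult_ac)
  finally show ?thesis .
qed

text \<open>The price index is convex in \<open>ln (p k)\<close> with slope
  \<open>share i p k\<close> at the old price; the bound is the tangent there.\<close>

lemma price_index_update_ge:
  assumes p: "\<And>j. 0 < p j" and d: "-1 < \<delta>"
  shows "price_index i p + share i p k * ln (1 + \<delta>) \<le> price_index i (p(k := p k * (1 + \<delta>)))"
proof (cases "\<theta> i = 0")
  case True
  let ?p' = "p(k := p k * (1 + \<delta>))"
  have p': "0 < ?p' j" for j using p d by auto
  have sh: "share i ?p' j = share i p j" for j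
    unfolding share_def agg_def using True p p' by (simp add: less_imp_neq[symmetric])
  have "(\<Sum>j\<in>UNIV. share i p j * ln (?p' j)) =
      share i p k * ln (p k * (1 + \<delta>)) + (\<Sum>j\<in>UNIV - {k}. share i p j * ln (p j))"
    by (subst sum.remove[of _ k]) auto
  moreover have "(\<Sum>j\<in>UNIV. share i p j * ln (p j)) =
      share i p k * ln (p k) + (\<Sum>j\<in>UNIV - {k}. share i p j * ln (p j))"
    by (subst sum.remove[of _ k]) auto
  moreover have "ln (p k * (1 + \<delta>)) = ln (p k) + ln (1 + \<delta>)"
    using p[of k] d by (simp add: ln_mult)
  ultimately show ?thesis unfolding price_index_def using True sh by (simp add: algebra_simps)
next
  case False
  then have th: "0 < \<theta> i" using theta_nonneg[of i] by simp
  have pos: "0 < agg i p" using agg_pos p by auto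
  let ?y = "(1 + \<delta>) powr \<theta> i"
  have y: "0 < ?y" using d by simp
  have s: "0 \<le> share i p k" "share i p k \<le> 1" using share_nonneg share_le_1[OF p] by auto
  have "agg i (p(k := p k * (1 + \<delta>))) > 0" using p d by (intro agg_pos) auto
  then have pos2: "0 < 1 + share i p k * (?y - 1)"
    using agg_update[of p \<delta> i k, OF p d] pos by (simp add: zero_less_mult_iff)
  have "share i p k * (\<theta> i * ln (1 + \<delta>)) \<le> ln (1 + share i p k * (?y - 1))"
    using ln_convex_combination_ge[OF s y] d by (simp add: ln_powr)
  then have "share i p k * ln (1 + \<delta>) \<le> ln (1 + share i p k * (?y - 1)) / \<theta> i"
    using th by (simp add: field_simps)
  moreover have "ln (agg i (p(k := p k * (1 + \<delta>)))) = ln (agg i p) + ln (1 + share i p k * (?y - 1))"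
    using agg_update[of p \<delta> i k, OF p d] pos pos2 by (simp add: ln_mult)
  ultimately show ?thesis unfolding price_index_def using False by (simp add: add_divide_distrib)
qed

lemma potential_update_le:
  assumes p: "\<And>j. 0 < p j" and d: "-1 < \<delta>"
  shows "potential (p(k := p k * (1 + \<delta>))) \<le> potential p + p k * \<delta> - spend p k * ln (1 + \<delta>)"
proof -
  let ?p' = "p(k := p k * (1 + \<delta>))"
  have "(\<Sum>j\<in>UNIV. ?p' j) = p k * (1 + \<delta>) + (\<Sum>j\<in>UNIV - {k}. p j)"
    by (subst sum.remove[of _ k]) auto
  moreover have "(\<Sum>j\<in>UNIV. p j) = p k + (\<Sum>j\<in>UNIV - {k}. p j)"
    by (subst sum.remove[of _ k]) auto
  ultimately have 1: "(\<Sum>j\<in>UNIV. ?p' j) = (\<Sum>j\<in>UNIV. p j) + p k * \<delta>" by (simp add: algebra_simps)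
  have "(\<Sum>i\<in>UNIV. e i * (price_index i p + share i p k * ln (1 + \<delta>))) \<le>
      (\<Sum>i\<in>UNIV. e i * price_index i ?p')"
    using e_pos by (intro sum_mono mult_left_mono price_index_update_ge assms) (auto simp: less_imp_le)
  moreover have "(\<Sum>i\<in>UNIV. e i * (price_index i p + share i p k * ln (1 + \<delta>))) =
      (\<Sum>i\<in>UNIV. e i * price_index i p) + spend p k * ln (1 + \<delta>)"
    unfolding spend_def by (simp add: sum.distrib distrib_left sum_distrib_right mult.assoc)
  ultimately show ?thesis unfolding potential_def using 1 by simp
qed

section \<open>Bounds for the price indices and the potential on bounded prices\<close>

lemma price_index_le:
  obtains K where "\<And>p. \<lbrakk>\<And>j. 0 < p j; \<And>j. p j \<le> B\<rbrakk> \<Longrightarrow> price_index i p \<le> K"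
proof -
  define C where "C = (\<Sum>j\<in>UNIV. c i j)"
  define K where "K = (if \<theta> i = 0 then ln B else ln (C * B powr \<theta> i) / \<theta> i)"
  have "price_index i p \<le> K" if p: "\<And>j. 0 < p j" and B: "\<And>j. p j \<le> B" for p
  proof (cases "\<theta> i = 0")
    case True
    have "(\<Sum>j\<in>UNIV. share i p j * ln (p j)) \<le> (\<Sum>j\<in>UNIV. share i p j * ln B)"
      using p B share_nonneg by (intro sum_mono mult_left_mono) (auto simp: ln_mono)
    also have "\<dots> = ln B" using sum_share[of i p] p by (simp add: sum_distrib_right[symmetric])
    finally show ?thesis using True by (simp add: price_index_def K_def)
  next
    case False
    have "agg i p \<le> C * B powr \<theta> i"
      unfolding agg_def C_def sum_distrib_right using p B c_nonneg theta_nonneg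
      by (intro sum_mono mult_left_mono powr_mono2) (auto simp: less_imp_le)
    moreover have "0 < agg i p" using agg_pos p by auto
    ultimately show ?thesis using False theta_nonneg[of i]
      by (auto simp: price_index_def K_def intro!: divide_right_mono ln_mono)
  qed
  then show ?thesis using that by blast
qed

text \<open>The price indices are bounded above and the prices are positive. Together with
  \<open>potential_descent\<close> this makes the accumulated squared responses finite.\<close>

lemma potential_bounded_below:
  obtains K where "\<And>p. \<lbrakk>\<And>j. 0 < p j; \<And>j. p j \<le> B\<rbrakk> \<Longrightarrow> K \<le> potential p"
proof -
  have "\<exists>K. \<forall>p. (\<forall>j. 0 < p j) \<longrightarrow> (\<forall>j. p j \<le> B) \<longrightarrow> price_index i p \<le> K" for i
    using price_index_le[of B i] by metis
  then obtain K where K: "\<And>i p. (\<forall>j. 0 < p j) \<Longrightarrow> (\<forall>j. p j \<le> B) \<Longrightarrow> price_index i p \<le> K i"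
    by metis
  have "- (\<Sum>i\<in>UNIV. e i * K i) \<le> potential p" if "\<And>j. 0 < p j" "\<And>j. p j \<le> B" for p
  proof -
    have "(\<Sum>i\<in>UNIV. e i * price_index i p) \<le> (\<Sum>i\<in>UNIV. e i * K i)"
      using that e_pos by (intro sum_mono mult_left_mono K) (auto simp: less_imp_le)
    moreover have "0 \<le> (\<Sum>j\<in>UNIV. p j)" using that by (intro sum_nonneg) (simp add: less_imp_le)
    ultimately show ?thesis unfolding potential_def by simp
  qed
  then show ?thesis using that by blast
qed

end

section \<open>Amortized decrease of the potential\<close>

text \<open>Here \<open>x\<close> is the demand at the update, \<open>a\<close> and \<open>b\<close>
  are outdated demands within \<open>V\<close> of it, and \<open>m\<close> is the capped response.
  For \<open>x \<le> 2\<close> the cap is harmless: \<open>m\<close> differs from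
  \<open>x - 1\<close> by at most \<open>V\<close>, and half of \<open>m\<^sup>2\<close> dominates
  \<open>x * m\<^sup>2 / 4\<close>. For \<open>x > 2\<close> it suffices that
  \<open>0 \<le> m \<le> 1\<close> and \<open>1 / 2 + x / 4 \<le> x - 1\<close>.\<close>

lemma capped_response_bound:
  fixes m x V a b :: real
  assumes V: "0 \<le> V" "V \<le> x / 5" and a: "\<bar>a - x\<bar> \<le> V" and b: "\<bar>b - x\<bar> \<le> V"
    and m: "min (a - 1) 1 \<le> m" "m \<le> min (b - 1) 1"
  shows "m\<^sup>2 / 2 + x * m\<^sup>2 / 4 - \<bar>m\<bar> * V \<le> m * (x - 1)"
proof (cases "x \<le> 2")
  case True
  then have "\<bar>m - (x - 1)\<bar> \<le> V" using V a b m by (auto simp: min_def split: if_splits)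
  then have "m * (m - (x - 1)) \<le> \<bar>m\<bar> * V"
    by (metis abs_ge_self abs_ge_zero abs_mult mult_left_mono order.trans)
  moreover have "x * m\<^sup>2 \<le> 2 * m\<^sup>2" using True by (intro mult_right_mono) auto
  ultimately show ?thesis by (simp add: algebra_simps power2_eq_square)
next
  case False
  \<comment> \<open>\<open>V \<le> x / 5\<close> leaves \<open>a \<ge> 4 * x / 5 > 8 / 5\<close>, so
    even the smallest admissible response is positive.\<close>
  have m1: "0 \<le> m" "m \<le> 1" using False V a m by (auto simp: min_def split: if_splits)
  have "m\<^sup>2 * (1 / 2 + x / 4) \<le> m * (1 / 2 + x / 4)"
    using m1 False by (intro mult_right_mono) (auto simp: power2_eq_square mult_left_le)
  also have "\<dots> \<le> m * (x - 1)" using m1 False by (intro mult_left_mono) auto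
  finally have "m\<^sup>2 / 2 + x * m\<^sup>2 / 4 \<le> m * (x - 1)" by (simp add: algebra_simps)
  moreover have "0 \<le> \<bar>m\<bar> * V" using V by simp
  ultimately show ?thesis by linarith
qed

text \<open>The updates in chronological order: update \<open>n\<close> changes good \<open>g n\<close>, \<open>d n\<close> is the time since the
  previous update of that good, \<open>m n\<close> the capped excess demand it uses, \<open>P n\<close> the prices just before
  it, and \<open>win n\<close> the updates (all of other goods) since that previous update.\<close>

locale update_sequence = ces_market e \<theta> c
  for e :: "'b::finite \<Rightarrow> real" and \<theta> :: "'b \<Rightarrow> real" and c :: "'b \<Rightarrow> 'g::finite \<Rightarrow> real" +
  fixes lam :: real and g :: "nat \<Rightarrow> 'g" and d m :: "nat \<Rightarrow> real"
    and P :: "nat \<Rightarrow> 'g \<Rightarrow> real" and win :: "nat \<Rightarrow> nat set"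
  assumes lam_pos: "0 < lam" and lam_le: "lam \<le> 1 / 23.46"
    and d_pos: "0 < d n" and d_le: "d n \<le> 1"
    and m_ge: "-1 \<le> m n" and m_le: "m n \<le> 1"
    and P_pos: "0 < P n j"
    and P_step: "P (Suc n) = (P n)(g n := P n (g n) * (1 + lam * m n * d n))"
    and win_less: "l \<in> win n \<Longrightarrow> l < n"
    and win_upwards: "\<lbrakk>l \<in> win n; l \<le> l'; l' < n\<rbrakk> \<Longrightarrow> l' \<in> win n"
    and win_other: "l \<in> win n \<Longrightarrow> g l \<noteq> g n"
    and win_unique: "\<lbrakk>l \<in> win n; l \<in> win n'; g n = g n'\<rbrakk> \<Longrightarrow> n = n'"
    and win_duration: "(\<Sum>l\<in>{l \<in> win n. g l = k}. d l) \<le> 2"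
    and response: "\<exists>a\<in>insert n (win n). \<exists>b\<in>insert n (win n).
      min (spend (P a) (g n) / P a (g n) - 1) 1 \<le> m n \<and> m n \<le> min (spend (P b) (g n) / P b (g n) - 1) 1"
begin

text \<open>A rational upper bound of \<open>1 / 23.46\<close>, on which the numerical estimates of
  the amortization rest.\<close>

lemma lam_bound: "lam \<le> 427 / 10000"
  using lam_le by simp

lemma step_bound: "\<bar>lam * m n * d n\<bar> \<le> lam * d n" "\<bar>lam * m n * d n\<bar> \<le> 427 / 10000"
proof -
  have "\<bar>m n\<bar> \<le> 1" using m_ge[of n] m_le[of n] by simp
  then have "(lam * d n) * \<bar>m n\<bar> \<le> lam * d n" using lam_pos d_pos[of n] by (intro mult_left_le) auto
  then show 1: "\<bar>lam * m n * d n\<bar> \<le> lam * d n"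
    using lam_pos d_pos[of n] by (simp add: abs_mult mult_ac)
  have "lam * d n \<le> lam" using lam_pos d_le[of n] by simp
  then show "\<bar>lam * m n * d n\<bar> \<le> 427 / 10000" using 1 lam_bound by linarith
qed

lemma finite_win: "finite (win n)"
  by (rule finite_subset[of _ "{..<n}"]) (auto dest: win_less)

section \<open>Drift of prices and spending within a window\<close>

lemma interval_subset_win:
  assumes "a \<in> insert n (win n)"
  shows "{a..<n} \<subseteq> win n" "a \<le> n"
  using assms win_upwards win_less by (auto intro: less_imp_le)

text \<open>The window contains no update of \<open>g n\<close> itself. Hence the outdated demands
  for \<open>g n\<close> differ from the current one only through the spending.\<close>

lemma price_const_on_win:
  assumes "a \<in> insert n (win n)"
  shows "P a (g n) = P n (g n)"
proof -
  have "P a (g n) = P b (g n)" if "a \<le> b" "b \<le> n" for b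
    using that
  proof (induction b rule: dec_induct)
    case (step b)
    then have "b \<in> win n" using interval_subset_win[OF assms] by auto
    then have "g n \<noteq> g b" using win_other[of b n] by auto
    then show ?case using step P_step[of b] by simp
  qed simp
  then show ?thesis using interval_subset_win(2)[OF assms] by simp
qed

text \<open>Each update of \<open>k\<close> multiplies its price by a factor between
  \<open>1 - lam * d l\<close> and \<open>1 + lam * d l\<close>. Both directions are expressed by
  the same Bernoulli-type factor \<open>1 - lam * D\<close>, which avoids exponentials.\<close>

lemma price_drift:
  fixes k :: 'g
  assumes "a \<le> b"
  defines "D \<equiv> (\<Sum>l\<in>{l \<in> {a..<b}. g l = k}. d l)"
  shows "P a k * (1 - lam * D) \<le> P b k" "P b k * (1 - lam * D) \<le> P a k"
proof -
  define E where "E b = (\<Sum>l\<in>{l \<in> {a..<b}. g l = k}. d l)" for b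
  have "P a k * (1 - lam * E b) \<le> P b k \<and> P b k * (1 - lam * E b) \<le> P a k"
    using assms(1)
  proof (induction b rule: dec_induct)
    case base
    then show ?case by (simp add: E_def)
  next
    case (step b)
    show ?case
    proof (cases "g b = k")
      case False
      then have "{l \<in> {a..<Suc b}. g l = k} = {l \<in> {a..<b}. g l = k}" by (auto simp: less_Suc_eq)
      moreover have "P (Suc b) k = P b k" using False P_step[of b] by auto
      ultimately show ?thesis using step.IH by (simp add: E_def)
    next
      case True
      have "{l \<in> {a..<Suc b}. g l = k} = insert b {l \<in> {a..<b}. g l = k}"
        using True step.hyps by (auto simp: less_Suc_eq)
      then have E: "E (Suc b) = d b + E b" by (simp add: E_def)
      define \<delta> where "\<delta> = lam * m b * d b"
      define h where "h = lam * d b"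
      have "h \<le> lam" using lam_pos d_le[of b] by (simp add: h_def)
      then have "h < 1" using lam_bound by linarith
      then have h: "0 < h" "h < 1" "\<bar>\<delta>\<bar> \<le> h"
        using step_bound[of b] lam_pos d_pos[of b] by (simp_all add: h_def \<delta>_def)
      have P: "P (Suc b) k = P b k * (1 + \<delta>)" using True P_step[of b] by (simp add: \<delta>_def)
      have E0: "0 \<le> lam * E b" using lam_pos d_pos by (auto simp: E_def less_imp_le intro!: sum_nonneg mult_nonneg_nonneg)
      have Pb: "0 < P b k" "0 < P a k" using P_pos by auto
      have "P a k * (1 - lam * E (Suc b)) \<le> P a k * ((1 - lam * E b) * (1 - h))"
      proof (intro mult_left_mono)
        have "0 \<le> lam * E b * h" using E0 h by simp
        moreover have "lam * E (Suc b) = h + lam * E b" by (simp add: E h_def algebra_simps)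
        ultimately show "1 - lam * E (Suc b) \<le> (1 - lam * E b) * (1 - h)" by (simp add: algebra_simps)
      qed (use Pb in simp)
      also have "\<dots> \<le> P b k * (1 - h)"
        using step.IH h mult_right_mono[of "P a k * (1 - lam * E b)" "P b k" "1 - h"] by simp
      also have "\<dots> \<le> P (Suc b) k" unfolding P using Pb h by (intro mult_left_mono) auto
      finally have 1: "P a k * (1 - lam * E (Suc b)) \<le> P (Suc b) k" .
      have "P (Suc b) k * (1 - lam * E (Suc b)) \<le> P a k"
      proof (cases "0 \<le> 1 - lam * E (Suc b)")
        case nonneg: True
        have "P (Suc b) k * (1 - lam * E (Suc b)) \<le> P b k * (1 + h) * (1 - lam * E (Suc b))"
          unfolding P using Pb h nonneg by (intro mult_right_mono mult_left_mono) auto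
        also have "\<dots> = P b k * ((1 + h) * (1 - (lam * E b + h)))" by (simp add: E h_def algebra_simps)
        \<comment> \<open>\<open>(1 + h) * (1 - lam * E b - h)\<close> equals
          \<open>1 - lam * E b - h * (lam * E b + h)\<close>.\<close>
        also have "\<dots> \<le> P b k * (1 - lam * E b)"
          using Pb h E0 by (intro mult_left_mono) (auto simp: algebra_simps)
        finally show ?thesis using step.IH by linarith
      next
        case False
        then have "P (Suc b) k * (1 - lam * E (Suc b)) \<le> 0"
          using P_pos[of "Suc b" k] by (simp add: mult_le_0_iff)
        then show ?thesis using Pb by linarith
      qed
      then show ?thesis using 1 by simp
    qed
  qed
  then show "P a k * (1 - lam * D) \<le> P b k" "P b k * (1 - lam * D) \<le> P a k"
    by (auto simp: D_def E_def)
qed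

text \<open>A window holds at most two units of update time per good, and
  \<open>1 - 2 * 427 / 10000 \<ge> 10 / 11\<close>.\<close>

lemma price_ratio_on_win:
  assumes "a \<in> insert n (win n)"
  shows "P a k \<le> 11 / 10 * P n k" "P n k \<le> 11 / 10 * P a k"
proof -
  let ?D = "\<Sum>l\<in>{l \<in> {a..<n}. g l = k}. d l"
  have "?D \<le> (\<Sum>l\<in>{l \<in> win n. g l = k}. d l)"
    using interval_subset_win(1)[OF assms] finite_win d_pos
    by (intro sum_mono2) (auto simp: less_imp_le)
  then have "?D \<le> 2" using win_duration[of n k] by linarith
  then have "lam * ?D \<le> 427 / 10000 * 2"
    using lam_bound lam_pos d_pos by (intro mult_mono) (auto simp: less_imp_le intro!: sum_nonneg)
  then have D: "10 / 11 \<le> 1 - lam * ?D" by linarith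
  have "P a k * (10 / 11) \<le> P a k * (1 - lam * ?D)" "P n k * (10 / 11) \<le> P n k * (1 - lam * ?D)"
    using D P_pos[of a k] P_pos[of n k] by (auto intro!: mult_left_mono)
  then show "P a k \<le> 11 / 10 * P n k" "P n k \<le> 11 / 10 * P a k"
    using price_drift[OF interval_subset_win(2)[OF assms], of k] by linarith+
qed

text \<open>Bound for the total movement of the spending on \<open>g n\<close> during its window.
  The factor \<open>21 / 20\<close> covers \<open>1 / (1 - \<bar>\<delta>\<bar>)\<close> for steps
  \<open>\<bar>\<delta>\<bar> \<le> 427 / 10000\<close>.\<close>

definition variation :: "nat \<Rightarrow> real" where
  "variation n = (\<Sum>l\<in>win n. cross (P l) (g n) (g l) * (21 / 20 * (lam * \<bar>m l\<bar> * d l)))"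

lemma spend_diff_on_win:
  assumes "a \<in> insert n (win n)"
  shows "\<bar>spend (P a) (g n) - spend (P n) (g n)\<bar> \<le> variation n"
proof -
  define h where "h l = cross (P l) (g n) (g l) * (21 / 20 * (lam * \<bar>m l\<bar> * d l))" for l
  have h0: "0 \<le> h l" for l
    unfolding h_def using cross_nonneg lam_pos d_pos[of l] by simp
  have upd: "\<bar>spend (P (Suc l)) (g n) - spend (P l) (g n)\<bar> \<le> h l" if "l \<in> win n" for l
  proof -
    let ?\<delta> = "lam * m l * d l"
    have "\<bar>?\<delta>\<bar> / (1 - \<bar>?\<delta>\<bar>) \<le> \<bar>?\<delta>\<bar> / (20 / 21)"
      using step_bound(2)[of l] by (intro divide_left_mono) auto
    then have le: "\<bar>?\<delta>\<bar> / (1 - \<bar>?\<delta>\<bar>) \<le> 21 / 20 * (lam * \<bar>m l\<bar> * d l)"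
      using lam_pos d_pos[of l] by (simp add: abs_mult)
    have "\<bar>spend (P (Suc l)) (g n) - spend (P l) (g n)\<bar>
        \<le> cross (P l) (g n) (g l) * (\<bar>?\<delta>\<bar> / (1 - \<bar>?\<delta>\<bar>))"
      unfolding P_step[of l] using win_other[OF that] step_bound(2)[of l]
      by (intro spend_update_diff_le P_pos) auto
    also have "\<dots> \<le> h l" unfolding h_def using le cross_nonneg by (intro mult_left_mono)
    finally show ?thesis .
  qed
  have "\<bar>spend (P a) (g n) - spend (P b) (g n)\<bar> \<le> (\<Sum>l\<in>{a..<b}. h l)" if "a \<le> b" "b \<le> n" for b
    using that
  proof (induction b rule: dec_induct)
    case (step b)
    then have "b \<in> win n" using interval_subset_win[OF assms] by auto
    then show ?case using step upd[of b] by simp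
  qed simp
  then have "\<bar>spend (P a) (g n) - spend (P n) (g n)\<bar> \<le> (\<Sum>l\<in>{a..<n}. h l)"
    using interval_subset_win[OF assms] by simp
  also have "\<dots> \<le> (\<Sum>l\<in>win n. h l)"
    using interval_subset_win[OF assms] finite_win h0 by (intro sum_mono2) auto
  finally show ?thesis by (simp add: variation_def h_def)
qed

text \<open>Moving all cross terms to the prices at update \<open>n\<close> costs
  \<open>(11 / 10) ^ 4 \<le> 3 / 2\<close>. Grouped by good, each group has duration at most 2, and
  the cross terms over all goods add up to the spending.\<close>

lemma sum_cross_on_win:
  "(\<Sum>l\<in>win n. cross (P l) (g n) (g l) * d l) \<le> 3 * spend (P n) (g n)"
proof -
  have "(\<Sum>l\<in>win n. cross (P l) (g n) (g l) * d l)
      \<le> (\<Sum>l\<in>win n. (3 / 2 * cross (P n) (g n) (g l)) * d l)"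
  proof (intro sum_mono mult_right_mono)
    fix l assume l: "l \<in> win n"
    have "cross (P l) (g n) (g l) \<le> (11 / 10) ^ 4 * cross (P n) (g n) (g l)"
      using price_ratio_on_win[of l n] l by (intro cross_le_scaled P_pos) auto
    also have "\<dots> \<le> 3 / 2 * cross (P n) (g n) (g l)"
      using cross_nonneg by (intro mult_right_mono) (auto simp: power4_eq_xxxx)
    finally show "cross (P l) (g n) (g l) \<le> 3 / 2 * cross (P n) (g n) (g l)" .
  qed (simp add: d_pos less_imp_le)
  also have "\<dots> = (\<Sum>k\<in>UNIV. \<Sum>l\<in>{l \<in> win n. g l = k}. (3 / 2 * cross (P n) (g n) (g l)) * d l)"
    using finite_win by (intro sum.group[symmetric]) auto
  also have "\<dots> = (\<Sum>k\<in>UNIV. 3 / 2 * cross (P n) (g n) k * (\<Sum>l\<in>{l \<in> win n. g l = k}. d l))"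
    unfolding sum_distrib_left by (intro sum.cong) auto
  also have "\<dots> \<le> (\<Sum>k\<in>UNIV. 3 / 2 * cross (P n) (g n) k * 2)"
    using cross_nonneg win_duration by (intro sum_mono mult_left_mono) auto
  also have "\<dots> = 3 * spend (P n) (g n)"
    using sum_cross[of "P n" "g n", OF P_pos] by (simp add: sum_distrib_left[symmetric])
  finally show ?thesis .
qed

text \<open>\<open>21 / 20 * 427 / 10000 * 3\<close> is below \<open>1 / 5\<close>. The ratio
  \<open>1 / 5\<close> is the one required by \<open>capped_response_bound\<close>.\<close>

lemma variation_bounds: "0 \<le> variation n" "variation n \<le> spend (P n) (g n) / 5"
proof -
  show "0 \<le> variation n"
    unfolding variation_def using cross_nonneg lam_pos d_pos
    by (intro sum_nonneg mult_nonneg_nonneg) (auto simp: less_imp_le)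
  have "variation n \<le> (\<Sum>l\<in>win n. 21 / 20 * lam * (cross (P l) (g n) (g l) * d l))"
    unfolding variation_def
  proof (intro sum_mono)
    fix l
    have "\<bar>m l\<bar> \<le> 1" using m_ge[of l] m_le[of l] by simp
    then have "(cross (P l) (g n) (g l) * (21 / 20 * lam * d l)) * \<bar>m l\<bar>
        \<le> cross (P l) (g n) (g l) * (21 / 20 * lam * d l)"
      using cross_nonneg[of "P l"] lam_pos d_pos[of l] by (intro mult_left_le) auto
    then show "cross (P l) (g n) (g l) * (21 / 20 * (lam * \<bar>m l\<bar> * d l))
        \<le> 21 / 20 * lam * (cross (P l) (g n) (g l) * d l)" by (simp add: mult_ac)
  qed
  also have "\<dots> \<le> 21 / 20 * lam * (3 * spend (P n) (g n))"
    unfolding sum_distrib_left[symmetric] using sum_cross_on_win lam_pos by (intro mult_left_mono) auto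
  also have "\<dots> \<le> spend (P n) (g n) / 5"
    using mult_right_mono[OF lam_bound spend_nonneg[of "P n" "g n"]] spend_nonneg[of "P n" "g n"] by simp
  finally show "variation n \<le> spend (P n) (g n) / 5" .
qed

text \<open>To first order the potential changes by \<open>- \<delta> * (s - p)\<close>, the
  response times the true excess demand, which \<open>capped_response_bound\<close> controls. The
  last summand is the quadratic error of the logarithm.\<close>

lemma potential_step:
  "potential (P (Suc n)) \<le> potential (P n)
     - lam * d n * (P n (g n) * (m n)\<^sup>2 / 2 + spend (P n) (g n) * (m n)\<^sup>2 / 4)
     + lam * d n * \<bar>m n\<bar> * variation n
     + 21 / 20 * lam\<^sup>2 * (spend (P n) (g n) * (m n)\<^sup>2 * d n)"
proof -
  define \<delta> where "\<delta> = lam * m n * d n"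
  define p where "p = P n (g n)"
  define s where "s = spend (P n) (g n)"
  have p: "0 < p" using P_pos by (simp add: p_def)
  have s: "0 \<le> s" using spend_nonneg by (simp add: s_def)
  have \<delta>: "\<bar>\<delta>\<bar> \<le> 427 / 10000" using step_bound by (simp add: \<delta>_def)
  have "0 < 1 + \<delta>" using \<delta> by linarith
  \<comment> \<open>Lower bound for the logarithm, from \<open>ln y \<le> y - 1\<close> at the
    reciprocal \<open>y = 1 / (1 + \<delta>)\<close>.\<close>
  then have "1 - 1 / (1 + \<delta>) \<le> ln (1 + \<delta>)"
    using ln_le_minus_one[of "1 / (1 + \<delta>)"] by (simp add: ln_div)
  moreover have "\<delta> - 21 / 20 * \<delta>\<^sup>2 \<le> 1 - 1 / (1 + \<delta>)"
  proof -
    have "\<delta>\<^sup>2 / (1 + \<delta>) \<le> \<delta>\<^sup>2 / (20 / 21)" using \<delta> by (intro divide_left_mono) auto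
    moreover have "1 - 1 / (1 + \<delta>) = \<delta> - \<delta>\<^sup>2 / (1 + \<delta>)" using \<delta> by (simp add: field_simps power2_eq_square)
    ultimately show ?thesis by simp
  qed
  ultimately have "\<delta> - 21 / 20 * \<delta>\<^sup>2 \<le> ln (1 + \<delta>)" by linarith
  then have ln: "s * (\<delta> - 21 / 20 * \<delta>\<^sup>2) \<le> s * ln (1 + \<delta>)" using s by (intro mult_left_mono)
  have pot: "potential (P (Suc n)) \<le> potential (P n) + p * \<delta> - s * ln (1 + \<delta>)"
    unfolding P_step[of n] p_def s_def \<delta>_def[symmetric] using \<delta> by (intro potential_update_le P_pos) auto
  obtain a b where ab: "a \<in> insert n (win n)" "b \<in> insert n (win n)"
    "min (spend (P a) (g n) / P a (g n) - 1) 1 \<le> m n" "m n \<le> min (spend (P b) (g n) / P b (g n) - 1) 1"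
    using response by blast
  have div: "\<bar>spend (P a) (g n) / P a (g n) - s / p\<bar> \<le> variation n / p" if "a \<in> insert n (win n)" for a
    using spend_diff_on_win[OF that] price_const_on_win[OF that] p
    by (simp add: s_def p_def diff_divide_distrib[symmetric] divide_right_mono)
  \<comment> \<open>The own price is constant on the window, so dividing by \<open>p\<close> turns
    bounds on spending into bounds on demand.\<close>
  have "(m n)\<^sup>2 / 2 + (s / p) * (m n)\<^sup>2 / 4 - \<bar>m n\<bar> * (variation n / p) \<le> m n * (s / p - 1)"
    using variation_bounds[of n] p ab div
    by (intro capped_response_bound[of _ _ "spend (P a) (g n) / P a (g n)" "spend (P b) (g n) / P b (g n)"])
       (auto simp: s_def field_simps)
  then have "p * ((m n)\<^sup>2 / 2 + (s / p) * (m n)\<^sup>2 / 4 - \<bar>m n\<bar> * (variation n / p)) \<le> p * (m n * (s / p - 1))"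
    using p by (intro mult_left_mono) auto
  moreover have "p * ((m n)\<^sup>2 / 2 + (s / p) * (m n)\<^sup>2 / 4 - \<bar>m n\<bar> * (variation n / p))
      = p * (m n)\<^sup>2 / 2 + s * (m n)\<^sup>2 / 4 - \<bar>m n\<bar> * variation n"
    "p * (m n * (s / p - 1)) = m n * (s - p)"
    using p by (simp_all add: right_diff_distrib distrib_left)
  ultimately have "p * (m n)\<^sup>2 / 2 + s * (m n)\<^sup>2 / 4 - \<bar>m n\<bar> * variation n \<le> m n * (s - p)"
    by linarith
  then have "(lam * d n) * (p * (m n)\<^sup>2 / 2 + s * (m n)\<^sup>2 / 4 - \<bar>m n\<bar> * variation n) \<le> (lam * d n) * (m n * (s - p))"
    using lam_pos d_pos[of n] by (intro mult_left_mono) auto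
  then have gain: "lam * d n * (p * (m n)\<^sup>2 / 2 + s * (m n)\<^sup>2 / 4) - lam * d n * \<bar>m n\<bar> * variation n \<le> s * \<delta> - p * \<delta>"
    by (simp add: \<delta>_def algebra_simps)
  \<comment> \<open>Since \<open>d n \<le> 1\<close>, the quadratic error is also linear in
    \<open>d n\<close> and can be compared with the gain.\<close>
  have "d n * d n \<le> d n" using d_pos[of n] d_le[of n] by (simp add: mult_left_le)
  then have "(lam\<^sup>2 * (m n)\<^sup>2) * (d n * d n) \<le> (lam\<^sup>2 * (m n)\<^sup>2) * d n" by (intro mult_left_mono) auto
  then have "\<delta>\<^sup>2 \<le> lam\<^sup>2 * (m n)\<^sup>2 * d n" by (simp add: \<delta>_def power2_eq_square mult_ac)
  then have "s * \<delta>\<^sup>2 \<le> s * (lam\<^sup>2 * (m n)\<^sup>2 * d n)" using s by (intro mult_left_mono)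
  then show ?thesis using pot ln gain unfolding p_def[symmetric] s_def[symmetric]
    by (simp add: algebra_simps)
qed

text \<open>After exchanging the sums, update \<open>l\<close> is charged by the later updates whose
  windows contain it. By \<open>win_unique\<close> there is at most one for each good, so the cross
  terms add up to at most the spending on \<open>g l\<close>; also
  \<open>d n \<le> 1\<close>.\<close>

lemma sum_win_transpose:
  "(\<Sum>n<N. \<Sum>l\<in>win n. d n * cross (P l) (g n) (g l) * (d l * (m l)\<^sup>2))
     \<le> (\<Sum>l<N. spend (P l) (g l) * (m l)\<^sup>2 * d l)"
proof -
  have "(\<Sum>n<N. \<Sum>l\<in>win n. d n * cross (P l) (g n) (g l) * (d l * (m l)\<^sup>2))
      = (\<Sum>n<N. \<Sum>l\<in>{l \<in> {..<N}. l \<in> win n}. d n * cross (P l) (g n) (g l) * (d l * (m l)\<^sup>2))"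
    by (intro sum.cong refl) (auto dest: win_less)
  also have "\<dots> = (\<Sum>l<N. \<Sum>n\<in>{n \<in> {..<N}. l \<in> win n}. d n * cross (P l) (g n) (g l) * (d l * (m l)\<^sup>2))"
    by (rule sum.swap_restrict) auto
  also have "\<dots> \<le> (\<Sum>l<N. spend (P l) (g l) * (m l)\<^sup>2 * d l)"
  proof (intro sum_mono)
    fix l
    let ?S = "{n \<in> {..<N}. l \<in> win n}"
    have "(\<Sum>n\<in>?S. d n * cross (P l) (g n) (g l)) \<le> (\<Sum>n\<in>?S. cross (P l) (g n) (g l))"
      using d_le cross_nonneg by (intro sum_mono mult_left_le_one_le) (auto simp: d_pos less_imp_le)
    also have "\<dots> = (\<Sum>j\<in>g ` ?S. cross (P l) j (g l))"
      by (subst sum.reindex) (auto intro: win_unique simp: inj_on_def)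
    also have "\<dots> \<le> (\<Sum>j\<in>UNIV. cross (P l) j (g l))"
      using cross_nonneg by (intro sum_mono2) auto
    also have "\<dots> = spend (P l) (g l)"
      using sum_cross[of "P l" "g l", OF P_pos] by (simp add: cross_commute[of _ _ "g l"])
    finally have "(\<Sum>n\<in>?S. d n * cross (P l) (g n) (g l)) * (d l * (m l)\<^sup>2)
        \<le> spend (P l) (g l) * (d l * (m l)\<^sup>2)"
      using d_pos[of l] by (intro mult_right_mono) auto
    then show "(\<Sum>n\<in>?S. d n * cross (P l) (g n) (g l) * (d l * (m l)\<^sup>2)) \<le> spend (P l) (g l) * (m l)\<^sup>2 * d l"
      by (simp add: sum_distrib_right mult.assoc mult.commute[of "d l"])
  qed
  finally show ?thesis .
qed

text \<open>AM-GM splits \<open>\<bar>m n\<bar> * \<bar>m l\<bar>\<close> into halves. The half with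
  \<open>(m n)\<^sup>2\<close> is summed by \<open>sum_cross_on_win\<close>; the half with
  \<open>(m l)\<^sup>2\<close> is kept for \<open>sum_win_transpose\<close>.\<close>

lemma staleness_loss_le:
  "lam * d n * \<bar>m n\<bar> * variation n
     \<le> 21 / 40 * lam\<^sup>2 * (3 * (spend (P n) (g n) * (m n)\<^sup>2 * d n)
         + (\<Sum>l\<in>win n. d n * cross (P l) (g n) (g l) * (d l * (m l)\<^sup>2)))"
proof -
  have "lam * d n * \<bar>m n\<bar> * variation n
      = (\<Sum>l\<in>win n. (21 / 20 * lam\<^sup>2 * (d n * cross (P l) (g n) (g l) * d l)) * (\<bar>m n\<bar> * \<bar>m l\<bar>))"
    unfolding variation_def sum_distrib_left by (intro sum.cong) (auto simp: power2_eq_square mult_ac)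
  also have "\<dots> \<le> (\<Sum>l\<in>win n. (21 / 20 * lam\<^sup>2 * (d n * cross (P l) (g n) (g l) * d l)) * (((m n)\<^sup>2 + (m l)\<^sup>2) / 2))"
  proof (intro sum_mono mult_left_mono)
    fix l
    have "0 \<le> (\<bar>m n\<bar> - \<bar>m l\<bar>)\<^sup>2" by simp
    then show "\<bar>m n\<bar> * \<bar>m l\<bar> \<le> ((m n)\<^sup>2 + (m l)\<^sup>2) / 2" by (simp add: power2_diff)
    show "0 \<le> 21 / 20 * lam\<^sup>2 * (d n * cross (P l) (g n) (g l) * d l)"
      using cross_nonneg[of "P l"] d_pos[of l] d_pos[of n] by simp
  qed
  also have "\<dots> = 21 / 40 * lam\<^sup>2 * (d n * (m n)\<^sup>2 * (\<Sum>l\<in>win n. cross (P l) (g n) (g l) * d l)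
      + (\<Sum>l\<in>win n. d n * cross (P l) (g n) (g l) * (d l * (m l)\<^sup>2)))"
    unfolding sum_distrib_left sum.distrib[symmetric] by (intro sum.cong) (auto simp: field_simps)
  also have "\<dots> \<le> 21 / 40 * lam\<^sup>2 * (d n * (m n)\<^sup>2 * (3 * spend (P n) (g n))
      + (\<Sum>l\<in>win n. d n * cross (P l) (g n) (g l) * (d l * (m l)\<^sup>2)))"
    using sum_cross_on_win[of n] d_pos[of n] by (intro mult_left_mono add_right_mono) auto
  finally show ?thesis by (simp add: mult_ac)
qed

text \<open>Summed over all updates, the losses amount to at most
  \<open>(21 / 8 + 21 / 40) * lam\<^sup>2\<close> times the sum of \<open>C\<close>. This is paid
  for by the gain \<open>lam / 4\<close> times the same sum, because
  \<open>63 / 20 * 427 / 10000 < 1 / 4\<close>. The gain in \<open>A\<close> survives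
  untouched.\<close>

theorem potential_descent:
  "potential (P N) + lam / 2 * (\<Sum>n<N. P n (g n) * (m n)\<^sup>2 * d n) \<le> potential (P 0)"
proof -
  define A where "A n = P n (g n) * (m n)\<^sup>2 * d n" for n
  define C where "C n = spend (P n) (g n) * (m n)\<^sup>2 * d n" for n
  define F where "F n = (\<Sum>l\<in>win n. d n * cross (P l) (g n) (g l) * (d l * (m l)\<^sup>2))" for n
  have C0: "0 \<le> C n" for n unfolding C_def using spend_nonneg d_pos[of n] by simp
  \<comment> \<open>\<open>21 / 8\<close> collects \<open>21 / 20\<close> from the logarithm and
    \<open>3 * 21 / 40\<close> from the stale demands.\<close>
  have step: "potential (P (Suc n)) \<le> potential (P n) - lam / 2 * A n - lam / 4 * C n
      + 21 / 8 * lam\<^sup>2 * C n + 21 / 40 * lam\<^sup>2 * F n" for n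
    using potential_step[of n] staleness_loss_le[of n] unfolding A_def C_def F_def
    by (simp add: algebra_simps)
  have "potential (P N) \<le> potential (P 0) - (\<Sum>n<N. lam / 2 * A n) - (\<Sum>n<N. lam / 4 * C n)
      + (\<Sum>n<N. 21 / 8 * lam\<^sup>2 * C n) + (\<Sum>n<N. 21 / 40 * lam\<^sup>2 * F n)"
  proof (induction N)
    case (Suc N)
    then show ?case using step[of N] unfolding sum.lessThan_Suc by linarith
  qed simp
  then have "potential (P N) \<le> potential (P 0) - lam / 2 * (\<Sum>n<N. A n) - lam / 4 * (\<Sum>n<N. C n)
      + 21 / 8 * (lam\<^sup>2 * (\<Sum>n<N. C n)) + 21 / 40 * (lam\<^sup>2 * (\<Sum>n<N. F n))"
    by (simp add: sum_distrib_left mult.assoc)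
  moreover have "lam\<^sup>2 * (\<Sum>n<N. F n) \<le> lam\<^sup>2 * (\<Sum>n<N. C n)"
    using sum_win_transpose[of N] unfolding F_def C_def by (intro mult_left_mono) auto
  moreover have "lam\<^sup>2 * (\<Sum>n<N. C n) \<le> 427 / 10000 * (lam * (\<Sum>n<N. C n))"
    using mult_right_mono[OF lam_bound, of "lam * (\<Sum>n<N. C n)"] lam_pos sum_nonneg[of "{..<N}" C] C0
    by (simp add: power2_eq_square mult_ac)
  moreover have "0 \<le> lam * (\<Sum>n<N. C n)" using lam_pos C0 by (simp add: sum_nonneg)
  ultimately show ?thesis unfolding A_def[symmetric] by (simp add: algebra_simps)
qed

end

section \<open>Asynchronous runs\<close>

text \<open>Every nonempty subset has a least element, so the set is listed by iterating the passage
  to the next larger element. An element never reached would bound the infinite list from above,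
  against local finiteness.\<close>

lemma enumerate_locally_finite:
  fixes A :: "real set"
  assumes inf: "infinite A" and fin: "\<And>c. finite (A \<inter> {..c})"
  obtains \<tau> :: "nat \<Rightarrow> real" where "strict_mono \<tau>" "range \<tau> = A"
proof -
  have least: "\<exists>a\<in>B. \<forall>b\<in>B. a \<le> b" if B: "B \<subseteq> A" "B \<noteq> {}" for B
  proof -
    obtain a0 where a0: "a0 \<in> B" using B(2) by blast
    have "finite (B \<inter> {..a0})" by (rule finite_subset[OF _ fin[of a0]]) (use B(1) in auto)
    moreover have "B \<inter> {..a0} \<noteq> {}" using a0 by auto
    ultimately have "Min (B \<inter> {..a0}) \<in> B \<inter> {..a0}" "\<forall>b\<in>B \<inter> {..a0}. Min (B \<inter> {..a0}) \<le> b"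
      by (rule Min_in, simp)
    then show ?thesis by (metis Int_iff atMost_iff linear order.trans)
  qed
  have "A \<inter> {s<..} \<noteq> {}" for s
  proof
    assume "A \<inter> {s<..} = {}"
    then have "A \<subseteq> A \<inter> {..s}" by (auto simp: not_less[symmetric])
    then show False using inf fin finite_subset by blast
  qed
  then have "\<exists>a\<in>A \<inter> {s<..}. \<forall>b\<in>A \<inter> {s<..}. a \<le> b" for s by (intro least) auto
  then obtain nx where nx: "\<And>s. nx s \<in> A" "\<And>s. s < nx s" "\<And>s b. b \<in> A \<Longrightarrow> s < b \<Longrightarrow> nx s \<le> b"
    by (metis Int_iff greaterThan_iff)
  obtain a0 where a0: "a0 \<in> A" "\<And>b. b \<in> A \<Longrightarrow> a0 \<le> b"
    using least[of A] inf by auto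
  define \<tau> where "\<tau> n = (nx ^^ n) a0" for n
  have mono: "strict_mono \<tau>" by (rule strict_monoI_Suc) (simp add: \<tau>_def nx)
  have in_A: "\<tau> n \<in> A" for n by (cases n) (auto simp: \<tau>_def a0 nx)
  have "b \<in> range \<tau>" if b: "b \<in> A" for b
  proof (rule ccontr)
    assume not: "b \<notin> range \<tau>"
    have "\<tau> n < b" for n
    proof (induction n)
      case 0
      then show ?case using a0(2)[OF b] not by (metis \<tau>_def funpow_0 order.order_iff_strict rangeI)
    next
      case (Suc n)
      then have "\<tau> (Suc n) \<le> b" using nx(3)[OF b] by (simp add: \<tau>_def)
      then show ?case using not by (metis order.order_iff_strict rangeI)
    qed
    then have "range \<tau> \<subseteq> A \<inter> {..b}" using in_A by (auto intro: less_imp_le)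
    then have "finite (range \<tau>)" using fin finite_subset by blast
    then show False using mono strict_mono_imp_inj_on range_inj_infinite by blast
  qed
  then show ?thesis using that[OF mono] in_A by blast
qed

text \<open>\<open>resp j k\<close> stands for the already capped value \<open>min zt 1\<close> of
  update \<open>Suc k\<close>. The formula for \<open>z\<close> is required at positive prices only,
  where demand is unique.\<close>

locale tatonnement_run = ces_market e \<theta> c
  for e :: "'b::finite \<Rightarrow> real" and \<theta> :: "'b \<Rightarrow> real" and c :: "'b \<Rightarrow> 'g::finite \<Rightarrow> real" +
  fixes lam :: real and z :: "('g \<Rightarrow> real) \<Rightarrow> 'g \<Rightarrow> real"
    and T q resp :: "'g \<Rightarrow> nat \<Rightarrow> real" and p :: "real \<Rightarrow> 'g \<Rightarrow> real"
  assumes lam_pos: "0 < lam" and lam_le: "lam \<le> 1 / 23.46"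
    and z_eq: "(\<And>j. 0 < pr j) \<Longrightarrow> z pr j = spend pr j / pr j - 1"
    and T_0: "T j 0 = 0"
    and T_less_Suc: "T j k < T j (Suc k)" and T_gap: "T j (Suc k) - T j k \<le> 1"
    and T_lim: "filterlim (T j) at_top sequentially"
    and T_distinct: "T j (Suc k) = T j' (Suc k') \<Longrightarrow> j = j'"
    and q_0: "0 < q j 0"
    and p_0: "p 0 j = q j 0"
    and p_eq: "\<lbrakk>T j k < t; t \<le> T j (Suc k)\<rbrakk> \<Longrightarrow> p t j = q j k"
    and resp_lower: "\<exists>t. T j k < t \<and> t \<le> T j (Suc k) \<and> min (z (p t) j) 1 \<le> resp j k"
    and resp_upper: "\<exists>t. T j k < t \<and> t \<le> T j (Suc k) \<and> resp j k \<le> min (z (p t) j) 1"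
    and q_Suc: "q j (Suc k) = q j k * (1 + lam * resp j k * (T j (Suc k) - T j k))"
begin

section \<open>Update times of a single good\<close>

lemma T_strict_mono: "strict_mono (T j)"
  by (rule strict_monoI_Suc) (rule T_less_Suc)

lemma T_less_iff: "T j k < T j l \<longleftrightarrow> k < l"
  by (rule strict_mono_less[OF T_strict_mono])

lemma T_le_iff: "T j k \<le> T j l \<longleftrightarrow> k \<le> l"
  by (rule strict_mono_less_eq[OF T_strict_mono])

lemma T_nonneg: "0 \<le> T j k"
  using T_le_iff[of j 0 k] by (simp add: T_0)

lemma T_Suc_pos: "0 < T j (Suc k)"
  using T_less_Suc[of j k] T_nonneg[of j k] by linarith

lemma T_unbounded: "\<exists>k. t \<le> T j k"
proof -
  have "eventually (\<lambda>k. t \<le> T j k) sequentially"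
    using T_lim[of j] by (simp add: filterlim_at_top)
  then show ?thesis by (auto simp: eventually_sequentially)
qed

lemma T_locate:
  assumes "0 < t"
  obtains k where "T j k < t" "t \<le> T j (Suc k)"
proof -
  define K where "K = (LEAST k. t \<le> T j k)"
  have K: "t \<le> T j K" unfolding K_def using T_unbounded by (rule LeastI_ex)
  then have "K \<noteq> 0" using assms T_0[of j] by (cases K) auto
  then obtain k where k: "K = Suc k" by (cases K) auto
  then have "\<not> t \<le> T j k" using not_less_Least[of k "\<lambda>k. t \<le> T j k"] by (simp add: K_def)
  then show ?thesis using that[of k] K k by simp
qed

lemma T_interval_unique:
  assumes "T j k < t" "t \<le> T j (Suc k)" "T j k' < t" "t \<le> T j (Suc k')"
  shows "k = k'"
proof -
  have "T j k < T j (Suc k')" "T j k' < T j (Suc k)" using assms by linarith+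
  then show ?thesis by (simp add: T_less_iff)
qed

text \<open>The durations telescope. The first of these updates may have its predecessor up to one
  time unit before \<open>s\<close>, whence the additional 1.\<close>

lemma sum_durations_le:
  assumes "finite K" "s \<le> t" and K: "\<And>i. i \<in> K \<Longrightarrow> s < T j (Suc i) \<and> T j (Suc i) \<le> t"
  shows "(\<Sum>i\<in>K. T j (Suc i) - T j i) \<le> t - s + 1"
proof (cases "K = {}")
  case False
  let ?a = "Min K" and ?b = "Max K"
  have ab: "?a \<in> K" "?b \<in> K" "K \<subseteq> {?a..<Suc ?b}" "?a \<le> ?b"
    using assms(1) False by (auto simp: less_Suc_eq_le)
  have "(\<Sum>i\<in>K. T j (Suc i) - T j i) \<le> (\<Sum>i\<in>{?a..<Suc ?b}. T j (Suc i) - T j i)"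
    using ab T_less_Suc by (intro sum_mono2) (auto simp: less_imp_le)
  also have "\<dots> = T j (Suc ?b) - T j ?a"
    using ab by (intro sum_Suc_diff') auto
  finally show ?thesis using K[OF ab(1)] K[OF ab(2)] T_gap[of j ?a] by linarith
qed (use assms in simp)

end

text \<open>Event \<open>n\<close> is update number \<open>Suc (\<kappa> n)\<close> of good
  \<open>g n\<close>; index 0 is excluded because \<open>T j 0 = 0\<close> is only the
  start.\<close>

locale enumerated_run = tatonnement_run e \<theta> c lam z T q resp p
  for e :: "'b::finite \<Rightarrow> real" and \<theta> :: "'b \<Rightarrow> real" and c :: "'b \<Rightarrow> 'g::finite \<Rightarrow> real"
    and lam z T q resp p +
  fixes \<tau> :: "nat \<Rightarrow> real" and g :: "nat \<Rightarrow> 'g" and \<kappa> :: "nat \<Rightarrow> nat"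
  assumes tau_mono: "strict_mono \<tau>"
    and tau_eq: "\<tau> n = T (g n) (Suc (\<kappa> n))"
    and tau_onto: "\<exists>n. T j (Suc k) = \<tau> n"
begin

lemma tau_pos: "0 < \<tau> n"
  by (simp add: tau_eq T_Suc_pos)

lemma tau_onto_unique:
  obtains n where "T j (Suc k) = \<tau> n" "g n = j" "\<kappa> n = k"
proof -
  obtain n where n: "T j (Suc k) = \<tau> n" using tau_onto by blast
  then have "g n = j" using T_distinct[of j k "g n" "\<kappa> n"] tau_eq[of n] by simp
  moreover from this have "\<kappa> n = k"
    using n tau_eq[of n] strict_mono_eq[OF T_strict_mono, of j "Suc k" "Suc (\<kappa> n)"] by simp
  ultimately show ?thesis using that n by blast
qed

lemma p_const:
  assumes "0 < t" "t \<le> t'" and none: "\<And>n. \<tau> n < t' \<Longrightarrow> \<tau> n < t"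
  shows "p t = p t'"
proof
  fix j
  obtain k where k: "T j k < t" "t \<le> T j (Suc k)" using T_locate assms(1) .
  obtain n where "T j (Suc k) = \<tau> n" using tau_onto by blast
  then have "t' \<le> T j (Suc k)" using none[of n] k by linarith
  then show "p t j = p t' j" using p_eq[of j k t] p_eq[of j k t'] k assms by simp
qed

text \<open>Prices are constant between updates, so \<open>p t\<close> is the state just before the
  first event at or after \<open>t\<close>. Continuous time is thereby reduced to the sequence of
  events.\<close>

lemma p_at_event:
  assumes "0 < t" "t \<le> \<tau> n"
  obtains l where "l \<le> n" "t \<le> \<tau> l" "p t = p (\<tau> l)"
proof -
  define l where "l = (LEAST l. t \<le> \<tau> l)"
  have l: "t \<le> \<tau> l" "l \<le> n" unfolding l_def using assms by (auto intro: LeastI Least_le)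
  have "\<tau> i < t" if "\<tau> i < \<tau> l" for i
  proof -
    have "i < l" using that strict_mono_less[OF tau_mono] by simp
    then show ?thesis using not_less_Least[of i "\<lambda>l. t \<le> \<tau> l"] by (simp add: l_def)
  qed
  then have "p t = p (\<tau> l)" using assms l by (intro p_const) auto
  then show ?thesis using that l by blast
qed

lemma tau_unbounded: "\<exists>n. t \<le> \<tau> n"
proof -
  obtain j :: 'g where True by blast
  obtain k where "t \<le> T j k" using T_unbounded by blast
  moreover have "T j k \<le> T j (Suc k)" using T_less_Suc by (simp add: less_imp_le)
  moreover obtain n where "T j (Suc k) = \<tau> n" using tau_onto by blast
  ultimately show ?thesis by (intro exI[of _ n]) linarith
qed

lemma p_event_own: "p (\<tau> n) (g n) = q (g n) (\<kappa> n)"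
  using p_eq[of "g n" "\<kappa> n" "\<tau> n"] T_less_Suc by (simp add: tau_eq)

lemma p_event_step: "p (\<tau> (Suc n)) = (p (\<tau> n))(g n := q (g n) (Suc (\<kappa> n)))"
proof
  fix j
  have less: "\<tau> n < \<tau> (Suc n)" using strict_mono_less[OF tau_mono] by simp
  have up: "\<tau> (Suc n) \<le> T j (Suc k)" if "\<tau> n < T j (Suc k)" for k
  proof -
    obtain i where "T j (Suc k) = \<tau> i" using tau_onto by blast
    then show ?thesis using that strict_mono_less[OF tau_mono] strict_mono_less_eq[OF tau_mono] by simp
  qed
  show "p (\<tau> (Suc n)) j = ((p (\<tau> n))(g n := q (g n) (Suc (\<kappa> n)))) j"
  proof (cases "j = g n")
    case True
    then have "\<tau> (Suc n) \<le> T j (Suc (Suc (\<kappa> n)))" using up T_less_Suc by (simp add: tau_eq[of n])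
    then show ?thesis using True less p_eq[of j "Suc (\<kappa> n)" "\<tau> (Suc n)"] by (simp add: tau_eq[of n])
  next
    case False
    obtain k where k: "T j k < \<tau> n" "\<tau> n \<le> T j (Suc k)" using T_locate tau_pos .
    moreover have "\<tau> n \<noteq> T j (Suc k)" using False T_distinct[of j k "g n" "\<kappa> n"] tau_eq[of n] by auto
    ultimately have "\<tau> (Suc n) \<le> T j (Suc k)" using up[of k] by simp
    then show ?thesis using False less k p_eq[of j k] by simp
  qed
qed

lemma p_first_event: "p (\<tau> 0) j = q j 0"
proof -
  obtain n where "T j (Suc 0) = \<tau> n" using tau_onto by blast
  then have "\<tau> 0 \<le> T j (Suc 0)" using strict_mono_less_eq[OF tau_mono] by simp
  then show ?thesis using p_eq[of j 0] tau_pos by (simp add: T_0)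
qed

lemma z_ge: "(\<And>j. 0 < pr j) \<Longrightarrow> -1 \<le> z pr j"
  using z_eq[of pr j] spend_nonneg[of pr j] by (simp add: less_imp_le)

text \<open>Strong induction is needed because the response may use any earlier state in the window.
  Once these are positive, the response is at least -1 and the update factor at least
  \<open>1 - lam\<close>.\<close>

lemma p_event_pos: "0 < p (\<tau> n) j"
proof (induction n arbitrary: j rule: less_induct)
  case (less n)
  show ?case
  proof (cases n)
    case 0
    then show ?thesis by (simp add: p_first_event q_0)
  next
    case (Suc n')
    let ?d = "T (g n') (Suc (\<kappa> n')) - T (g n') (\<kappa> n')"
    obtain t where t: "T (g n') (\<kappa> n') < t" "t \<le> \<tau> n'" "min (z (p t) (g n')) 1 \<le> resp (g n') (\<kappa> n')"
      using resp_lower[of "g n'" "\<kappa> n'"] tau_eq[of n'] by auto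
    have "0 < t" using t(1) T_nonneg[of "g n'" "\<kappa> n'"] by linarith
    then obtain l where l: "l \<le> n'" "p t = p (\<tau> l)" using p_at_event t(2) by metis
    then have "-1 \<le> z (p t) (g n')" using less Suc by (intro z_ge) auto
    then have r: "-1 \<le> resp (g n') (\<kappa> n')" using t(3) by linarith
    have d: "0 < ?d" "?d \<le> 1" using T_less_Suc T_gap by auto
    have "lam * ?d < 1"
    proof -
      have "lam * ?d \<le> lam" using d lam_pos by simp
      then show ?thesis using lam_le by simp
    qed
    moreover have "lam * ?d * (-1) \<le> lam * ?d * resp (g n') (\<kappa> n')"
      using r d lam_pos by (intro mult_left_mono) auto
    moreover have "lam * resp (g n') (\<kappa> n') * ?d = lam * ?d * resp (g n') (\<kappa> n')" by (simp only: mult_ac)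
    ultimately have "0 < 1 + lam * resp (g n') (\<kappa> n') * ?d" by linarith
    moreover have "0 < q (g n') (\<kappa> n')" using less Suc p_event_own[of n'] by (metis lessI)
    ultimately have "0 < q (g n') (Suc (\<kappa> n'))" unfolding q_Suc by simp
    then show ?thesis using less Suc p_event_step[of n'] by simp
  qed
qed

abbreviation win :: "nat \<Rightarrow> nat set" where
  "win n \<equiv> {l. l < n \<and> T (g n) (\<kappa> n) < \<tau> l}"

lemma window_state:
  assumes "T (g n) (\<kappa> n) < t" "t \<le> \<tau> n"
  obtains l where "l \<in> insert n (win n)" "p t = p (\<tau> l)"
proof -
  have "0 < t" using assms(1) T_nonneg[of "g n" "\<kappa> n"] by linarith
  then obtain l where l: "l \<le> n" "t \<le> \<tau> l" "p t = p (\<tau> l)" using p_at_event assms(2) by metis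
  then have "l \<in> insert n (win n)" using assms by auto
  then show ?thesis using that l by blast
qed

lemma resp_event_ge: "-1 \<le> resp (g n) (\<kappa> n)"
proof -
  obtain t where t: "T (g n) (\<kappa> n) < t" "t \<le> \<tau> n" "min (z (p t) (g n)) 1 \<le> resp (g n) (\<kappa> n)"
    using resp_lower[of "g n" "\<kappa> n"] tau_eq[of n] by auto
  obtain l where "p t = p (\<tau> l)" using window_state t(1,2) .
  then have "-1 \<le> z (p t) (g n)" by (intro z_ge) (simp add: p_event_pos)
  then show ?thesis using t(3) by linarith
qed

sublocale update_sequence e \<theta> c lam g "\<lambda>n. \<tau> n - T (g n) (\<kappa> n)" "\<lambda>n. resp (g n) (\<kappa> n)"
  "\<lambda>n. p (\<tau> n)" win
proof
  fix n l l' n' :: nat and k :: 'g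
  show "0 < lam" "lam \<le> 1 / 23.46" by (rule lam_pos lam_le)+
  show "0 < \<tau> n - T (g n) (\<kappa> n)" "\<tau> n - T (g n) (\<kappa> n) \<le> 1"
    using T_less_Suc T_gap by (auto simp: tau_eq)
  show "-1 \<le> resp (g n) (\<kappa> n)" by (rule resp_event_ge)
  show "resp (g n) (\<kappa> n) \<le> 1" using resp_upper[of "g n" "\<kappa> n"] by auto
  show "0 < p (\<tau> n) k" by (rule p_event_pos)
  show "p (\<tau> (Suc n)) = (p (\<tau> n))
      (g n := p (\<tau> n) (g n) * (1 + lam * resp (g n) (\<kappa> n) * (\<tau> n - T (g n) (\<kappa> n))))"
    unfolding p_event_step p_event_own q_Suc by (simp add: tau_eq)
  show "l < n" if "l \<in> win n" using that by simp
  show "l' \<in> win n" if "l \<in> win n" "l \<le> l'" "l' < n"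
    using that strict_mono_less_eq[OF tau_mono, of l l'] by (auto intro: order.strict_trans2)
  show "g l \<noteq> g n" if "l \<in> win n"
  proof
    assume eq: "g l = g n"
    have "\<tau> l < \<tau> n" using that strict_mono_less[OF tau_mono] by simp
    then have "Suc (\<kappa> l) < Suc (\<kappa> n)" "\<kappa> n < Suc (\<kappa> l)"
      using that eq by (auto simp: tau_eq T_less_iff)
    then show False by simp
  qed
  \<comment> \<open>The intervals between consecutive updates of one good are disjoint, so
    \<open>\<tau> l\<close> lies in only one of them.\<close>
  show "n = n'" if "l \<in> win n" "l \<in> win n'" "g n = g n'"
  proof -
    have "\<tau> l \<le> \<tau> n" "\<tau> l \<le> \<tau> n'" using that strict_mono_less_eq[OF tau_mono] by auto
    then have "\<kappa> n = \<kappa> n'"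
      using that tau_eq[of n] tau_eq[of n'] by (intro T_interval_unique[of "g n" _ "\<tau> l"]) auto
    then have "\<tau> n = \<tau> n'" using that by (simp add: tau_eq)
    then show ?thesis using strict_mono_eq[OF tau_mono] by simp
  qed
  show "(\<Sum>l\<in>{l \<in> win n. g l = k}. \<tau> l - T (g l) (\<kappa> l)) \<le> 2"
  proof -
    let ?S = "{l \<in> win n. g l = k}"
    have fin: "finite ?S" by (rule finite_subset[of _ "{..<n}"]) auto
    have inj: "inj_on \<kappa> ?S"
    proof (rule inj_onI)
      fix a b assume "a \<in> ?S" "b \<in> ?S" "\<kappa> a = \<kappa> b"
      then have "\<tau> a = \<tau> b" by (simp add: tau_eq)
      then show "a = b" using strict_mono_eq[OF tau_mono] by simp
    qed
    have "(\<Sum>l\<in>?S. \<tau> l - T (g l) (\<kappa> l)) = (\<Sum>l\<in>?S. T k (Suc (\<kappa> l)) - T k (\<kappa> l))"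
      by (intro sum.cong) (auto simp: tau_eq)
    also have "\<dots> = (\<Sum>i\<in>\<kappa> ` ?S. T k (Suc i) - T k i)"
      using inj by (simp add: sum.reindex)
    \<comment> \<open>The window itself lasts at most one unit; the extra unit belongs to the first
      update of \<open>k\<close> in it.\<close>
    also have "\<dots> \<le> \<tau> n - T (g n) (\<kappa> n) + 1"
    proof (rule sum_durations_le)
      show "T (g n) (\<kappa> n) \<le> \<tau> n" using T_less_Suc by (simp add: tau_eq less_imp_le)
      fix i assume "i \<in> \<kappa> ` ?S"
      then obtain l where l: "l < n" "T (g n) (\<kappa> n) < \<tau> l" "\<tau> l = T k (Suc i)" by (auto simp: tau_eq[symmetric])
      moreover have "\<tau> l \<le> \<tau> n" using l(1) strict_mono_less_eq[OF tau_mono, of l n] by simp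
      ultimately show "T (g n) (\<kappa> n) < T k (Suc i) \<and> T k (Suc i) \<le> \<tau> n" by simp
    qed (use fin in simp)
    also have "\<dots> \<le> 2" using T_gap[of "g n" "\<kappa> n"] by (simp add: tau_eq)
    finally show ?thesis .
  qed
  show "\<exists>a\<in>insert n (win n). \<exists>b\<in>insert n (win n).
      min (spend (p (\<tau> a)) (g n) / p (\<tau> a) (g n) - 1) 1 \<le> resp (g n) (\<kappa> n) \<and>
      resp (g n) (\<kappa> n) \<le> min (spend (p (\<tau> b)) (g n) / p (\<tau> b) (g n) - 1) 1"
  proof -
    obtain t where t: "T (g n) (\<kappa> n) < t" "t \<le> \<tau> n" "min (z (p t) (g n)) 1 \<le> resp (g n) (\<kappa> n)"
      using resp_lower[of "g n" "\<kappa> n"] tau_eq[of n] by auto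
    obtain a where a: "a \<in> insert n (win n)" "p t = p (\<tau> a)" using window_state t(1,2) .
    obtain s where s: "T (g n) (\<kappa> n) < s" "s \<le> \<tau> n" "resp (g n) (\<kappa> n) \<le> min (z (p s) (g n)) 1"
      using resp_upper[of "g n" "\<kappa> n"] tau_eq[of n] by auto
    obtain b where b: "b \<in> insert n (win n)" "p s = p (\<tau> b)" using window_state s(1,2) .
    have "z (p (\<tau> l)) (g n) = spend (p (\<tau> l)) (g n) / p (\<tau> l) (g n) - 1" for l
      by (intro z_eq p_event_pos)
    then show ?thesis using a b t(3) s(3) by (intro bexI[of _ a] bexI[of _ b]) simp_all
  qed
qed

end

section \<open>Positivity, boundedness and finite total squared response of a run\<close>

context tatonnement_run
begin

lemma enumeration_exists: "\<exists>\<tau> g \<kappa>. enumerated_run e \<theta> c lam z T q resp p \<tau> g \<kappa>"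
proof -
  define A where "A = (\<Union>j. range (\<lambda>k. T j (Suc k)))"
  obtain j :: 'g where True by blast
  have "inj (\<lambda>k. T j (Suc k))"
    using strict_mono_eq[OF T_strict_mono, of j] by (auto intro!: injI)
  then have "infinite (range (\<lambda>k. T j (Suc k)))" by (rule range_inj_infinite)
  then have inf: "infinite A" unfolding A_def by (meson UNIV_I UN_upper finite_subset)
  have fin: "finite (A \<inter> {..t})" for t
  proof -
    have "finite (range (\<lambda>k. T j (Suc k)) \<inter> {..t})" for j
    proof -
      obtain K where K: "t \<le> T j K" using T_unbounded by blast
      have "range (\<lambda>k. T j (Suc k)) \<inter> {..t} \<subseteq> (\<lambda>k. T j (Suc k)) ` {..<K}"
      proof
        fix x assume "x \<in> range (\<lambda>k. T j (Suc k)) \<inter> {..t}"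
        then obtain k where k: "x = T j (Suc k)" "x \<le> t" by auto
        then have "T j (Suc k) \<le> T j K" using K by linarith
        then show "x \<in> (\<lambda>k. T j (Suc k)) ` {..<K}" using k T_le_iff by auto
      qed
      then show ?thesis by (rule finite_subset) simp
    qed
    then have "finite (\<Union>j. range (\<lambda>k. T j (Suc k)) \<inter> {..t})" by (intro finite_UN_I) auto
    then show ?thesis unfolding A_def by (rule rev_finite_subset) blast
  qed
  obtain \<tau> :: "nat \<Rightarrow> real" where \<tau>: "strict_mono \<tau>" "range \<tau> = A"
    using enumerate_locally_finite[OF inf fin] .
  have "\<exists>j k. \<tau> n = T j (Suc k)" for n
  proof -
    have "\<tau> n \<in> A" using \<tau>(2) by blast
    then show ?thesis by (auto simp: A_def)
  qed
  then obtain g \<kappa> where *: "\<And>n. \<tau> n = T (g n) (Suc (\<kappa> n))" by metis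
  have **: "\<exists>n. T j (Suc k) = \<tau> n" for j k
  proof -
    have "T j (Suc k) \<in> range \<tau>" unfolding \<tau>(2) by (auto simp: A_def)
    then show ?thesis by auto
  qed
  have "enumerated_run e \<theta> c lam z T q resp p \<tau> g \<kappa>"
    by unfold_locales (rule \<tau>(1) * **)+
  then show ?thesis by blast
qed

lemma p_pos: "0 \<le> t \<Longrightarrow> 0 < p t j"
proof -
  assume t: "0 \<le> t"
  obtain \<tau> g \<kappa> where "enumerated_run e \<theta> c lam z T q resp p \<tau> g \<kappa>" using enumeration_exists by blast
  then interpret enumerated_run e \<theta> c lam z T q resp p \<tau> g \<kappa> .
  show ?thesis
  proof (cases "t = 0")
    case True
    then show ?thesis by (simp add: p_0 q_0)
  next
    case False
    obtain n where "t \<le> \<tau> n" using tau_unbounded by blast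
    then obtain l where "p t = p (\<tau> l)" using p_at_event[of t n] False t by auto
    then show ?thesis by (simp add: p_event_pos)
  qed
qed

lemma q_eq: "q j k = p (T j (Suc k)) j"
  using p_eq[of j k "T j (Suc k)"] T_less_Suc by simp

lemma q_pos: "0 < q j k"
  unfolding q_eq by (intro p_pos T_nonneg)

lemma z_p: "0 \<le> t \<Longrightarrow> z (p t) j = spend (p t) j / p t j - 1"
  by (intro z_eq p_pos)

lemma resp_le: "resp j k \<le> 1"
  using resp_upper[of j k] by auto

lemma resp_ge: "-1 \<le> resp j k"
proof -
  obtain t where t: "T j k < t" "min (z (p t) j) 1 \<le> resp j k" using resp_lower by blast
  then have t0: "0 \<le> t" using T_nonneg[of j k] by linarith
  have "-1 \<le> z (p t) j" unfolding z_p[OF t0] using spend_nonneg[of "p t" j] p_pos[OF t0, of j] by simp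
  then show ?thesis using t by linarith
qed

text \<open>This follows from the summed inequality \<open>potential_descent\<close>, not from
  monotonicity. It keeps the Leontief aggregates away from zero later on.\<close>

lemma potential_le_initial:
  assumes "0 < t"
  shows "potential (p t) \<le> potential (p 0)"
proof -
  obtain \<tau> g \<kappa> where "enumerated_run e \<theta> c lam z T q resp p \<tau> g \<kappa>" using enumeration_exists by blast
  then interpret enumerated_run e \<theta> c lam z T q resp p \<tau> g \<kappa> .
  obtain n where "t \<le> \<tau> n" using tau_unbounded by blast
  then obtain l where l: "p t = p (\<tau> l)" using p_at_event[of t n] assms by auto
  have "0 \<le> (\<Sum>n<l. p (\<tau> n) (g n) * (resp (g n) (\<kappa> n))\<^sup>2 * (\<tau> n - T (g n) (\<kappa> n)))"
    by (intro sum_nonneg mult_nonneg_nonneg) (auto simp: p_event_pos less_imp_le, simp add: tau_eq T_less_Suc less_imp_le)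
  then have "0 \<le> lam / 2 * (\<Sum>n<l. p (\<tau> n) (g n) * (resp (g n) (\<kappa> n))\<^sup>2 * (\<tau> n - T (g n) (\<kappa> n)))"
    using lam_pos by simp
  moreover have "p (\<tau> 0) = p 0" by (simp add: fun_eq_iff p_first_event p_0)
  ultimately show ?thesis using potential_descent[of l] l by simp
qed

text \<open>With \<open>E\<close> the total budget, a price above \<open>E\<close> has demand at
  most 1 during the whole interval, so it does not rise. A price of at most \<open>E\<close> can at
  most double in one update.\<close>

lemma q_bounded:
  obtains B where "\<And>j k. q j k \<le> B"
proof -
  define E where "E = (\<Sum>i\<in>UNIV. e i)"
  have E: "0 < E" unfolding E_def by (intro sum_pos) (auto simp: e_pos)
  have "q j k \<le> max (q j 0) (2 * E)" for j k
  proof (induction k)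
    case (Suc k)
    let ?d = "T j (Suc k) - T j k"
    have d: "0 < ?d" "?d \<le> 1" using T_less_Suc T_gap by auto
    have qk: "0 < q j k" by (rule q_pos)
    show ?case
    proof (cases "q j k \<le> E")
      case True
      have "resp j k * ?d \<le> 1" using d resp_le[of j k] mult_mono[of "resp j k" 1 ?d 1] by simp
      then have "lam * (resp j k * ?d) \<le> lam * 1" using lam_pos by (intro mult_left_mono) auto
      then have "1 + lam * resp j k * ?d \<le> 2" using lam_le by (simp add: mult.assoc)
      then have "q j (Suc k) \<le> E * 2" unfolding q_Suc
        using True qk E by (intro order.trans[OF mult_left_mono mult_right_mono]) auto
      then show ?thesis by simp
    next
      case False
      obtain t where t: "T j k < t" "t \<le> T j (Suc k)" "resp j k \<le> min (z (p t) j) 1"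
        using resp_upper by blast
      then have t0: "0 \<le> t" using T_nonneg[of j k] by linarith
      have "spend (p t) j \<le> E" unfolding E_def using p_pos[OF t0] by (intro spend_le_budgets)
      then have "spend (p t) j / p t j \<le> 1" using False p_eq[OF t(1,2)] qk by simp
      then have "resp j k \<le> 0" using t(3) z_p[OF t0, of j] by linarith
      then have "lam * resp j k * ?d \<le> 0" using lam_pos d by (simp add: mult_le_0_iff)
      then have "q j k * (1 + lam * resp j k * ?d) \<le> q j k * 1" using qk by (intro mult_left_mono) auto
      then show ?thesis using Suc unfolding q_Suc by simp
    qed
  qed simp
  moreover have "q j 0 \<le> (\<Sum>j\<in>UNIV. q j 0)" for j
    by (intro member_le_sum) (auto simp: q_pos less_imp_le)
  ultimately have "q j k \<le> max (\<Sum>j\<in>UNIV. q j 0) (2 * E)" for j k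
    by (meson max.mono order.refl order.trans)
  then show ?thesis using that by blast
qed

lemma p_bounded:
  obtains B where "\<And>t j. 0 \<le> t \<Longrightarrow> p t j \<le> B"
proof -
  obtain B where B: "\<And>j k. q j k \<le> B" using q_bounded by blast
  have "p t j \<le> B" if "0 \<le> t" for t j
  proof (cases "t = 0")
    case True
    then show ?thesis using B by (simp add: p_0)
  next
    case False
    then obtain k where "T j k < t" "t \<le> T j (Suc k)" using T_locate[of t j] \<open>0 \<le> t\<close> by auto
    then show ?thesis using B p_eq by simp
  qed
  then show ?thesis using that by blast
qed

text \<open>The potential is bounded below along the run, so \<open>potential_descent\<close> bounds
  the chronological sum; the updates of one good form an injectively indexed part of it.\<close>

lemma summable_squared_response:
  "summable (\<lambda>k. q j k * (resp j k)\<^sup>2 * (T j (Suc k) - T j k))"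
proof -
  obtain \<tau> g \<kappa> where "enumerated_run e \<theta> c lam z T q resp p \<tau> g \<kappa>" using enumeration_exists by blast
  then interpret enumerated_run e \<theta> c lam z T q resp p \<tau> g \<kappa> .
  obtain B where B: "\<And>t j. 0 \<le> t \<Longrightarrow> p t j \<le> B" using p_bounded by blast
  obtain K where K: "\<And>p. \<lbrakk>\<And>j. 0 < p j; \<And>j. p j \<le> B\<rbrakk> \<Longrightarrow> K \<le> potential p"
    using potential_bounded_below[of B] by metis
  define a where "a n = p (\<tau> n) (g n) * (resp (g n) (\<kappa> n))\<^sup>2 * (\<tau> n - T (g n) (\<kappa> n))" for n
  have a0: "0 \<le> a n" for n
    unfolding a_def by (intro mult_nonneg_nonneg) (auto simp: p_event_pos less_imp_le, simp add: tau_eq T_less_Suc less_imp_le)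
  have "(\<Sum>n<N. a n) \<le> 2 / lam * (potential (p (\<tau> 0)) - K)" for N
  proof -
    have "K \<le> potential (p (\<tau> N))" using p_event_pos B tau_pos by (intro K) (auto simp: less_imp_le)
    then have "lam / 2 * (\<Sum>n<N. a n) \<le> potential (p (\<tau> 0)) - K"
      using potential_descent[of N] unfolding a_def by linarith
    then show ?thesis using lam_pos by (simp add: field_simps)
  qed
  then have suma: "summable a" using a0 by (intro summableI_nonneg_bounded)
  have "\<exists>n. T j (Suc k) = \<tau> n \<and> g n = j \<and> \<kappa> n = k" for k
    using tau_onto_unique[of j k] by metis
  then obtain idx where idx: "\<And>k. T j (Suc k) = \<tau> (idx k)" "\<And>k. g (idx k) = j" "\<And>k. \<kappa> (idx k) = k"
    by metis
  have "inj idx" by (rule injI) (metis idx(3))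
  then have "summable (a \<circ> idx)"
    using suma a0 by (intro summable_reindex) auto
  moreover have "(a \<circ> idx) k = q j k * (resp j k)\<^sup>2 * (T j (Suc k) - T j k)" for k
    using p_event_own[of "idx k"] by (simp add: a_def idx)
  ultimately show ?thesis by (auto elim!: iffD1[OF summable_cong, rotated])
qed

end

section \<open>Limit points\<close>

context tatonnement_run
begin

text \<open>Increments are linear in the response while only its square is summable;
  \<open>\<bar>r\<bar> \<le> r\<^sup>2 / (2 * \<epsilon>) + \<epsilon> / 2\<close> mediates. The
  first term is then a tail of a convergent series, the second is small with
  \<open>\<epsilon>\<close>.\<close>

lemma q_increment_le:
  assumes "k \<le> k'" and eps: "0 < \<epsilon>" and B: "\<And>k. q j k \<le> B"
  shows "\<bar>q j k' - q j k\<bar> \<le> lam / (2 * \<epsilon>) * (\<Sum>i\<in>{k..<k'}. q j i * (resp j i)\<^sup>2 * (T j (Suc i) - T j i))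
           + lam * \<epsilon> / 2 * B * (T j k' - T j k)"
  using assms(1)
proof (induction k' rule: dec_induct)
  case (step n)
  let ?d = "T j (Suc n) - T j n" and ?r = "resp j n"
  have d: "0 < ?d" using T_less_Suc by simp
  have qn: "0 < q j n" by (rule q_pos)
  have "0 \<le> (\<bar>?r\<bar> - \<epsilon>)\<^sup>2" by simp
  then have "2 * \<epsilon> * \<bar>?r\<bar> \<le> ?r\<^sup>2 + \<epsilon>\<^sup>2" by (simp add: power2_diff mult_ac)
  then have r: "\<bar>?r\<bar> \<le> ?r\<^sup>2 / (2 * \<epsilon>) + \<epsilon> / 2" using eps by (simp add: field_simps power2_eq_square)
  have "q j (Suc n) - q j n = lam * q j n * ?d * ?r"
    unfolding q_Suc by (simp add: algebra_simps)
  then have "\<bar>q j (Suc n) - q j n\<bar> = lam * q j n * ?d * \<bar>?r\<bar>"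
    using d qn lam_pos by (simp add: abs_mult)
  also have "\<dots> \<le> lam * q j n * ?d * (?r\<^sup>2 / (2 * \<epsilon>) + \<epsilon> / 2)"
    using r d qn lam_pos by (intro mult_left_mono) auto
  also have "\<dots> = lam / (2 * \<epsilon>) * (q j n * ?r\<^sup>2 * ?d) + lam * \<epsilon> / 2 * ?d * q j n"
    by (simp add: distrib_left mult_ac)
  also have "\<dots> \<le> lam / (2 * \<epsilon>) * (q j n * ?r\<^sup>2 * ?d) + lam * \<epsilon> / 2 * ?d * B"
    using B d eps lam_pos by (intro add_left_mono mult_left_mono) auto
  finally have "\<bar>q j (Suc n) - q j n\<bar> \<le> lam / (2 * \<epsilon>) * (q j n * ?r\<^sup>2 * ?d) + lam * \<epsilon> / 2 * B * ?d"
    by (simp add: mult_ac)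
  moreover have "\<bar>q j (Suc n) - q j k\<bar> \<le> \<bar>q j (Suc n) - q j n\<bar> + \<bar>q j n - q j k\<bar>" by linarith
  moreover have "lam / (2 * \<epsilon>) * (\<Sum>i\<in>{k..<Suc n}. q j i * (resp j i)\<^sup>2 * (T j (Suc i) - T j i)) =
      lam / (2 * \<epsilon>) * (\<Sum>i\<in>{k..<n}. q j i * (resp j i)\<^sup>2 * (T j (Suc i) - T j i))
      + lam / (2 * \<epsilon>) * (q j n * ?r\<^sup>2 * ?d)"
    using step.hyps by (simp add: distrib_left)
  moreover have "lam * \<epsilon> / 2 * B * (T j (Suc n) - T j k) =
      lam * \<epsilon> / 2 * B * (T j n - T j k) + lam * \<epsilon> / 2 * B * ?d"
    by (simp only: distrib_left[symmetric]) simp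
  ultimately show ?case using step.IH by linarith
qed simp

lemma p_slow:
  assumes "0 < \<eta>" "0 \<le> L"
  shows "\<exists>t0>0. \<forall>t\<ge>t0. \<forall>t'. t \<le> t' \<and> t' \<le> t + L \<longrightarrow> \<bar>p t' j - p t j\<bar> \<le> \<eta>"
proof -
  obtain B where B: "\<And>j k. q j k \<le> B" using q_bounded by blast
  have B0: "0 < B" using B[of j 0] q_pos[of j 0] by linarith
  \<comment> \<open>Makes the term linear in elapsed time at most \<open>\<eta> / 2\<close>. The
    span is \<open>L + 1\<close> because the price current at \<open>t\<close> may have been set up
    to one unit earlier.\<close>
  define \<epsilon> where "\<epsilon> = \<eta> / (lam * B * (L + 1))"
  have eps: "0 < \<epsilon>" unfolding \<epsilon>_def using assms B0 lam_pos by simp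
  define a where "a k = q j k * (resp j k)\<^sup>2 * (T j (Suc k) - T j k)" for k
  have "0 < \<epsilon> * \<eta> / lam" using eps assms lam_pos by simp
  then obtain K where K: "\<And>m n. m \<ge> K \<Longrightarrow> norm (sum a {m..<n}) < \<epsilon> * \<eta> / lam"
    using summable_squared_response[of j] unfolding summable_Cauchy a_def by meson
  have "\<bar>p t' j - p t j\<bar> \<le> \<eta>" if t: "T j K + 1 \<le> t" "t \<le> t'" "t' \<le> t + L" for t t'
  proof -
    have pos: "0 < t" "0 < t'" using t T_nonneg[of j K] by linarith+
    obtain k where k: "T j k < t" "t \<le> T j (Suc k)" using T_locate pos(1) .
    obtain k' where k': "T j k' < t'" "t' \<le> T j (Suc k')" using T_locate pos(2) .
    have "T j K \<le> T j k" using k t T_gap[of j k] by linarith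
    then have Kk: "K \<le> k" by (simp add: T_le_iff)
    have "T j k < T j (Suc k')" using k k' t by linarith
    then have kk: "k \<le> k'" by (simp add: T_less_iff)
    have dT: "T j k' - T j k \<le> L + 1" using k k' t T_gap[of j k] by linarith
    have "\<bar>q j k' - q j k\<bar> \<le> lam / (2 * \<epsilon>) * sum a {k..<k'} + lam * \<epsilon> / 2 * B * (T j k' - T j k)"
      using q_increment_le[OF kk eps B] unfolding a_def .
    also have "\<dots> \<le> lam / (2 * \<epsilon>) * (\<epsilon> * \<eta> / lam) + lam * \<epsilon> / 2 * B * (L + 1)"
      using K[OF Kk, of k'] dT eps lam_pos B0 by (intro add_mono mult_left_mono) auto
    also have "\<dots> = \<eta> / 2 + \<eta> / 2"
    proof -
      have "lam * B * (L + 1) \<noteq> 0" using lam_pos B0 assms(2) by simp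
      then have "\<epsilon> * (lam * B * (L + 1)) = \<eta>" by (simp add: \<epsilon>_def)
      then have "lam * \<epsilon> / 2 * B * (L + 1) = \<eta> / 2" by (simp add: mult_ac)
      then show ?thesis using eps lam_pos by simp
    qed
    finally show ?thesis using p_eq k k' by simp
  qed
  moreover have "0 < T j K + 1" using T_nonneg[of j K] by linarith
  ultimately show ?thesis by blast
qed

lemma p_slow_seq:
  assumes s: "filterlim s at_top sequentially" and lim: "(\<lambda>n. p (s n) j) \<longlonglongrightarrow> l"
    and r: "\<And>n. s n \<le> r n" "\<And>n. r n \<le> s n + L" and "0 \<le> L"
  shows "(\<lambda>n. p (r n) j) \<longlonglongrightarrow> l"
proof -
  have "(\<lambda>n. p (r n) j - p (s n) j) \<longlonglongrightarrow> 0"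
  proof (rule LIMSEQ_I)
    fix \<eta> :: real assume "0 < \<eta>"
    then obtain t0 where t0: "\<forall>t\<ge>t0. \<forall>t'. t \<le> t' \<and> t' \<le> t + L \<longrightarrow> \<bar>p t' j - p t j\<bar> \<le> \<eta> / 2"
      using p_slow[of "\<eta> / 2" L j] \<open>0 \<le> L\<close> by auto
    have "eventually (\<lambda>n. t0 \<le> s n) sequentially" using s by (simp add: filterlim_at_top)
    then obtain N where "\<forall>n\<ge>N. t0 \<le> s n" by (auto simp: eventually_sequentially)
    then have "\<forall>n\<ge>N. \<bar>p (r n) j - p (s n) j\<bar> \<le> \<eta> / 2" using t0 r by blast
    then show "\<exists>N. \<forall>n\<ge>N. norm (p (r n) j - p (s n) j - 0) < \<eta>"
      using \<open>0 < \<eta>\<close> by (intro exI[of _ N]) (auto intro: le_less_trans)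
  qed
  from tendsto_add[OF this lim] show ?thesis by simp
qed

section \<open>Growth and decline of a price under excess demand of one sign\<close>

lemma resp_ge_if:
  assumes "\<epsilon> \<le> 1" "\<And>t. T j k < t \<Longrightarrow> t \<le> T j (Suc k) \<Longrightarrow> \<epsilon> \<le> z (p t) j"
  shows "\<epsilon> \<le> resp j k"
  using resp_lower[of j k] assms by fastforce

lemma resp_le_if:
  assumes "\<And>t. T j k < t \<Longrightarrow> t \<le> T j (Suc k) \<Longrightarrow> z (p t) j \<le> \<epsilon>"
  shows "resp j k \<le> \<epsilon>"
  using resp_upper[of j k] assms by fastforce

text \<open>Compound growth dominates linear growth:
  \<open>(1 + H) * (1 + h) \<ge> 1 + H + h\<close>. The bound depends on the elapsed time only, not
  on the number of updates.\<close>

lemma q_growth: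
  assumes "k \<le> k'" "0 \<le> \<epsilon>" "\<epsilon> \<le> 1" "\<And>t. T j k < t \<Longrightarrow> t \<le> T j k' \<Longrightarrow> \<epsilon> \<le> z (p t) j"
  shows "q j k * (1 + lam * \<epsilon> * (T j k' - T j k)) \<le> q j k'"
  using assms(1,4)
proof (induction k' rule: dec_induct)
  case (step n)
  let ?d = "T j (Suc n) - T j n" and ?D = "T j n - T j k"
  have IH: "q j k * (1 + lam * \<epsilon> * ?D) \<le> q j n"
    using step.prems T_less_Suc[of j n] by (intro step.IH) auto
  have d: "0 < ?d" "0 \<le> ?D" using T_less_Suc step.hyps by (auto simp: T_le_iff)
  have "\<epsilon> \<le> resp j n"
  proof (rule resp_ge_if)
    fix t assume "T j n < t" "t \<le> T j (Suc n)"
    moreover have "T j k \<le> T j n" using d by simp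
    ultimately show "\<epsilon> \<le> z (p t) j" using step.prems[of t] by simp
  qed fact
  then have "lam * \<epsilon> * ?d \<le> lam * resp j n * ?d"
    using lam_pos d by (intro mult_right_mono mult_left_mono) auto
  then have "q j n * (1 + lam * \<epsilon> * ?d) \<le> q j (Suc n)"
    unfolding q_Suc using q_pos[of j n] by (intro mult_left_mono) auto
  moreover have e0: "0 \<le> lam * \<epsilon> * ?d" "0 \<le> lam * \<epsilon> * ?D" using lam_pos assms(2) d by auto
  have "q j k * (1 + lam * \<epsilon> * ?D) * (1 + lam * \<epsilon> * ?d) \<le> q j n * (1 + lam * \<epsilon> * ?d)"
    using IH e0 by (intro mult_right_mono) auto
  moreover have "q j k * (1 + lam * \<epsilon> * (T j (Suc n) - T j k))
      \<le> q j k * ((1 + lam * \<epsilon> * ?D) * (1 + lam * \<epsilon> * ?d))"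
  proof (intro mult_left_mono)
    have "0 \<le> (lam * \<epsilon> * ?D) * (lam * \<epsilon> * ?d)" using e0 by (rule mult_nonneg_nonneg[rotated])
    moreover have "lam * \<epsilon> * (T j (Suc n) - T j k) = lam * \<epsilon> * ?D + lam * \<epsilon> * ?d" by (simp add: algebra_simps)
    ultimately show "1 + lam * \<epsilon> * (T j (Suc n) - T j k) \<le> (1 + lam * \<epsilon> * ?D) * (1 + lam * \<epsilon> * ?d)"
      unfolding distrib_left distrib_right by linarith
  qed (simp add: q_pos less_imp_le)
  ultimately show ?case by (simp add: mult.assoc)
qed simp

text \<open>The product form records a decay like \<open>1 / t\<close>, and the induction rests on
  \<open>(1 - h) * (1 + H + h) \<le> 1 + H\<close>.\<close>

lemma q_decline:
  assumes "k \<le> k'" "0 \<le> \<epsilon>" "\<And>t. T j k < t \<Longrightarrow> t \<le> T j k' \<Longrightarrow> z (p t) j \<le> - \<epsilon>"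
  shows "q j k' * (1 + lam * \<epsilon> * (T j k' - T j k)) \<le> q j k"
  using assms(1,3)
proof (induction k' rule: dec_induct)
  case (step n)
  let ?d = "T j (Suc n) - T j n" and ?D = "T j n - T j k"
  have IH: "q j n * (1 + lam * \<epsilon> * ?D) \<le> q j k"
    using step.prems T_less_Suc[of j n] by (intro step.IH) auto
  have d: "0 < ?d" "0 \<le> ?D" using T_less_Suc step.hyps by (auto simp: T_le_iff)
  have "resp j n \<le> - \<epsilon>"
  proof (rule resp_le_if)
    fix t assume "T j n < t" "t \<le> T j (Suc n)"
    moreover have "T j k \<le> T j n" using d by simp
    ultimately show "z (p t) j \<le> - \<epsilon>" using step.prems[of t] by simp
  qed
  then have "lam * resp j n * ?d \<le> lam * (- \<epsilon>) * ?d"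
    using lam_pos d by (intro mult_right_mono mult_left_mono) auto
  define h where "h = lam * \<epsilon> * ?d"
  define H where "H = lam * \<epsilon> * ?D"
  have e0: "0 \<le> h" "0 \<le> H" using lam_pos assms(2) d by (auto simp: h_def H_def)
  have "q j (Suc n) \<le> q j n * (1 - h)"
    unfolding q_Suc using q_pos[of j n] \<open>lam * resp j n * ?d \<le> _\<close> by (intro mult_left_mono) (auto simp: h_def)
  then have "q j (Suc n) * (1 + H + h) \<le> q j n * (1 - h) * (1 + H + h)"
    using e0 by (intro mult_right_mono) auto
  also have "\<dots> = q j n * (1 + H) - q j n * (h * (H + h))" by (simp add: algebra_simps)
  also have "\<dots> \<le> q j n * (1 + H)" using e0 q_pos[of j n] by simp
  also have "\<dots> \<le> q j k" using IH by (simp add: H_def)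
  finally show ?case by (simp add: H_def h_def algebra_simps)
qed simp

lemma price_change_over_span:
  assumes "0 < s"
  obtains v where "s \<le> v" "v \<le> s + 3"
    "\<And>\<epsilon>. \<lbrakk>0 \<le> \<epsilon>; \<epsilon> \<le> 1; \<forall>t. s \<le> t \<and> t \<le> s + 3 \<longrightarrow> \<epsilon> \<le> z (p t) j\<rbrakk>
       \<Longrightarrow> p v j * (1 + lam * \<epsilon>) \<le> p (s + 3) j"
    "\<And>\<epsilon>. \<lbrakk>0 \<le> \<epsilon>; \<forall>t. s \<le> t \<and> t \<le> s + 3 \<longrightarrow> z (p t) j \<le> - \<epsilon>\<rbrakk>
       \<Longrightarrow> p (s + 3) j * (1 + lam * \<epsilon>) \<le> p v j"
proof -
  obtain k0 where k0: "T j k0 < s" "s \<le> T j (Suc k0)" using T_locate assms .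
  \<comment> \<open>Update \<open>k\<close> occurs before \<open>s + 1\<close> and the last update
    \<open>k'\<close> before \<open>s + 3\<close> not before \<open>s + 2\<close>, so more than one
    unit of time separates them; this explains the span 3.\<close>
  define k where "k = Suc k0"
  obtain k' where k': "T j k' < s + 3" "s + 3 \<le> T j (Suc k')" using T_locate[of "s + 3" j] assms by auto
  have k: "s \<le> T j k" "T j k + 1 \<le> T j k'" "s \<le> T j (Suc k)" "T j (Suc k) \<le> s + 3"
    unfolding k_def
    using k0 k' T_gap[of j k0] T_gap[of j k'] T_gap[of j "Suc k0"] T_less_Suc[of j "Suc k0"] by linarith+
  then have "T j k \<le> T j k'" by linarith
  then have kk: "k \<le> k'" by (simp add: T_le_iff)
  have p3: "p (s + 3) j = q j k'" using k' by (rule p_eq)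
  have stretch: "lam * \<epsilon> \<le> lam * \<epsilon> * (T j k' - T j k)" if "0 \<le> \<epsilon>" for \<epsilon>
    using k lam_pos that mult_left_mono[of 1 "T j k' - T j k" "lam * \<epsilon>"] by simp
  have "p (T j (Suc k)) j * (1 + lam * \<epsilon>) \<le> p (s + 3) j"
    if "0 \<le> \<epsilon>" "\<epsilon> \<le> 1" "\<forall>t. s \<le> t \<and> t \<le> s + 3 \<longrightarrow> \<epsilon> \<le> z (p t) j" for \<epsilon>
  proof -
    have "q j k * (1 + lam * \<epsilon>) \<le> q j k * (1 + lam * \<epsilon> * (T j k' - T j k))"
      using q_pos[of j k] stretch[OF that(1)] by (intro mult_left_mono) auto
    also have "\<dots> \<le> q j k'" using that k k' kk by (intro q_growth) auto
    finally show ?thesis using p3 by (simp add: q_eq[symmetric])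
  qed
  moreover have "p (s + 3) j * (1 + lam * \<epsilon>) \<le> p (T j (Suc k)) j"
    if "0 \<le> \<epsilon>" "\<forall>t. s \<le> t \<and> t \<le> s + 3 \<longrightarrow> z (p t) j \<le> - \<epsilon>" for \<epsilon>
  proof -
    have "q j k' * (1 + lam * \<epsilon>) \<le> q j k' * (1 + lam * \<epsilon> * (T j k' - T j k))"
      using q_pos[of j k'] stretch[OF that(1)] by (intro mult_left_mono) auto
    also have "\<dots> \<le> q j k" using that k k' kk by (intro q_decline) auto
    finally show ?thesis using p3 by (simp add: q_eq[symmetric])
  qed
  \<comment> \<open>The price set by update \<open>k\<close> is still current just before the next
    update, so \<open>v\<close> is the time of that one; it lies inside the span.\<close>
  ultimately show ?thesis using that[of "T j (Suc k)"] k by blast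
qed

text \<open>Over a bounded time span the prices barely move but are updated for at least one unit of time,
  so a good whose limit price is positive cannot keep an excess demand of a fixed sign.\<close>

lemma limit_complementarity:
  assumes s: "filterlim s at_top sequentially" and lim: "\<And>k. (\<lambda>n. p (s n) k) \<longlonglongrightarrow> ps k"
    and cont: "\<And>r. \<lbrakk>filterlim r at_top sequentially; \<And>k. (\<lambda>n. p (r n) k) \<longlonglongrightarrow> ps k\<rbrakk>
       \<Longrightarrow> (\<lambda>n. z (p (r n)) j) \<longlonglongrightarrow> zl"
    and pos: "0 < ps j"
  shows "zl = 0"
proof (rule ccontr)
  assume "zl \<noteq> 0"
  define \<epsilon> where "\<epsilon> = min (\<bar>zl\<bar> / 2) 1"
  have \<epsilon>: "0 < \<epsilon>" "\<epsilon> \<le> 1" "\<epsilon> < \<bar>zl\<bar>" using \<open>zl \<noteq> 0\<close> by (auto simp: \<epsilon>_def)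
  define h where "h = lam * \<epsilon>"
  have h: "0 < h" "h \<le> 1"
    using lam_pos lam_le \<epsilon> mult_mono[of lam 1 \<epsilon> 1] by (auto simp: h_def)
  \<comment> \<open>\<open>4 * \<eta> = ps j * h\<close>, so a relative change by
    \<open>1 + h\<close> cannot fit into an interval of radius \<open>\<eta>\<close> around
    \<open>ps j\<close>.\<close>
  define \<eta> where "\<eta> = ps j * h / 4"
  have \<eta>: "0 < \<eta>" using pos h by (simp add: \<eta>_def)
  \<comment> \<open>A statement about all times of the spans reduces to one about a single sequence:
    \<open>r n\<close> is a time violating \<open>Q\<close> if there is one, and by slowness the
    prices along \<open>r\<close> have the same limit.\<close>
  have near: "eventually (\<lambda>n. \<forall>t. s n \<le> t \<and> t \<le> s n + 3 \<longrightarrow> Q t) sequentially"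
    if Q: "\<And>r. \<lbrakk>filterlim r at_top sequentially; \<And>k. (\<lambda>n. p (r n) k) \<longlonglongrightarrow> ps k\<rbrakk>
       \<Longrightarrow> eventually (\<lambda>n. Q (r n)) sequentially" for Q :: "real \<Rightarrow> bool"
  proof -
    have "\<exists>r. s n \<le> r \<and> r \<le> s n + 3 \<and> (Q r \<longrightarrow> (\<forall>t. s n \<le> t \<and> t \<le> s n + 3 \<longrightarrow> Q t))" for n
    proof (cases "\<forall>t. s n \<le> t \<and> t \<le> s n + 3 \<longrightarrow> Q t")
      case True
      then show ?thesis by (intro exI[of _ "s n"]) simp
    qed blast
    then obtain r where r: "\<And>n. s n \<le> r n" "\<And>n. r n \<le> s n + 3"
      "\<And>n. Q (r n) \<Longrightarrow> \<forall>t. s n \<le> t \<and> t \<le> s n + 3 \<longrightarrow> Q t"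
      by metis
    have "filterlim r at_top sequentially"
      using s by (rule filterlim_at_top_mono) (use r in auto)
    moreover have "(\<lambda>n. p (r n) k) \<longlonglongrightarrow> ps k" for k
      using s lim by (rule p_slow_seq[where L=3]) (use r in auto)
    ultimately have "eventually (\<lambda>n. Q (r n)) sequentially" by (rule Q)
    then show ?thesis by eventually_elim (rule r(3))
  qed
  have "eventually (\<lambda>n. 0 < s n) sequentially" using s by (simp add: filterlim_at_top_dense)
  moreover have "eventually (\<lambda>n. \<forall>t. s n \<le> t \<and> t \<le> s n + 3 \<longrightarrow> \<bar>p t j - ps j\<bar> < \<eta>) sequentially"
  proof (rule near)
    fix r assume "\<And>k. (\<lambda>n. p (r n) k) \<longlonglongrightarrow> ps k"
    from tendstoD[OF this[of j] \<eta>] show "eventually (\<lambda>n. \<bar>p (r n) j - ps j\<bar> < \<eta>) sequentially"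
      by (simp add: dist_real_def)
  qed
  moreover have "eventually (\<lambda>n. \<forall>t. s n \<le> t \<and> t \<le> s n + 3 \<longrightarrow> \<bar>z (p t) j - zl\<bar> < \<bar>zl\<bar> - \<epsilon>) sequentially"
  proof (rule near)
    fix r assume r: "filterlim r at_top sequentially" "\<And>k. (\<lambda>n. p (r n) k) \<longlonglongrightarrow> ps k"
    have "0 < \<bar>zl\<bar> - \<epsilon>" using \<epsilon> by simp
    from tendstoD[OF cont[OF r] this]
    show "eventually (\<lambda>n. \<bar>z (p (r n)) j - zl\<bar> < \<bar>zl\<bar> - \<epsilon>) sequentially"
      by (simp add: dist_real_def)
  qed
  ultimately have "eventually (\<lambda>n. 0 < s n \<and> (\<forall>t. s n \<le> t \<and> t \<le> s n + 3 \<longrightarrow> \<bar>p t j - ps j\<bar> < \<eta>) \<and>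
      (\<forall>t. s n \<le> t \<and> t \<le> s n + 3 \<longrightarrow> \<bar>z (p t) j - zl\<bar> < \<bar>zl\<bar> - \<epsilon>)) sequentially"
    by eventually_elim simp
  then obtain n where n: "0 < s n" "\<And>t. s n \<le> t \<Longrightarrow> t \<le> s n + 3 \<Longrightarrow> \<bar>p t j - ps j\<bar> < \<eta>"
    "\<And>t. s n \<le> t \<Longrightarrow> t \<le> s n + 3 \<Longrightarrow> \<bar>z (p t) j - zl\<bar> < \<bar>zl\<bar> - \<epsilon>"
    by (auto simp: eventually_sequentially)
  have contra: False if "\<bar>a - ps j\<bar> < \<eta>" "\<bar>b - ps j\<bar> < \<eta>" "a * (1 + h) \<le> b" for a b
  proof -
    have "(ps j - \<eta>) * (1 + h) \<le> a * (1 + h)" using that h by (intro mult_right_mono) auto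
    moreover have "(ps j - \<eta>) * (1 + h) = ps j + 4 * \<eta> - \<eta> - \<eta> * h" by (simp add: \<eta>_def field_simps)
    moreover have "\<eta> * h \<le> \<eta>" using \<eta> h by simp
    ultimately show False using that \<eta> by linarith
  qed
  obtain v where v: "s n \<le> v" "v \<le> s n + 3"
    "\<And>\<epsilon>. \<lbrakk>0 \<le> \<epsilon>; \<epsilon> \<le> 1; \<forall>t. s n \<le> t \<and> t \<le> s n + 3 \<longrightarrow> \<epsilon> \<le> z (p t) j\<rbrakk>
       \<Longrightarrow> p v j * (1 + lam * \<epsilon>) \<le> p (s n + 3) j"
    "\<And>\<epsilon>. \<lbrakk>0 \<le> \<epsilon>; \<forall>t. s n \<le> t \<and> t \<le> s n + 3 \<longrightarrow> z (p t) j \<le> - \<epsilon>\<rbrakk>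
       \<Longrightarrow> p (s n + 3) j * (1 + lam * \<epsilon>) \<le> p v j"
    using price_change_over_span[OF n(1), of j] by blast
  show False
  proof (cases "0 < zl")
    case True
    have "\<epsilon> \<le> z (p t) j" if "s n \<le> t" "t \<le> s n + 3" for t using n(3)[OF that] True by linarith
    then have "p v j * (1 + h) \<le> p (s n + 3) j" unfolding h_def using \<epsilon> by (intro v) auto
    then show False using n(2) v by (intro contra) auto
  next
    case False
    have "z (p t) j \<le> - \<epsilon>" if "s n \<le> t" "t \<le> s n + 3" for t using n(3)[OF that] False by linarith
    then have "p (s n + 3) j * (1 + h) \<le> p v j" unfolding h_def using \<epsilon> by (intro v) auto
    then show False using n(2) v by (intro contra) auto
  qed
qed

end

text \<open>Bolzano-Weierstrass, carried over from the Euclidean space of vectors indexed by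
  \<open>'a\<close>.\<close>

lemma bounded_functions_subsequence:
  fixes f :: "nat \<Rightarrow> 'a::finite \<Rightarrow> real"
  assumes "\<And>n j. \<bar>f n j\<bar> \<le> B"
  obtains h l where "strict_mono h" "\<And>j. (\<lambda>n. f (h n) j) \<longlonglongrightarrow> l j"
proof -
  define v where "v n = (\<chi> j. f n j)" for n
  have "norm (v n) \<le> (\<Sum>j\<in>(UNIV :: 'a set). B)" for n
    by (rule order.trans[OF norm_le_l1_cart sum_mono]) (simp add: v_def assms)
  then have "bounded (range v)" by (auto simp: bounded_iff)
  then obtain l h where h: "strict_mono h" "(v \<circ> h) \<longlonglongrightarrow> l"
    using bounded_imp_convergent_subsequence by blast
  have "(\<lambda>n. f (h n) j) \<longlonglongrightarrow> l $ j" for j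
    using tendsto_vec_nth[OF h(2), of j] by (simp add: v_def comp_def)
  then show ?thesis using that h(1) by blast
qed

context tatonnement_run
begin

lemma trajectory_subsequence:
  assumes s: "filterlim s at_top sequentially"
  obtains h l where "strict_mono h" "\<And>j. (\<lambda>n. p (s (h n)) j) \<longlonglongrightarrow> l j"
    "filterlim (\<lambda>n. s (h n)) at_top sequentially"
proof -
  obtain B where B: "\<And>t j. 0 \<le> t \<Longrightarrow> p t j \<le> B" using p_bounded by blast
  \<comment> \<open>Nothing is known about \<open>p\<close> at negative times; clipping changes only
    finitely many terms of the sequence.\<close>
  have "\<bar>p (max 0 (s n)) j\<bar> \<le> B" for n j
    using B[of "max 0 (s n)" j] p_pos[of "max 0 (s n)" j] by (simp add: less_imp_le abs_of_pos)
  then obtain h l where h: "strict_mono h" "\<And>j. (\<lambda>n. p (max 0 (s (h n))) j) \<longlonglongrightarrow> l j"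
    using bounded_functions_subsequence[of "\<lambda>n j. p (max 0 (s n)) j" B] by metis
  have sh: "filterlim (\<lambda>n. s (h n)) at_top sequentially"
    using s filterlim_subseq[OF h(1)] by (rule filterlim_compose)
  then have "eventually (\<lambda>n. 0 \<le> s (h n)) sequentially" by (simp add: filterlim_at_top)
  then have "eventually (\<lambda>n. p (max 0 (s (h n))) j = p (s (h n)) j) sequentially" for j
    by eventually_elim (simp add: max_def)
  then have "(\<lambda>n. p (s (h n)) j) \<longlonglongrightarrow> l j" for j using h(2) by (blast intro: Lim_transform_eventually)
  then show ?thesis using that h(1) sh by blast
qed

end

section \<open>Convergence for CES utilities\<close>

text \<open>Strict weighted AM-GM for \<open>t\<close> and 1 with mean \<open>M\<close>: the bounds
  \<open>ln y \<le> y - 1\<close> at \<open>t / M\<close> and \<open>1 / M\<close> are added with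
  weights \<open>\<theta>\<close> and \<open>1 - \<theta>\<close>, the first being strict.\<close>

lemma powr_less_tangent:
  fixes t \<theta> :: real
  assumes "0 < t" "t \<noteq> 1" "0 < \<theta>" "\<theta> < 1"
  shows "t powr \<theta> < 1 + \<theta> * (t - 1)"
proof -
  define M where "M = 1 + \<theta> * (t - 1)"
  have M_eq: "M = \<theta> * t + (1 - \<theta>)" by (simp add: M_def algebra_simps)
  have M: "0 < M" unfolding M_eq using assms by (intro add_pos_pos) auto
  have "(1 - \<theta>) * (t - 1) \<noteq> 0" using assms by simp
  then have "t / M \<noteq> 1" using M by (simp add: M_eq algebra_simps)
  then have "ln (t / M) < t / M - 1"
    using ln_le_minus_one[of "t / M"] ln_eq_minus_one[of "t / M"] M assms by fastforce
  then have "\<theta> * ln (t / M) < \<theta> * (t / M - 1)" using assms by (intro mult_strict_left_mono) auto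
  moreover have "(1 - \<theta>) * ln (1 / M) \<le> (1 - \<theta>) * (1 / M - 1)"
    using ln_le_minus_one[of "1 / M"] M assms by (intro mult_left_mono) auto
  moreover have "\<theta> * (t / M - 1) + (1 - \<theta>) * (1 / M - 1) = (\<theta> * t + (1 - \<theta>)) / M - 1"
    by (simp add: add_divide_distrib diff_divide_distrib algebra_simps)
  ultimately have "\<theta> * ln (t / M) + (1 - \<theta>) * ln (1 / M) < 0" using M by (simp add: M_eq[symmetric])
  then have "\<theta> * ln t < ln M" using M assms by (simp add: ln_div algebra_simps)
  then have "exp (\<theta> * ln t) < exp (ln M)" by (rule exp_less_mono)
  then have "t powr \<theta> < M" using M assms by (simp add: powr_def)
  then show ?thesis by (simp add: M_def)
qed

lemma add_inverse_ge_2: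
  fixes r :: real
  assumes "0 < r"
  shows "2 \<le> r + 1 / r" and "r \<noteq> 1 \<Longrightarrow> 2 < r + 1 / r"
proof -
  have eq: "r + 1 / r - 2 = (r - 1)\<^sup>2 / r" using assms by (simp add: field_simps power2_eq_square)
  have "0 \<le> (r - 1)\<^sup>2 / r" using assms by simp
  then show "2 \<le> r + 1 / r" using eq by linarith
  show "2 < r + 1 / r" if "r \<noteq> 1"
  proof -
    have "0 < (r - 1)\<^sup>2 / r" using assms that by simp
    then show ?thesis using eq by linarith
  qed
qed

section \<open>Uniqueness of the CES equilibrium\<close>

context ces_market
begin

definition wanted :: "'g \<Rightarrow> bool" where
  "wanted j \<longleftrightarrow> (\<exists>i. 0 < c i j)"

lemma share_eq_0: "\<not> 0 < c i j \<Longrightarrow> share i p j = 0"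
  using c_nonneg[of i j] by (simp add: share_def)

lemma spend_unwanted: "\<not> wanted j \<Longrightarrow> spend p j = 0"
  unfolding spend_def wanted_def by (simp add: share_eq_0)

text \<open>The sum on the right is the cost at prices \<open>p'\<close> of the bundle bought at
  \<open>p\<close>, per unit of budget. The ratio of the aggregates is the share-weighted mean of
  \<open>(p' j / p j) powr \<theta> i\<close>, and each power is at most its tangent at 1.\<close>

lemma revalued_bundle_ge:
  assumes p: "\<And>j. 0 < c i j \<Longrightarrow> 0 < p j" and p': "\<And>j. 0 < c i j \<Longrightarrow> 0 < p' j"
    and th: "0 < \<theta> i" "\<theta> i < 1"
  shows "agg i p' / agg i p - (1 - \<theta> i) \<le> \<theta> i * (\<Sum>j\<in>UNIV. share i p j * (p' j / p j))"
    and "\<exists>j. 0 < c i j \<and> p j \<noteq> p' j \<Longrightarrow>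
      agg i p' / agg i p - (1 - \<theta> i) < \<theta> i * (\<Sum>j\<in>UNIV. share i p j * (p' j / p j))"
proof -
  define f where "f j = c i j * p' j powr \<theta> i / agg i p - (1 - \<theta> i) * share i p j" for j
  define h where "h j = \<theta> i * (share i p j * (p' j / p j))" for j
  have Y: "0 < agg i p" using agg_pos p by blast
  have f_eq: "f j = share i p j * ((p' j / p j) powr \<theta> i - (1 - \<theta> i))" if "0 < c i j" for j
  proof -
    have "c i j * p' j powr \<theta> i / agg i p = share i p j * (p' j / p j) powr \<theta> i"
      using p[OF that] p'[OF that] by (simp add: share_def powr_divide)
    then show ?thesis by (simp only: f_def right_diff_distrib mult.commute[of "1 - \<theta> i"])
  qed
  have h_eq: "h j = share i p j * ((1 + \<theta> i * (p' j / p j - 1)) - (1 - \<theta> i))" for j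
    by (simp add: h_def algebra_simps)
  have strict: "f j < h j" if j: "0 < c i j" "p j \<noteq> p' j" for j
  proof -
    have "0 < share i p j" unfolding share_def using j p[OF j(1)] Y by simp
    moreover have "(p' j / p j) powr \<theta> i < 1 + \<theta> i * (p' j / p j - 1)"
      using j p[OF j(1)] p'[OF j(1)] th by (intro powr_less_tangent) auto
    ultimately show ?thesis unfolding f_eq[OF j(1)] h_eq by simp
  qed
  have weak: "f j \<le> h j" for j
  proof (cases "0 < c i j")
    case True
    show ?thesis
    proof (cases "p j = p' j")
      case eq: True
      show ?thesis unfolding f_eq[OF True] h_eq using eq p[OF True] by simp
    qed (use strict[OF True] in simp)
  next
    case False
    then have "c i j = 0" using c_nonneg[of i j] by simp
    then show ?thesis by (simp add: f_def h_def share_def)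
  qed
  have sum_f: "(\<Sum>j\<in>UNIV. f j) = agg i p' / agg i p - (1 - \<theta> i)"
    unfolding f_def sum_subtractf sum_distrib_left[symmetric] sum_divide_distrib[symmetric]
    using sum_share[of i p] p by (simp add: agg_def)
  have sum_h: "(\<Sum>j\<in>UNIV. h j) = \<theta> i * (\<Sum>j\<in>UNIV. share i p j * (p' j / p j))"
    by (simp add: h_def sum_distrib_left)
  show "agg i p' / agg i p - (1 - \<theta> i) \<le> \<theta> i * (\<Sum>j\<in>UNIV. share i p j * (p' j / p j))"
    unfolding sum_f[symmetric] sum_h[symmetric] by (intro sum_mono weak)
  show "agg i p' / agg i p - (1 - \<theta> i) < \<theta> i * (\<Sum>j\<in>UNIV. share i p j * (p' j / p j))"
    if "\<exists>j. 0 < c i j \<and> p j \<noteq> p' j"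
    unfolding sum_f[symmetric] sum_h[symmetric] using that strict weak by (intro sum_strict_mono_ex1) auto
qed

text \<open>Equivalent to monotonicity \<open>(x - x') \<bullet> (p - p') \<le> 0\<close> of the demand of a single buyer, with the equality case.\<close>

lemma cross_costs_ge:
  assumes p: "\<And>j. 0 < c i j \<Longrightarrow> 0 < p j" and p': "\<And>j. 0 < c i j \<Longrightarrow> 0 < p' j"
    and th: "\<theta> i < 1"
  defines "A \<equiv> (\<Sum>j\<in>UNIV. share i p j * (p' j / p j)) + (\<Sum>j\<in>UNIV. share i p' j * (p j / p' j))"
  shows "2 \<le> A" and "\<exists>j. 0 < c i j \<and> p j \<noteq> p' j \<Longrightarrow> 2 < A"
proof -
  have "2 \<le> A \<and> ((\<exists>j. 0 < c i j \<and> p j \<noteq> p' j) \<longrightarrow> 2 < A)"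
  proof (cases "\<theta> i = 0")
    case True
    \<comment> \<open>Cobb-Douglas shares do not depend on the prices, so the two sums merge into
      shares times \<open>r + 1 / r\<close>.\<close>
    define h where "h j = share i p j * (p' j / p j + 1 / (p' j / p j))" for j
    have pw: "c i j * p j powr \<theta> i = c i j" "c i j * p' j powr \<theta> i = c i j" for j
      using True p[of j] p'[of j] c_nonneg[of i j] by (cases "c i j = 0"; force)+
    have sh: "share i p' j = share i p j" for j
      unfolding share_def agg_def pw ..
    have A_eq: "A = (\<Sum>j\<in>UNIV. h j)"
      unfolding A_def sh h_def by (simp add: sum.distrib distrib_left)
    have two: "(\<Sum>j\<in>UNIV. share i p j * 2) = 2"
      using sum_share[of i p] p by (simp add: sum_distrib_right[symmetric])
    have weak: "share i p j * 2 \<le> h j" for j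
    proof (cases "0 < c i j")
      case True
      then show ?thesis unfolding h_def using p p' share_nonneg
        by (intro mult_left_mono add_inverse_ge_2) auto
    qed (simp add: h_def share_eq_0)
    have strict: "share i p j * 2 < h j" if j: "0 < c i j" "p j \<noteq> p' j" for j
    proof -
      have "0 < agg i p" using agg_pos p by blast
      then have "0 < share i p j" unfolding share_def using j p[OF j(1)] by simp
      moreover have "2 < p' j / p j + 1 / (p' j / p j)"
        using j p[OF j(1)] p'[OF j(1)] by (intro add_inverse_ge_2) auto
      ultimately show ?thesis unfolding h_def by (intro mult_strict_left_mono)
    qed
    show ?thesis
    proof (intro conjI impI)
      have "(\<Sum>j\<in>UNIV. share i p j * 2) \<le> (\<Sum>j\<in>UNIV. h j)" by (intro sum_mono weak)
      then show "2 \<le> A" by (simp only: A_eq two)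
      show "2 < A" if "\<exists>j. 0 < c i j \<and> p j \<noteq> p' j"
      proof -
        have "(\<Sum>j\<in>UNIV. share i p j * 2) < (\<Sum>j\<in>UNIV. h j)"
          using weak strict that by (intro sum_strict_mono_ex1) auto
        then show ?thesis by (simp only: A_eq two)
      qed
    qed
  next
    case False
    then have th0: "0 < \<theta> i" using theta_nonneg[of i] by simp
    have Y: "0 < agg i p" "0 < agg i p'" using agg_pos p p' by blast+
    define R where "R = agg i p' / agg i p"
    \<comment> \<open>The two halves below add up to \<open>\<theta> i * A \<ge> R + 1 / R - 2 * (1
      - \<theta> i) \<ge> 2 * \<theta> i\<close>.\<close>
    have "2 \<le> R + 1 / R" using Y by (intro add_inverse_ge_2) (simp add: R_def)
    then have R: "2 \<le> R + agg i p / agg i p'" by (simp add: R_def)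
    have half: "agg i p' / agg i p - (1 - \<theta> i) \<le> \<theta> i * (\<Sum>j\<in>UNIV. share i p j * (p' j / p j))"
      by (intro revalued_bundle_ge(1) p p' th0 th)
    have half': "agg i p / agg i p' - (1 - \<theta> i) \<le> \<theta> i * (\<Sum>j\<in>UNIV. share i p' j * (p j / p' j))"
      by (intro revalued_bundle_ge(1) p p' th0 th)
    have thA: "\<theta> i * A = \<theta> i * (\<Sum>j\<in>UNIV. share i p j * (p' j / p j))
        + \<theta> i * (\<Sum>j\<in>UNIV. share i p' j * (p j / p' j))"
      by (simp add: A_def distrib_left)
    show ?thesis
    proof (intro conjI impI)
      have "\<theta> i * 2 \<le> \<theta> i * A" using half half' R unfolding thA R_def by linarith
      then show "2 \<le> A" using th0 by simp
      show "2 < A" if "\<exists>j. 0 < c i j \<and> p j \<noteq> p' j"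
      proof -
        have "agg i p' / agg i p - (1 - \<theta> i) < \<theta> i * (\<Sum>j\<in>UNIV. share i p j * (p' j / p j))"
          by (intro revalued_bundle_ge(2) p p' th0 th that)
        then have "\<theta> i * 2 < \<theta> i * A" using half' R unfolding thA R_def by linarith
        then show ?thesis using th0 by simp
      qed
    qed
  qed
  then show "2 \<le> A" "\<exists>j. 0 < c i j \<and> p j \<noteq> p' j \<Longrightarrow> 2 < A" by auto
qed

lemma sum_spend:
  assumes "\<And>j. wanted j \<Longrightarrow> 0 < p j"
  shows "(\<Sum>j\<in>UNIV. spend p j) = (\<Sum>i\<in>UNIV. e i)"
proof -
  have "(\<Sum>j\<in>UNIV. spend p j) = (\<Sum>i\<in>UNIV. e i * (\<Sum>j\<in>UNIV. share i p j))"
    unfolding spend_def by (subst sum.swap) (simp add: sum_distrib_left)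
  also have "\<dots> = (\<Sum>i\<in>UNIV. e i * 1)"
    using assms by (intro sum.cong refl arg_cong2[where f="(*)"] sum_share) (auto simp: wanted_def)
  finally show ?thesis by simp
qed

text \<open>At equilibrium spending equals price, so the bundles bought at one equilibrium cost
  exactly the total budget at the other. The two revalued costs thus total twice the budgets,
  against the strict case of \<open>cross_costs_ge\<close>.\<close>

lemma equilibrium_unique:
  assumes th: "\<And>i. \<theta> i < 1"
    and p: "\<And>j. wanted j \<Longrightarrow> 0 < p j" "\<And>j. wanted j \<Longrightarrow> spend p j = p j"
    and p': "\<And>j. wanted j \<Longrightarrow> 0 < p' j" "\<And>j. wanted j \<Longrightarrow> spend p' j = p' j"
    and "wanted k"
  shows "p k = p' k"
proof (rule ccontr)
  assume neq: "p k \<noteq> p' k"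
  define A where "A i = (\<Sum>j\<in>UNIV. share i p j * (p' j / p j)) + (\<Sum>j\<in>UNIV. share i p' j * (p j / p' j))" for i
  have w: "\<And>i j. 0 < c i j \<Longrightarrow> 0 < p j" "\<And>i j. 0 < c i j \<Longrightarrow> 0 < p' j"
    using p(1) p'(1) by (auto simp: wanted_def)
  have weak: "e i * 2 \<le> e i * A i" for i
    unfolding A_def using e_pos[of i] w th by (intro mult_left_mono cross_costs_ge) (auto simp: less_imp_le)
  obtain i where i: "0 < c i k" using \<open>wanted k\<close> by (auto simp: wanted_def)
  have "e i * 2 < e i * A i"
    unfolding A_def using e_pos[of i] w th i neq by (intro mult_strict_left_mono cross_costs_ge(2)) auto
  then have "(\<Sum>i\<in>UNIV. e i * 2) < (\<Sum>i\<in>UNIV. e i * A i)"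
    using weak by (intro sum_strict_mono_ex1) auto
  moreover have revalue: "(\<Sum>i\<in>UNIV. e i * (\<Sum>j\<in>UNIV. share i r j * (r' j / r j))) = (\<Sum>i\<in>UNIV. e i)"
    if r: "\<And>j. wanted j \<Longrightarrow> 0 < r j" "\<And>j. wanted j \<Longrightarrow> spend r j = r j"
      and r': "\<And>j. wanted j \<Longrightarrow> 0 < r' j" "\<And>j. wanted j \<Longrightarrow> spend r' j = r' j" for r r'
  proof -
    have "(\<Sum>i\<in>UNIV. e i * (\<Sum>j\<in>UNIV. share i r j * (r' j / r j))) = (\<Sum>j\<in>UNIV. spend r j * (r' j / r j))"
      unfolding spend_def sum_distrib_left sum_distrib_right
      by (subst sum.swap) (simp add: mult.assoc)
    also have "\<dots> = (\<Sum>j\<in>UNIV. spend r' j)"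
    proof (rule sum.cong)
      show "spend r j * (r' j / r j) = spend r' j" for j
      proof (cases "wanted j")
        case True
        then show ?thesis using r(1)[OF True] by (simp add: r(2) r'(2))
      qed (simp add: spend_unwanted)
    qed simp
    finally show ?thesis using sum_spend r' by simp
  qed
  have "(\<Sum>i\<in>UNIV. e i * A i) = 2 * (\<Sum>i\<in>UNIV. e i)"
    unfolding A_def using revalue[of p p'] revalue[of p' p] p p' by (simp add: distrib_left sum.distrib)
  ultimately show False by (simp add: sum_distrib_right[symmetric])
qed

lemma spend_tendsto:
  assumes lim: "\<And>k. ((\<lambda>n. P n k) \<longlongrightarrow> ps k) F" and pos: "\<And>k. wanted k \<Longrightarrow> 0 < ps k"
  shows "((\<lambda>n. spend (P n) j) \<longlongrightarrow> spend ps j) F"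
proof -
  have summand: "((\<lambda>n. c i k * P n k powr \<theta> i) \<longlongrightarrow> c i k * ps k powr \<theta> i) F" for i k
  proof (cases "0 < c i k")
    case True
    then have "0 < ps k" using pos by (auto simp: wanted_def)
    then show ?thesis by (intro tendsto_intros lim) auto
  next
    case False
    then have "c i k = 0" using c_nonneg[of i k] by simp
    then show ?thesis by simp
  qed
  have "agg i ps \<noteq> 0" for i
  proof -
    have "0 < agg i ps" by (intro agg_pos pos) (auto simp: wanted_def)
    then show ?thesis by simp
  qed
  then show ?thesis unfolding spend_def share_def agg_def
    by (intro tendsto_sum tendsto_mult tendsto_const tendsto_divide summand) (simp add: agg_def)
qed

end

section \<open>Wanted and unwanted goods along a CES run, and convergence\<close>

context tatonnement_run
begin

text \<open>For \<open>\<theta> i < 1\<close> the demand of buyer \<open>i\<close> for a wanted good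
  tends to infinity as its price tends to zero while the aggregate stays bounded. Below a threshold
  the price is therefore not lowered.\<close>

lemma p_wanted_bounded_away:
  assumes th: "\<And>i. \<theta> i < 1" and "wanted j"
  obtains b where "0 < b" "\<And>t. 0 \<le> t \<Longrightarrow> b \<le> p t j"
proof -
  obtain i where i: "0 < c i j" using \<open>wanted j\<close> by (auto simp: wanted_def)
  obtain B where B: "\<And>t j. 0 \<le> t \<Longrightarrow> p t j \<le> B" using p_bounded by blast
  have B0: "0 < B" using B[of 0 j] p_pos[of 0 j] by simp
  define Y where "Y = (\<Sum>k\<in>UNIV. c i k * B powr \<theta> i)"
  have Y: "0 < Y" unfolding Y_def using B0 i by (intro sum_pos2[of _ j]) (auto simp: c_nonneg)
  \<comment> \<open>Calibrated so that \<open>p t j powr (\<theta> i - 1) \<ge> K\<close> forces a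
    demand of at least 2, that is, excess demand at least 1; \<open>b0\<close> is the price with
    equality.\<close>
  define K where "K = 2 * Y / (e i * c i j)"
  have K: "0 < K" using Y i e_pos[of i] by (simp add: K_def)
  define b0 where "b0 = K powr (1 / (\<theta> i - 1))"
  have b0: "0 < b0" using K by (simp add: b0_def)
  have b0K: "b0 powr (\<theta> i - 1) = K" unfolding b0_def using K th[of i] by (simp add: powr_powr)
  have high: "1 \<le> z (p t) j" if t: "0 \<le> t" "p t j \<le> b0" for t
  proof -
    have pp: "0 < p t k" for k using p_pos t by simp
    have "agg i (p t) \<le> Y"
      unfolding agg_def Y_def using pp B t c_nonneg theta_nonneg
      by (intro sum_mono mult_left_mono powr_mono2) (auto simp: less_imp_le)
    moreover have agg: "0 < agg i (p t)" using agg_pos pp by blast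
    ultimately have "e i * c i j * K / Y \<le> e i * c i j * p t j powr (\<theta> i - 1) / agg i (p t)"
      using powr_mono2'[of "\<theta> i - 1" "p t j" b0] th[of i] t pp[of j] i e_pos[of i] K
      by (intro frac_le mult_left_mono) (auto simp: b0K less_imp_le)
    also have "e i * c i j * K / Y = 2" unfolding K_def using Y i e_pos[of i] by simp
    also have "e i * c i j * p t j powr (\<theta> i - 1) / agg i (p t) = e i * share i (p t) j / p t j"
      unfolding share_def using pp[of j] by (simp add: powr_diff mult_ac)
    also have "\<dots> \<le> spend (p t) j / p t j"
      unfolding spend_def using pp[of j] share_nonneg e_pos
      by (intro divide_right_mono member_le_sum) (auto simp: less_imp_le)
    finally show ?thesis using z_p[OF t(1), of j] by simp
  qed
  \<comment> \<open>One update at most halves a price, so a price above \<open>b0\<close> stays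
    above \<open>b0 / 2\<close>, and a price of at most \<open>b0\<close> does not fall.\<close>
  define b where "b = min (q j 0) (b0 / 2)"
  have b: "0 < b" using b0 q_pos by (simp add: b_def)
  have "b \<le> q j k" for k
  proof (induction k)
    case (Suc k)
    let ?d = "T j (Suc k) - T j k"
    have d: "0 < ?d" "?d \<le> 1" using T_less_Suc T_gap by auto
    show ?case
    proof (cases "q j k \<le> b0")
      case True
      have "0 \<le> resp j k"
      proof (rule resp_ge_if)
        fix t assume t: "T j k < t" "t \<le> T j (Suc k)"
        then have "0 \<le> t" using T_nonneg[of j k] by linarith
        then show "0 \<le> z (p t) j" using high[of t] True p_eq[OF t] by simp
      qed simp
      then have "0 \<le> lam * resp j k * ?d" using lam_pos d by simp
      then have "q j k * 1 \<le> q j (Suc k)" unfolding q_Suc using q_pos[of j k] by (intro mult_left_mono) auto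
      then show ?thesis using Suc by simp
    next
      case False
      have "lam * ?d \<le> 1 / 2" using mult_mono[of lam "1 / 2" ?d 1] lam_pos lam_le d by simp
      moreover have "lam * ?d * (-1) \<le> lam * ?d * resp j k"
        using resp_ge lam_pos d by (intro mult_left_mono) auto
      ultimately have "1 / 2 \<le> 1 + lam * ?d * resp j k" by linarith
      then have "b0 * (1 / 2) \<le> q j k * (1 + lam * ?d * resp j k)"
        using False b0 by (intro mult_mono) auto
      then show ?thesis unfolding q_Suc b_def by (simp add: mult_ac)
    qed
  qed (simp add: b_def)
  then have "b \<le> p t j" if "0 \<le> t" for t
  proof (cases "t = 0")
    case True
    then show ?thesis using \<open>\<And>k. b \<le> q j k\<close> by (simp add: p_0)
  next
    case False
    then obtain k where "T j k < t" "t \<le> T j (Suc k)" using T_locate[of t j] \<open>0 \<le> t\<close> by auto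
    then show ?thesis using \<open>\<And>k. b \<le> q j k\<close> p_eq by simp
  qed
  then show ?thesis using that b by blast
qed

text \<open>The excess demand is constantly -1, and \<open>q_decline\<close> with
  \<open>\<epsilon> = 1\<close> gives decay of order \<open>1 / t\<close>.\<close>

lemma p_unwanted_tendsto:
  assumes "\<not> wanted j"
  shows "((\<lambda>t. p t j) \<longlongrightarrow> 0) at_top"
proof -
  have upper: "p t j \<le> q j 0 / lam / t" if t: "0 < t" for t
  proof -
    obtain k where k: "T j k < t" "t \<le> T j (Suc k)" using T_locate t .
    have "q j k * (1 + lam * 1 * (T j k - T j 0)) \<le> q j 0"
    proof (rule q_decline)
      fix s assume "T j 0 < s"
      then show "z (p s) j \<le> - 1" using z_p[of s j] spend_unwanted[OF assms] by (simp add: T_0)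
    qed auto
    \<comment> \<open>At most one unit passes between \<open>T j k\<close> and \<open>t\<close>; its
      contribution \<open>lam \<le> 1\<close> is absorbed by the summand 1.\<close>
    moreover have "lam * t \<le> 1 + lam * 1 * (T j k - T j 0)"
    proof -
      have "t \<le> 1 + T j k" using k T_gap[of j k] by linarith
      then have "lam * t \<le> lam * (1 + T j k)" using lam_pos by simp
      moreover have "lam \<le> 1" using lam_le by simp
      ultimately show ?thesis by (simp add: T_0 algebra_simps)
    qed
    ultimately have "q j k * (lam * t) \<le> q j 0"
      using q_pos[of j k] by (meson less_imp_le mult_left_mono order.trans)
    then show ?thesis using p_eq[OF k] lam_pos t by (simp add: field_simps)
  qed
  have "((\<lambda>t. q j 0 / lam / t) \<longlongrightarrow> 0) at_top"
    by (intro tendsto_divide_0[OF tendsto_const] filterlim_at_top_imp_at_infinity filterlim_ident)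
  then show ?thesis
  proof (rule tendsto_sandwich[rotated 3])
    show "eventually (\<lambda>t. 0 \<le> p t j) at_top"
      using eventually_ge_at_top[of 0] by eventually_elim (simp add: p_pos less_imp_le)
    show "eventually (\<lambda>t. p t j \<le> q j 0 / lam / t) at_top"
      using eventually_gt_at_top[of 0] by eventually_elim (rule upper)
  qed simp
qed

lemma ces_limit_point:
  assumes th: "\<And>i. \<theta> i < 1"
    and s: "filterlim s at_top sequentially" and lim: "\<And>k. (\<lambda>n. p (s n) k) \<longlonglongrightarrow> ps k"
  shows "wanted j \<Longrightarrow> 0 < ps j" "wanted j \<Longrightarrow> spend ps j = ps j" "\<not> wanted j \<Longrightarrow> ps j = 0"
proof -
  have ev: "eventually (\<lambda>n. 0 \<le> r n) sequentially" if "filterlim r at_top sequentially" for r :: "nat \<Rightarrow> real"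
    using that by (simp add: filterlim_at_top)
  have pos: "0 < ps j" if w: "wanted j" for j
  proof -
    obtain b where b: "0 < b" "\<And>t. 0 \<le> t \<Longrightarrow> b \<le> p t j" using p_wanted_bounded_away[OF th w] by blast
    have "eventually (\<lambda>n. b \<le> p (s n) j) sequentially" using ev[OF s] by eventually_elim (rule b)
    then have "b \<le> ps j" using lim by (intro tendsto_lowerbound) auto
    then show ?thesis using b by simp
  qed
  show "wanted j \<Longrightarrow> 0 < ps j" by (rule pos)
  show "spend ps j = ps j" if w: "wanted j"
  proof -
    have "spend ps j / ps j - 1 = 0"
      using s lim
    proof (rule limit_complementarity)
      fix r assume r: "filterlim r at_top sequentially" "\<And>k. (\<lambda>n. p (r n) k) \<longlonglongrightarrow> ps k"
      have "(\<lambda>n. spend (p (r n)) j / p (r n) j - 1) \<longlonglongrightarrow> spend ps j / ps j - 1"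
        using r pos pos[OF w] by (intro tendsto_intros spend_tendsto) auto
      moreover have "eventually (\<lambda>n. spend (p (r n)) j / p (r n) j - 1 = z (p (r n)) j) sequentially"
        using ev[OF r(1)] by eventually_elim (simp add: z_p)
      ultimately show "(\<lambda>n. z (p (r n)) j) \<longlonglongrightarrow> spend ps j / ps j - 1"
        by (rule Lim_transform_eventually)
    qed (rule pos[OF w])
    then show ?thesis using pos[OF w] by simp
  qed
  show "ps j = 0" if "\<not> wanted j"
    using lim[of j] filterlim_compose[OF p_unwanted_tendsto[OF that] s] by (rule LIMSEQ_unique)
qed

text \<open>Every limit point satisfies the equilibrium conditions, which determine it; a bounded
  trajectory with a single limit point converges.\<close>

theorem ces_convergence:
  assumes th: "\<And>i. \<theta> i < 1"
  obtains ps where "\<And>j. wanted j \<Longrightarrow> 0 < ps j" "\<And>j. wanted j \<Longrightarrow> spend ps j = ps j"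
    "\<And>j. \<not> wanted j \<Longrightarrow> ps j = 0" "\<And>j. ((\<lambda>t. p t j) \<longlongrightarrow> ps j) at_top"
proof -
  obtain h ps where "strict_mono (h :: nat \<Rightarrow> nat)" and ps: "\<And>j. (\<lambda>n. p (real (h n)) j) \<longlonglongrightarrow> ps j"
    and inf: "filterlim (\<lambda>n. real (h n)) at_top sequentially"
    using trajectory_subsequence[OF filterlim_real_sequentially] by metis
  note ps_props = ces_limit_point[OF th inf ps]
  have "((\<lambda>t. p t j) \<longlongrightarrow> ps j) at_top" for j
  proof (rule ccontr)
    assume "\<not> ((\<lambda>t. p t j) \<longlongrightarrow> ps j) at_top"
    then obtain \<eta> where \<eta>: "0 < \<eta>" "\<not> eventually (\<lambda>t. dist (p t j) (ps j) < \<eta>) at_top"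
      by (auto simp: tendsto_iff)
    then have "\<exists>t\<ge>real n. \<not> dist (p t j) (ps j) < \<eta>" for n
      by (auto simp: eventually_at_top_linorder)
    then obtain s where s: "\<And>n. real n \<le> s n" "\<And>n. \<not> dist (p (s n) j) (ps j) < \<eta>" by metis
    have s_inf: "filterlim s at_top sequentially"
      using filterlim_real_sequentially by (rule filterlim_at_top_mono) (simp add: s)
    obtain f l where f: "strict_mono (f :: nat \<Rightarrow> nat)" and l: "\<And>j. (\<lambda>n. p (s (f n)) j) \<longlonglongrightarrow> l j"
      and f_inf: "filterlim (\<lambda>n. s (f n)) at_top sequentially"
      using trajectory_subsequence[OF s_inf] by metis
    note l_props = ces_limit_point[OF th f_inf l]
    have "l j = ps j"
    proof (cases "wanted j")
      case True
      show ?thesis by (rule equilibrium_unique[OF th l_props(1,2) ps_props(1,2) True])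
    qed (simp add: l_props(3) ps_props(3))
    then have "eventually (\<lambda>n. dist (p (s (f n)) j) (ps j) < \<eta>) sequentially"
      using tendstoD[OF l[of j] \<eta>(1)] by simp
    then show False using s(2) by simp
  qed
  then show ?thesis using that ps_props by blast
qed

end

section \<open>Limit points for Leontief utilities\<close>

locale leontief_market = ces_market e \<theta> c
  for e :: "'b::finite \<Rightarrow> real" and \<theta> :: "'b \<Rightarrow> real" and c :: "'b \<Rightarrow> 'g::finite \<Rightarrow> real" +
  assumes theta_eq_1: "\<theta> i = 1"
begin

text \<open>Unlike \<open>spend p j / p j\<close>, this expression for the demand remains meaningful at zero prices.\<close>

definition leontief_demand :: "('g \<Rightarrow> real) \<Rightarrow> 'g \<Rightarrow> real" where
  "leontief_demand p j = (\<Sum>i\<in>UNIV. e i * c i j / agg i p)"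

lemma agg_linear: "(\<And>j. 0 \<le> p j) \<Longrightarrow> agg i p = (\<Sum>j\<in>UNIV. c i j * p j)"
  by (simp add: agg_def theta_eq_1)

lemma spend_eq_leontief_demand:
  assumes "\<And>j. 0 < p j"
  shows "spend p j / p j = leontief_demand p j"
  unfolding spend_def share_def leontief_demand_def sum_divide_distrib using assms[of j]
  by (intro sum.cong) (auto simp: theta_eq_1)

lemma agg_tendsto:
  assumes "\<And>k. ((\<lambda>n. P n k) \<longlongrightarrow> ps k) F" and "eventually (\<lambda>n. \<forall>k. 0 \<le> P n k) F" and "\<And>k. 0 \<le> ps k"
  shows "((\<lambda>n. agg i (P n)) \<longlongrightarrow> agg i ps) F"
proof -
  have "((\<lambda>n. \<Sum>k\<in>UNIV. c i k * P n k) \<longlongrightarrow> (\<Sum>k\<in>UNIV. c i k * ps k)) F"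
    by (intro tendsto_intros assms)
  moreover have "eventually (\<lambda>n. (\<Sum>k\<in>UNIV. c i k * P n k) = agg i (P n)) F"
    using assms(2) by eventually_elim (simp add: agg_linear)
  ultimately show ?thesis unfolding agg_linear[of ps, OF assms(3)] by (rule Lim_transform_eventually)
qed

text \<open>Good by good, \<open>(x - x') * (p - p')\<close> vanishes: either both demands are 1 or
  both prices are 0. Regrouped by buyer, the total has summands
  \<open>e i * (1 / Y - 1 / Y') * (Y - Y') \<le> 0\<close>, so all aggregates agree, and demand
  depends on the aggregates only.\<close>

lemma leontief_demand_eq_if_same_support:
  assumes p: "\<And>j. 0 \<le> p j" "\<And>i. 0 < agg i p" "\<And>j. 0 < p j \<Longrightarrow> leontief_demand p j = 1"
    and p': "\<And>j. 0 \<le> p' j" "\<And>i. 0 < agg i p'" "\<And>j. 0 < p' j \<Longrightarrow> leontief_demand p' j = 1"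
    and support: "\<And>j. 0 < p j \<longleftrightarrow> 0 < p' j"
  shows "leontief_demand p = leontief_demand p'"
proof -
  define D where "D i = e i * ((1 / agg i p - 1 / agg i p') * (agg i p - agg i p'))" for i
  have D_eq: "D i = - (e i * ((agg i p - agg i p')\<^sup>2 / (agg i p * agg i p')))" for i
    using p(2)[of i] p'(2)[of i] by (simp add: D_def field_simps power2_eq_square)
  have D0: "0 \<le> - D i" for i
    unfolding D_eq using p(2)[of i] p'(2)[of i] e_pos[of i] by simp
  have "0 = (\<Sum>j\<in>UNIV. (leontief_demand p j - leontief_demand p' j) * (p j - p' j))"
  proof (rule sum.neutral[symmetric], intro ballI)
    fix j
    show "(leontief_demand p j - leontief_demand p' j) * (p j - p' j) = 0"
    proof (cases "0 < p j")
      case True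
      then show ?thesis using p(3) p'(3) support[of j] by simp
    next
      case False
      then have "p j = 0" "p' j = 0" using p(1)[of j] p'(1)[of j] support[of j] by auto
      then show ?thesis by simp
    qed
  qed
  also have "\<dots> = (\<Sum>j\<in>UNIV. \<Sum>i\<in>UNIV. e i * (1 / agg i p - 1 / agg i p') * (c i j * p j - c i j * p' j))"
    unfolding leontief_demand_def sum_subtractf[symmetric] sum_distrib_right
    by (intro sum.cong refl) (simp add: divide_inverse algebra_simps)
  also have "\<dots> = (\<Sum>i\<in>UNIV. D i)"
    unfolding D_def agg_linear[of p, OF p(1)] agg_linear[of p', OF p'(1)] sum_subtractf[symmetric]
    by (subst sum.swap) (simp add: sum_distrib_left mult.assoc)
  finally have "(\<Sum>i\<in>UNIV. - D i) = 0" by (simp add: sum_negf)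
  then have D_0: "D i = 0" for i
    using D0 sum_nonneg_eq_0_iff[of UNIV "\<lambda>i. - D i"] by simp
  have "agg i p = agg i p'" for i
    using D_0[of i] p(2)[of i] p'(2)[of i] e_pos[of i] unfolding D_eq by auto
  then show ?thesis by (simp add: leontief_demand_def fun_eq_iff)
qed

end

section \<open>Limit demands along a Leontief run\<close>

locale leontief_run = leontief_market e \<theta> c + tatonnement_run e \<theta> c lam z T q resp p
  for e :: "'b::finite \<Rightarrow> real" and \<theta> :: "'b \<Rightarrow> real" and c :: "'b \<Rightarrow> 'g::finite \<Rightarrow> real"
    and lam z T q resp p
begin

definition limit_point :: "('g \<Rightarrow> real) \<Rightarrow> bool" where
  "limit_point ps \<longleftrightarrow> (\<exists>s. filterlim s at_top sequentially \<and> (\<forall>k. (\<lambda>n. p (s n) k) \<longlonglongrightarrow> ps k))"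

text \<open>The potential stays below its initial value and the indices of the other buyers are
  bounded above, so \<open>ln (agg i (p t))\<close> is bounded below. Demand is therefore continuous
  at limit points, even where some prices vanish.\<close>

lemma agg_bounded_away:
  obtains y where "0 < y" "\<And>t. 0 < t \<Longrightarrow> y \<le> agg i (p t)"
proof -
  obtain B where B: "\<And>t j. 0 \<le> t \<Longrightarrow> p t j \<le> B" using p_bounded by blast
  have "\<exists>K. \<forall>pr. (\<forall>j. 0 < pr j) \<longrightarrow> (\<forall>j. pr j \<le> B) \<longrightarrow> price_index i pr \<le> K" for i
    using price_index_le[of B i] by metis
  then obtain K where K: "\<And>i pr. (\<forall>j. 0 < pr j) \<Longrightarrow> (\<forall>j. pr j \<le> B) \<Longrightarrow> price_index i pr \<le> K i"
    by metis
  define M where "M = (- potential (p 0) - (\<Sum>i\<in>UNIV - {i}. e i * K i)) / e i"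
  have "exp M \<le> agg i (p t)" if t: "0 < t" for t
  proof -
    have pp: "0 < p t k" for k using p_pos t by simp
    have "(\<Sum>i\<in>UNIV - {i}. e i * price_index i (p t)) \<le> (\<Sum>i\<in>UNIV - {i}. e i * K i)"
      using pp B[of t] t e_pos by (intro sum_mono mult_left_mono K) (auto simp: less_imp_le)
    moreover have "0 \<le> (\<Sum>j\<in>UNIV. p t j)" using pp by (intro sum_nonneg) (simp add: less_imp_le)
    moreover have "(\<Sum>i\<in>UNIV. e i * price_index i (p t)) =
        e i * price_index i (p t) + (\<Sum>i\<in>UNIV - {i}. e i * price_index i (p t))"
      by (subst sum.remove[of _ i]) auto
    ultimately have "- potential (p 0) - (\<Sum>i\<in>UNIV - {i}. e i * K i) \<le> e i * price_index i (p t)"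
      using potential_le_initial[OF t] unfolding potential_def[of "p t"] by linarith
    then have "M \<le> price_index i (p t)" using e_pos[of i] by (simp add: M_def field_simps)
    then have "M \<le> ln (agg i (p t))" by (simp add: price_index_def theta_eq_1)
    moreover have "0 < agg i (p t)" using agg_pos pp by blast
    ultimately show ?thesis by (simp add: ln_ge_iff)
  qed
  then show ?thesis using that[of "exp M"] by simp
qed

lemma eventually_pos:
  fixes s :: "nat \<Rightarrow> real"
  assumes "filterlim s at_top sequentially"
  shows "eventually (\<lambda>n. 0 < s n) sequentially"
  using assms by (simp add: filterlim_at_top_dense)

lemma limit_nonneg:
  assumes s: "filterlim s at_top sequentially" and lim: "\<And>k. (\<lambda>n. p (s n) k) \<longlonglongrightarrow> ps k"
  shows "0 \<le> ps j"
proof (rule tendsto_lowerbound[OF lim])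
  show "eventually (\<lambda>n. 0 \<le> p (s n) j) sequentially"
    using eventually_pos[OF s] by eventually_elim (simp add: p_pos less_imp_le)
qed simp

lemma limit_agg:
  assumes s: "filterlim s at_top sequentially" and lim: "\<And>k. (\<lambda>n. p (s n) k) \<longlonglongrightarrow> ps k"
  shows "(\<lambda>n. agg i (p (s n))) \<longlonglongrightarrow> agg i ps" "0 < agg i ps"
proof -
  show *: "(\<lambda>n. agg i (p (s n))) \<longlonglongrightarrow> agg i ps"
  proof (rule agg_tendsto[OF lim])
    show "eventually (\<lambda>n. \<forall>k. 0 \<le> p (s n) k) sequentially"
      using eventually_pos[OF s] by eventually_elim (simp add: p_pos less_imp_le)
    show "0 \<le> ps k" for k by (rule limit_nonneg[OF s lim])
  qed
  obtain y where y: "0 < y" "\<And>t. 0 < t \<Longrightarrow> y \<le> agg i (p t)" using agg_bounded_away[of i] by blast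
  have "eventually (\<lambda>n. y \<le> agg i (p (s n))) sequentially"
    using eventually_pos[OF s] by eventually_elim (rule y)
  then have "y \<le> agg i ps" using * by (intro tendsto_lowerbound) auto
  then show "0 < agg i ps" using y by simp
qed

lemma limit_demand:
  assumes s: "filterlim s at_top sequentially" and lim: "\<And>k. (\<lambda>n. p (s n) k) \<longlonglongrightarrow> ps k"
  shows "(\<lambda>n. leontief_demand (p (s n)) j) \<longlonglongrightarrow> leontief_demand ps j"
  unfolding leontief_demand_def using limit_agg[OF s lim]
  by (intro tendsto_intros) (auto simp: less_imp_neq[symmetric])

lemma z_leontief: "0 \<le> t \<Longrightarrow> z (p t) j = leontief_demand (p t) j - 1"
  by (simp add: z_p spend_eq_leontief_demand p_pos)

lemma limit_demand_eq_1:
  assumes s: "filterlim s at_top sequentially" and lim: "\<And>k. (\<lambda>n. p (s n) k) \<longlonglongrightarrow> ps k"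
    and pos: "0 < ps j"
  shows "leontief_demand ps j = 1"
proof -
  have "leontief_demand ps j - 1 = 0"
    using s lim
  proof (rule limit_complementarity)
    fix r assume r: "filterlim r at_top sequentially" "\<And>k. (\<lambda>n. p (r n) k) \<longlonglongrightarrow> ps k"
    have "(\<lambda>n. leontief_demand (p (r n)) j - 1) \<longlonglongrightarrow> leontief_demand ps j - 1"
      by (intro tendsto_intros limit_demand r)
    moreover have "eventually (\<lambda>n. leontief_demand (p (r n)) j - 1 = z (p (r n)) j) sequentially"
      using eventually_pos[OF r(1)] by eventually_elim (simp add: z_leontief)
    ultimately show "(\<lambda>n. z (p (r n)) j) \<longlonglongrightarrow> leontief_demand ps j - 1"
      by (rule Lim_transform_eventually)
  qed (rule pos)
  then show ?thesis by simp
qed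

text \<open>At limit points the demand is determined by the set of goods with positive price, and
  there are finitely many such sets.\<close>

lemma finite_limit_demands: "finite ((\<lambda>ps. leontief_demand ps j) ` {ps. limit_point ps})"
proof -
  define supp where "supp ps = {j. 0 < ps j}" for ps :: "'g \<Rightarrow> real"
  have "leontief_demand ps = leontief_demand ps'"
    if l: "limit_point ps" "limit_point ps'" "supp ps = supp ps'" for ps ps'
  proof -
    obtain s where s: "filterlim s at_top sequentially" "\<And>k. (\<lambda>n. p (s n) k) \<longlonglongrightarrow> ps k"
      using l(1) by (auto simp: limit_point_def)
    obtain s' where s': "filterlim s' at_top sequentially" "\<And>k. (\<lambda>n. p (s' n) k) \<longlonglongrightarrow> ps' k"
      using l(2) by (auto simp: limit_point_def)
    show ?thesis
    proof (rule leontief_demand_eq_if_same_support)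
      show "0 < ps j \<longleftrightarrow> 0 < ps' j" for j using l(3) by (auto simp: supp_def)
    qed (rule limit_nonneg[OF s] limit_nonneg[OF s'] limit_agg(2)[OF s] limit_agg(2)[OF s']
        limit_demand_eq_1[OF s] limit_demand_eq_1[OF s'], assumption?)+
  qed
  \<comment> \<open>One representative is chosen for each support, so that the demands become images
    of sets of goods.\<close>
  then have eq: "leontief_demand ps j = leontief_demand (SOME ps'. limit_point ps' \<and> supp ps' = supp ps) j"
    if "limit_point ps" for ps
    using someI[of "\<lambda>ps'. limit_point ps' \<and> supp ps' = supp ps" ps] that by metis
  then have "(\<lambda>ps. leontief_demand ps j) ` {ps. limit_point ps}
      \<subseteq> (\<lambda>S. leontief_demand (SOME ps'. limit_point ps' \<and> supp ps' = S) j) ` UNIV"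
    by auto
  then show ?thesis by (rule finite_subset) simp
qed

text \<open>Otherwise there are times at most one unit apart, tending to infinity, with demands at
  least \<open>\<eta>\<close> apart. Along a subsequence both price sequences have the same limit,
  and so do the demands.\<close>

lemma demand_slow:
  assumes "0 < \<eta>"
  shows "eventually (\<lambda>t. \<forall>t'. t \<le> t' \<and> t' \<le> t + 1 \<longrightarrow>
    \<bar>leontief_demand (p t') j - leontief_demand (p t) j\<bar> < \<eta>) at_top"
proof (rule ccontr)
  let ?D = "\<lambda>t. leontief_demand (p t) j"
  assume "\<not> ?thesis"
  then have "\<exists>t\<ge>real n. \<exists>t'. t \<le> t' \<and> t' \<le> t + 1 \<and> \<not> \<bar>?D t' - ?D t\<bar> < \<eta>" for n
    by (force simp: eventually_at_top_linorder)
  then obtain s s' where s: "\<And>n. real n \<le> s n"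
    and s': "\<And>n. s n \<le> s' n" "\<And>n. s' n \<le> s n + 1" "\<And>n. \<not> \<bar>?D (s' n) - ?D (s n)\<bar> < \<eta>" by metis
  have s_inf: "filterlim s at_top sequentially"
    using filterlim_real_sequentially by (rule filterlim_at_top_mono) (simp add: s)
  obtain f ps where f: "strict_mono (f :: nat \<Rightarrow> nat)" and lim: "\<And>j. (\<lambda>n. p (s (f n)) j) \<longlonglongrightarrow> ps j"
    and f_inf: "filterlim (\<lambda>n. s (f n)) at_top sequentially"
    using trajectory_subsequence[OF s_inf] by metis
  have lim': "(\<lambda>n. p (s' (f n)) k) \<longlonglongrightarrow> ps k" for k
    using f_inf lim by (rule p_slow_seq[where L=1]) (use s' in auto)
  have f_inf': "filterlim (\<lambda>n. s' (f n)) at_top sequentially"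
    using f_inf by (rule filterlim_at_top_mono) (simp add: s')
  have "(\<lambda>n. ?D (s' (f n)) - ?D (s (f n))) \<longlonglongrightarrow> leontief_demand ps j - leontief_demand ps j"
    by (intro tendsto_diff limit_demand f_inf f_inf' lim lim')
  then have "eventually (\<lambda>n. dist (?D (s' (f n)) - ?D (s (f n))) 0 < \<eta>) sequentially"
    using \<open>0 < \<eta>\<close> by (intro tendstoD) simp_all
  then show False using s'(3) by (simp add: dist_real_def)
qed

lemma no_permanent_excess_demand:
  assumes "0 < \<epsilon>"
  shows "\<not> eventually (\<lambda>t. \<epsilon> \<le> z (p t) j) at_top"
proof
  assume "eventually (\<lambda>t. \<epsilon> \<le> z (p t) j) at_top"
  then obtain t0 where t0: "\<And>t. t0 \<le> t \<Longrightarrow> \<epsilon> \<le> z (p t) j" by (auto simp: eventually_at_top_linorder)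
  obtain B where B: "\<And>j k. q j k \<le> B" using q_bounded by blast
  define \<epsilon>' where "\<epsilon>' = min \<epsilon> 1"
  have \<epsilon>': "0 < \<epsilon>'" "\<epsilon>' \<le> 1" "\<epsilon>' \<le> \<epsilon>" using assms by (auto simp: \<epsilon>'_def)
  obtain k where k: "t0 \<le> T j k" using T_unbounded by blast
  define r where "r = q j k * lam * \<epsilon>'"
  have r: "0 < r" using q_pos lam_pos \<epsilon>' by (simp add: r_def)
  have B0: "0 < B" using B[of j k] q_pos[of j k] by linarith
  \<comment> \<open>During \<open>B / r\<close> units of time the linear growth alone adds
    \<open>B\<close> to a positive price, which contradicts the bound.\<close>
  obtain k' where k': "T j k + B / r \<le> T j k'" using T_unbounded by blast
  have "0 < B / r" using B0 r by simp
  then have "T j k \<le> T j k'" using k' by linarith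
  then have kk: "k \<le> k'" by (simp add: T_le_iff)
  have "\<epsilon>' \<le> z (p t) j" if "T j k < t" for t
    using t0[of t] k that \<epsilon>' by linarith
  then have "q j k * (1 + lam * \<epsilon>' * (T j k' - T j k)) \<le> q j k'"
    using \<epsilon>' kk by (intro q_growth) auto
  moreover have "q j k * (1 + lam * \<epsilon>' * (T j k' - T j k)) = q j k + r * (T j k' - T j k)"
    by (simp add: r_def algebra_simps)
  moreover have "r * (B / r) \<le> r * (T j k' - T j k)" using r k' by (intro mult_left_mono) auto
  moreover have "r * (B / r) = B" using r by simp
  ultimately show False using B[of j k'] q_pos[of j k] by linarith
qed

text \<open>The demand moves ever more slowly while accumulating only at the finitely many values it takes on
  limit points, so if it exceeds the supply at some limit point then it eventually does so forever.\<close>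

lemma limit_demand_le_1:
  assumes s: "filterlim s at_top sequentially" and lim: "\<And>k. (\<lambda>n. p (s n) k) \<longlonglongrightarrow> ps k"
  shows "leontief_demand ps j \<le> 1"
proof (rule ccontr)
  define v where "v = leontief_demand ps j"
  let ?D = "\<lambda>t. leontief_demand (p t) j"
  assume "\<not> leontief_demand ps j \<le> 1"
  then have v: "1 < v" by (simp add: v_def)
  \<comment> \<open>Inserting 1 makes \<open>V\<close> nonempty and its maximum \<open>a\<close> at
    least 1, so that the barrier above \<open>a\<close> is a true excess demand.\<close>
  define V where "V = insert 1 {w \<in> (\<lambda>ps. leontief_demand ps j) ` {ps. limit_point ps}. w < v}"
  have fin: "finite V" "V \<noteq> {}" using finite_limit_demands by (auto simp: V_def)
  define a where "a = Max V"
  have a: "a < v" "1 \<le> a" "\<And>w. w \<in> V \<Longrightarrow> w \<le> a"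
    using fin v Max_in[OF fin] by (auto simp: a_def V_def)
  \<comment> \<open>The middle third of the interval from \<open>a\<close> to \<open>v\<close>
    contains no limit demand.\<close>
  define \<alpha> \<beta> where "\<alpha> = (2 * a + v) / 3" and "\<beta> = (a + 2 * v) / 3"
  have ab: "a < \<alpha>" "\<alpha> < \<beta>" "\<beta> < v" using a by (auto simp: \<alpha>_def \<beta>_def)
  have gap: "eventually (\<lambda>t. \<not> (\<alpha> \<le> ?D t \<and> ?D t \<le> \<beta>)) at_top"
  proof (rule ccontr)
    assume "\<not> ?thesis"
    then have "\<exists>t\<ge>real n. \<alpha> \<le> ?D t \<and> ?D t \<le> \<beta>" for n
      by (auto simp: eventually_at_top_linorder)
    then obtain r where r: "\<And>n. real n \<le> r n" "\<And>n. \<alpha> \<le> ?D (r n)" "\<And>n. ?D (r n) \<le> \<beta>" by metis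
    have r_inf: "filterlim r at_top sequentially"
      using filterlim_real_sequentially by (rule filterlim_at_top_mono) (simp add: r)
    obtain f l where f: "strict_mono (f :: nat \<Rightarrow> nat)" and l: "\<And>j. (\<lambda>n. p (r (f n)) j) \<longlonglongrightarrow> l j"
      and f_inf: "filterlim (\<lambda>n. r (f n)) at_top sequentially"
      using trajectory_subsequence[OF r_inf] by metis
    have D: "(\<lambda>n. ?D (r (f n))) \<longlonglongrightarrow> leontief_demand l j" by (rule limit_demand[OF f_inf l])
    have "\<alpha> \<le> leontief_demand l j" using D r by (intro LIMSEQ_le_const) auto
    moreover have le: "leontief_demand l j \<le> \<beta>" using D r by (intro LIMSEQ_le_const2) auto
    moreover have "limit_point l" using f_inf l by (auto simp: limit_point_def)
    then have "leontief_demand l j \<in> V" using le ab by (auto simp: V_def)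
    ultimately show False using a(3)[of "leontief_demand l j"] ab by linarith
  qed
  have "eventually (\<lambda>t. \<not> (\<alpha> \<le> ?D t \<and> ?D t \<le> \<beta>) \<and>
      (\<forall>t'. t \<le> t' \<and> t' \<le> t + 1 \<longrightarrow> \<bar>?D t' - ?D t\<bar> < \<beta> - \<alpha>)) at_top"
    using ab by (intro eventually_conj gap demand_slow) simp
  then obtain t0 where t0: "\<And>t. t0 \<le> t \<Longrightarrow> \<not> (\<alpha> \<le> ?D t \<and> ?D t \<le> \<beta>)"
    "\<And>t t'. \<lbrakk>t0 \<le> t; t \<le> t'; t' \<le> t + 1\<rbrakk> \<Longrightarrow> \<bar>?D t' - ?D t\<bar> < \<beta> - \<alpha>"
    by (auto simp: eventually_at_top_linorder)
  have "eventually (\<lambda>n. \<beta> < ?D (s n)) sequentially"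
    using limit_demand[OF s lim, of j] ab by (intro order_tendstoD) (auto simp: v_def)
  moreover have "eventually (\<lambda>n. max t0 1 \<le> s n) sequentially" using s unfolding filterlim_at_top by blast
  ultimately have "eventually (\<lambda>n. \<beta> < ?D (s n) \<and> max t0 1 \<le> s n) sequentially" by eventually_elim simp
  then obtain n where n: "\<beta> < ?D (s n)" "t0 \<le> s n" "1 \<le> s n" by (auto simp: eventually_sequentially)
  \<comment> \<open>In one time unit the demand moves by less than the width of the forbidden band,
    so it cannot jump across, and it cannot stop inside.\<close>
  have stay: "\<beta> < ?D t" if "s n \<le> t" "t \<le> s n + real m" for m t
    using that
  proof (induction m arbitrary: t)
    case 0
    then show ?case using n by simp
  next
    case (Suc m)
    show ?case
    proof (cases "t \<le> s n + real m")
      case True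
      then show ?thesis using Suc by simp
    next
      case False
      have "\<bar>?D t - ?D (s n + real m)\<bar> < \<beta> - \<alpha>" using False Suc.prems n by (intro t0(2)) auto
      moreover have "\<beta> < ?D (s n + real m)" by (rule Suc.IH) auto
      ultimately have "\<alpha> < ?D t" by linarith
      then show ?thesis using t0(1)[of t] Suc.prems n by linarith
    qed
  qed
  have "\<beta> - 1 \<le> z (p t) j" if "s n \<le> t" for t
  proof -
    obtain m where "t - s n \<le> real m" using real_arch_simple by blast
    then have "\<beta> < ?D t" using that by (intro stay[of t m]) auto
    then show ?thesis using z_leontief[of t j] that n by simp
  qed
  then have "eventually (\<lambda>t. \<beta> - 1 \<le> z (p t) j) at_top" by (auto simp: eventually_at_top_linorder)
  then show False using no_permanent_excess_demand[of "\<beta> - 1" j] a ab by simp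
qed

end

section \<open>Utility maximization\<close>

text \<open>\<open>exp (\<rho> * ln t) \<ge> 1 + \<rho> * ln t\<close>, and
  \<open>ln t \<le> t - 1\<close> is reversed by the negative factor \<open>\<rho>\<close>.\<close>

lemma powr_neg_greater_tangent:
  fixes t \<rho> :: real
  assumes "0 < t" "\<rho> < 0"
  shows "1 + \<rho> * (t - 1) \<le> t powr \<rho>" and "t \<noteq> 1 \<Longrightarrow> 1 + \<rho> * (t - 1) < t powr \<rho>"
proof -
  have e: "1 + \<rho> * ln t \<le> t powr \<rho>" using assms exp_ge_add_one_self[of "\<rho> * ln t"] by (simp add: powr_def)
  have "\<rho> * (t - 1) \<le> \<rho> * ln t" using assms ln_le_minus_one[of t] by (intro mult_left_mono_neg) auto
  then show "1 + \<rho> * (t - 1) \<le> t powr \<rho>" using e by linarith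
  show "1 + \<rho> * (t - 1) < t powr \<rho>" if "t \<noteq> 1"
  proof -
    have "ln t < t - 1" using assms that ln_le_minus_one[of t] ln_eq_minus_one[of t] by fastforce
    then have "\<rho> * (t - 1) < \<rho> * ln t" using assms by (intro mult_strict_left_mono_neg) auto
    then show ?thesis using e by linarith
  qed
qed

text \<open>Written as budget times share over price to match \<open>share\<close> with
  \<open>c = a powr \<sigma>\<close>. A good with \<open>a j = 0\<close> gets quantity 0, also at
  price zero.\<close>

definition ces_bundle :: "('g::finite \<Rightarrow> real) \<Rightarrow> real \<Rightarrow> real \<Rightarrow> ('g \<Rightarrow> real) \<Rightarrow> 'g \<Rightarrow> real" where
  "ces_bundle a \<sigma> E p j =
     E * (a j powr \<sigma> * p j powr (1 - \<sigma>) / (\<Sum>k\<in>UNIV. a k powr \<sigma> * p k powr (1 - \<sigma>))) / p j"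

section \<open>Optimality and uniqueness of the CES bundle\<close>

context
  fixes a p :: "'g::finite \<Rightarrow> real" and \<rho> E \<sigma> Y :: real and x V
  assumes a: "\<And>j. 0 \<le> a j" "\<exists>j. 0 < a j" and rho: "\<rho> \<le> 0" and E: "0 < E"
    and p_pos: "\<And>j. 0 < a j \<Longrightarrow> 0 < p j" and p_nonneg: "\<And>j. 0 \<le> p j"
  defines "\<sigma> \<equiv> 1 / (1 - \<rho>)" and "x \<equiv> ces_bundle a \<sigma> E p" and "V \<equiv> {j. 0 < a j}"
    and "Y \<equiv> \<Sum>k\<in>UNIV. a k powr \<sigma> * p k powr (1 - \<sigma>)"
begin

lemma ces_bundle_eq: "x j = E * (a j powr \<sigma> * p j powr (1 - \<sigma>) / Y) / p j"
  by (simp add: x_def ces_bundle_def Y_def)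

lemma ces_agg_pos: "0 < Y"
proof -
  obtain j where "0 < a j" using a by blast
  then show ?thesis unfolding Y_def using p_pos[of j] by (intro sum_pos2[of _ j]) auto
qed

lemma ces_bundle_zero: "j \<notin> V \<Longrightarrow> x j = 0"
  using a(1)[of j] by (simp add: ces_bundle_eq V_def)

lemma ces_bundle_pos: "j \<in> V \<Longrightarrow> 0 < x j"
  using ces_agg_pos p_pos[of j] E by (simp add: ces_bundle_eq V_def)

lemma ces_bundle_nonneg: "0 \<le> x j"
  using ces_bundle_pos[of j] ces_bundle_zero[of j] by (cases "j \<in> V") auto

lemma ces_bundle_spending: "j \<in> V \<Longrightarrow> p j * x j = E * (a j powr \<sigma> * p j powr (1 - \<sigma>) / Y)"
  using p_pos[of j] by (simp add: ces_bundle_eq V_def)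

lemma ces_bundle_cost_V: "(\<Sum>j\<in>V. p j * x j) = E"
proof -
  have "(\<Sum>j\<in>V. p j * x j) = (\<Sum>j\<in>V. E * (a j powr \<sigma> * p j powr (1 - \<sigma>) / Y))"
    by (intro sum.cong refl ces_bundle_spending)
  also have "\<dots> = E * ((\<Sum>j\<in>V. a j powr \<sigma> * p j powr (1 - \<sigma>)) / Y)"
    by (simp add: sum_distrib_left sum_divide_distrib)
  also have "(\<Sum>j\<in>V. a j powr \<sigma> * p j powr (1 - \<sigma>)) = Y"
    unfolding Y_def using a by (intro sum.mono_neutral_left) (auto simp: V_def not_less order.antisym)
  finally show ?thesis using ces_agg_pos by simp
qed

lemma ces_bundle_cost: "(\<Sum>j\<in>UNIV. p j * x j) = E"
proof -
  have "(\<Sum>j\<in>UNIV. p j * x j) = (\<Sum>j\<in>V. p j * x j)"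
    by (intro sum.mono_neutral_right) (auto simp: ces_bundle_zero)
  then show ?thesis by (simp add: ces_bundle_cost_V)
qed

text \<open>A bundle lacking a valued good has utility 0. Otherwise a tangent at \<open>x\<close> is
  used: for \<open>ln\<close> if \<open>\<rho> = 0\<close>, and for the power if
  \<open>\<rho> < 0\<close>, where maximal utility means minimal \<open>h\<close>. Strictness of the
  tangent away from \<open>x\<close> gives uniqueness.\<close>

lemma ces_optimal_on_valued:
  assumes y: "\<And>j. 0 \<le> y j" and cost: "(\<Sum>j\<in>V. p j * y j) \<le> E"
  shows "ces_utility a \<rho> y \<le> ces_utility a \<rho> x"
    and "ces_utility a \<rho> x \<le> ces_utility a \<rho> y \<Longrightarrow> j \<in> V \<Longrightarrow> y j = x j"
proof -
  have Vne: "V \<noteq> {}" using a by (auto simp: V_def)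
  have "ces_utility a \<rho> y \<le> ces_utility a \<rho> x \<and>
    (ces_utility a \<rho> x \<le> ces_utility a \<rho> y \<longrightarrow> (\<forall>j\<in>V. y j = x j))"
  proof (cases "\<exists>j\<in>V. y j = 0")
    case True
    then obtain j where j: "j \<in> V" "y j = 0" by blast
    have "ces_utility a \<rho> y = 0"
    proof (cases "\<rho> = 0")
      case True
      then show ?thesis using j by (auto simp: ces_utility_def V_def intro!: prod_zero)
    qed (use j in \<open>auto simp: ces_utility_def V_def\<close>)
    moreover have "0 < ces_utility a \<rho> x"
    proof (cases "\<rho> = 0")
      case True
      then have "ces_utility a \<rho> x = (\<Prod>j\<in>V. x j powr (a j / (\<Sum>k\<in>UNIV. a k)))"
        by (simp add: ces_utility_def V_def)
      also have "0 < \<dots>" using ces_bundle_pos by (intro prod_pos) force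
      finally show ?thesis .
    next
      case False
      have xne: "x j \<noteq> 0" if "0 < a j" for j using ces_bundle_pos[of j] that by (simp add: V_def)
      have "0 < (\<Sum>j\<in>V. a j * x j powr \<rho>)"
        using xne Vne by (intro sum_pos) (auto simp: V_def)
      then show ?thesis using False xne by (auto simp: ces_utility_def V_def)
    qed
    ultimately show ?thesis by simp
  next
    case False
    then have yp: "0 < y j" if "j \<in> V" for j using y[of j] that by (auto simp: less_le)
    show ?thesis
    proof (cases "\<rho> = 0")
      case True
      then have \<sigma>1: "\<sigma> = 1" by (simp add: \<sigma>_def)
      define A where "A = (\<Sum>k\<in>UNIV. a k)"
      have A_eq: "Y = A" unfolding Y_def \<sigma>1 A_def
        using a(1) p_pos by (intro sum.cong) (auto simp: less_le)
      have A: "0 < A" using ces_agg_pos A_eq by simp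
      define w where "w j = a j / A" for j
      have w: "0 < w j" if "j \<in> V" for j using that A by (simp add: w_def V_def)
      \<comment> \<open>The Cobb-Douglas weights are the expenditure shares, so weighted logarithms
        compare with costs.\<close>
      have wx: "w j = p j * x j / E" if "j \<in> V" for j
        using that E p_pos[of j] ces_bundle_spending[OF that] unfolding A_eq
        by (simp add: w_def \<sigma>1 V_def)
      have util: "ces_utility a \<rho> v = exp (\<Sum>j\<in>V. w j * ln (v j))" if "\<And>j. j \<in> V \<Longrightarrow> 0 < v j" for v
      proof -
        have "ces_utility a \<rho> v = (\<Prod>j\<in>V. v j powr w j)"
          using True by (simp add: ces_utility_def V_def w_def A_def)
        also have "\<dots> = (\<Prod>j\<in>V. exp (w j * ln (v j)))"
          using that by (intro prod.cong) (auto simp: powr_def less_imp_neq[symmetric])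
        finally show ?thesis by (simp add: exp_sum)
      qed
      define l where "l j = w j * ln (y j) - w j * ln (x j)" for j
      define r where "r j = p j * y j / E - p j * x j / E" for j
      have lr: "l j \<le> r j \<and> (y j \<noteq> x j \<longrightarrow> l j < r j)" if j: "j \<in> V" for j
      proof -
        have xy: "0 < y j / x j" using yp ces_bundle_pos j by simp
        have "l j = w j * ln (y j / x j)"
          using yp[OF j] ces_bundle_pos[OF j] by (simp add: l_def ln_div algebra_simps)
        moreover have "r j = w j * (y j / x j - 1)"
          using ces_bundle_pos[OF j] by (simp add: r_def wx[OF j] right_diff_distrib)
        moreover have "ln (y j / x j) \<le> y j / x j - 1" by (rule ln_le_minus_one[OF xy])
        moreover have "ln (y j / x j) \<noteq> y j / x j - 1" if "y j \<noteq> x j"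
          using ln_eq_minus_one[OF xy] that ces_bundle_pos[OF j] by auto
        ultimately show ?thesis using w[OF j] by (auto simp: less_le)
      qed
      have sum_r: "(\<Sum>j\<in>V. r j) \<le> 0"
        using cost E by (simp add: r_def sum_subtractf sum_divide_distrib[symmetric] ces_bundle_cost_V)
      have sum_l: "(\<Sum>j\<in>V. l j) = (\<Sum>j\<in>V. w j * ln (y j)) - (\<Sum>j\<in>V. w j * ln (x j))"
        by (simp add: l_def sum_subtractf)
      have le: "(\<Sum>j\<in>V. l j) \<le> (\<Sum>j\<in>V. r j)" using lr by (intro sum_mono) auto
      have less: "(\<Sum>j\<in>V. l j) < (\<Sum>j\<in>V. r j)" if "\<exists>j\<in>V. y j \<noteq> x j"
        using lr that by (intro sum_strict_mono_ex1) auto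
      have uy: "ces_utility a \<rho> y = exp (\<Sum>j\<in>V. w j * ln (y j))" by (intro util yp)
      have ux: "ces_utility a \<rho> x = exp (\<Sum>j\<in>V. w j * ln (x j))" by (intro util ces_bundle_pos)
      show ?thesis unfolding uy ux exp_le_cancel_iff
      proof (intro conjI impI ballI)
        show "(\<Sum>j\<in>V. w j * ln (y j)) \<le> (\<Sum>j\<in>V. w j * ln (x j))" using le sum_l sum_r by linarith
        fix j assume "(\<Sum>j\<in>V. w j * ln (x j)) \<le> (\<Sum>j\<in>V. w j * ln (y j))" "j \<in> V"
        then show "y j = x j" using less sum_l sum_r by force
      qed
    next
      case False
      then have rho: "\<rho> < 0" using rho by simp
      define h where "h v = (\<Sum>j\<in>V. a j * v j powr \<rho>)" for v
      have util: "ces_utility a \<rho> v = h v powr (1 / \<rho>)" if "\<And>j. j \<in> V \<Longrightarrow> 0 < v j" for v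
        using False that by (auto simp: ces_utility_def V_def h_def less_imp_neq[symmetric])
      have h_pos: "0 < h v" if "\<And>j. j \<in> V \<Longrightarrow> 0 < v j" for v
      proof -
        have "0 < a j * v j powr \<rho>" if "j \<in> V" for j
          using that \<open>\<And>j. j \<in> V \<Longrightarrow> 0 < v j\<close>[OF that] by (simp add: V_def)
        then show ?thesis unfolding h_def using Vne by (intro sum_pos) auto
      qed
      \<comment> \<open>The Lagrange multiplier up to the factor \<open>\<rho>\<close>:
        \<open>x j = (E / Y) * (a j / p j) powr \<sigma>\<close> and
        \<open>\<sigma> * (\<rho> - 1) = -1\<close>.\<close>
      define \<mu> where "\<mu> = (E / Y) powr (\<rho> - 1)"
      have \<mu>: "0 < \<mu>" unfolding \<mu>_def using E ces_agg_pos by simp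
      have foc: "a j * x j powr (\<rho> - 1) = \<mu> * p j" if j: "j \<in> V" for j
      proof -
        have aj: "0 < a j" "0 < p j" using j p_pos by (auto simp: V_def)
        have "x j = (E / Y) * (a j / p j) powr \<sigma>"
          using aj by (simp add: ces_bundle_eq powr_diff powr_divide)
        then have "x j powr (\<rho> - 1) = \<mu> * ((a j / p j) powr \<sigma>) powr (\<rho> - 1)"
          by (simp only: \<mu>_def powr_mult)
        also have "((a j / p j) powr \<sigma>) powr (\<rho> - 1) = (a j / p j) powr (-1)"
        proof -
          have "\<sigma> * (\<rho> - 1) = -1" using rho by (simp add: \<sigma>_def field_simps)
          then show ?thesis by (simp only: powr_powr)
        qed
        also have "\<dots> = p j / a j" using aj by (simp add: powr_minus_divide)
        finally show ?thesis using aj by simp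
      qed
      \<comment> \<open>Tangents at \<open>x\<close> to the summands of \<open>h\<close>. Their sum
        is \<open>h x\<close> plus \<open>\<rho> * \<mu>\<close> times the cost of \<open>y\<close>
        minus \<open>E\<close>, a product of two nonpositive numbers.\<close>
      define l where "l j = a j * x j powr \<rho> + \<rho> * \<mu> * (p j * y j - p j * x j)" for j
      define r where "r j = a j * y j powr \<rho>" for j
      have lr: "l j \<le> r j \<and> (y j \<noteq> x j \<longrightarrow> l j < r j)" if j: "j \<in> V" for j
      proof -
        have xp: "0 < x j" using ces_bundle_pos j .
        have xy: "0 < y j / x j" using yp xp j by simp
        have ax: "0 < a j * x j powr \<rho>" using j xp by (simp add: V_def)
        have px: "\<mu> * (p j * x j) = a j * x j powr \<rho>"
          using foc[OF j] xp by (simp add: powr_diff field_simps)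
        have py: "\<mu> * (p j * y j) = a j * x j powr \<rho> * (y j / x j)"
          unfolding px[symmetric] using xp by simp
        have "l j = a j * x j powr \<rho> + \<rho> * (\<mu> * (p j * y j) - \<mu> * (p j * x j))"
          by (simp add: l_def right_diff_distrib mult.assoc)
        then have "l j = a j * x j powr \<rho> * (1 + \<rho> * (y j / x j - 1))"
          unfolding px py by (simp add: algebra_simps)
        moreover have "r j = a j * x j powr \<rho> * (y j / x j) powr \<rho>"
          using xp yp[OF j] by (simp add: r_def powr_divide)
        moreover note powr_neg_greater_tangent[OF xy rho]
        moreover have "y j / x j \<noteq> 1" if "y j \<noteq> x j" using that xp by simp
        ultimately show ?thesis using ax by (auto intro!: mult_left_mono mult_strict_left_mono)
      qed
      have "\<rho> * \<mu> * ((\<Sum>j\<in>V. p j * y j) - E) \<ge> 0"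
        using rho \<mu> cost by (intro mult_nonpos_nonpos) (auto simp: mult_nonpos_nonneg)
      then have sum_l: "h x \<le> (\<Sum>j\<in>V. l j)"
        by (simp add: l_def h_def sum.distrib sum_distrib_left[symmetric] sum_subtractf ces_bundle_cost_V)
      have "(\<Sum>j\<in>V. l j) \<le> h y" unfolding h_def r_def[symmetric] using lr by (intro sum_mono) auto
      then have "h x \<le> h y" using sum_l by linarith
      then have 1: "h y powr (1 / \<rho>) \<le> h x powr (1 / \<rho>)"
        using rho h_pos[of x] ces_bundle_pos by (intro powr_mono2') auto
      have "h y powr (1 / \<rho>) < h x powr (1 / \<rho>)" if "\<exists>j\<in>V. y j \<noteq> x j"
      proof -
        have "(\<Sum>j\<in>V. l j) < h y"
          unfolding h_def r_def[symmetric] using lr that by (intro sum_strict_mono_ex1) auto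
        then have "h x < h y" using sum_l by linarith
        then show ?thesis using rho h_pos[of x] ces_bundle_pos by (intro powr_less_mono2_neg) auto
      qed
      then show ?thesis using 1 util yp ces_bundle_pos by fastforce
    qed
  qed
  then show "ces_utility a \<rho> y \<le> ces_utility a \<rho> x"
    "ces_utility a \<rho> x \<le> ces_utility a \<rho> y \<Longrightarrow> j \<in> V \<Longrightarrow> y j = x j" by auto
qed

lemma ces_bundle_in_demand_set: "ces_bundle a \<sigma> E p \<in> demand_set (ces_utility a \<rho>) E p"
proof -
  have "ces_utility a \<rho> y \<le> ces_utility a \<rho> x"
    if y: "\<And>j. 0 \<le> y j" "(\<Sum>j\<in>UNIV. p j * y j) \<le> E" for y
  proof -
    have "(\<Sum>j\<in>V. p j * y j) \<le> (\<Sum>j\<in>UNIV. p j * y j)"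
      using y p_nonneg by (intro sum_mono2) auto
    then show ?thesis using y by (intro ces_optimal_on_valued) auto
  qed
  then show ?thesis
    using ces_bundle_nonneg ces_bundle_cost unfolding demand_set_def x_def by auto
qed

text \<open>An optimal bundle agrees with \<open>x\<close> on the valued goods, which already
  exhausts the budget; at positive prices nothing remains for other goods.\<close>

lemma ces_demand_unique:
  assumes y: "y \<in> demand_set (ces_utility a \<rho>) E p" and pp: "\<And>j. 0 < p j"
  shows "y = ces_bundle a \<sigma> E p"
proof -
  have y0: "\<And>j. 0 \<le> y j" and cost: "(\<Sum>j\<in>UNIV. p j * y j) \<le> E"
    and opt: "ces_utility a \<rho> x \<le> ces_utility a \<rho> y"
    using y ces_bundle_nonneg ces_bundle_cost by (auto simp: demand_set_def)
  have py: "0 \<le> p j * y j" for j using y0 pp by (simp add: less_imp_le)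
  have "(\<Sum>j\<in>V. p j * y j) \<le> (\<Sum>j\<in>UNIV. p j * y j)"
    using py by (intro sum_mono2) auto
  then have V: "y j = x j" if "j \<in> V" for j
    using y0 cost opt that by (intro ces_optimal_on_valued(2)) auto
  have "(\<Sum>j\<in>V. p j * y j) = E" using V ces_bundle_cost_V by simp
  moreover have "(\<Sum>j\<in>UNIV. p j * y j) = (\<Sum>j\<in>V. p j * y j) + (\<Sum>j\<in>UNIV - V. p j * y j)"
    using sum.subset_diff[of V UNIV "\<lambda>j. p j * y j"] by simp
  ultimately have "(\<Sum>j\<in>UNIV - V. p j * y j) \<le> 0" using cost by linarith
  then have "(\<Sum>j\<in>UNIV - V. p j * y j) = 0" using py by (intro order.antisym sum_nonneg) auto
  then have "p j * y j = 0" if "j \<notin> V" for j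
    using sum_nonneg_eq_0_iff[of "UNIV - V" "\<lambda>j. p j * y j"] py that by auto
  then have "y j = x j" if "j \<notin> V" for j
    using ces_bundle_zero[OF that] pp[of j] that by fastforce
  then have "y = x" using V by (intro ext) blast
  then show ?thesis by (simp add: x_def)
qed

end

text \<open>\<open>d\<close> is the least bundle of utility 1, namely \<open>1 / b j\<close> on
  \<open>S\<close>; it is scaled to cost \<open>E\<close>.\<close>

definition leontief_bundle :: "('g::finite \<Rightarrow> real) \<Rightarrow> real \<Rightarrow> ('g \<Rightarrow> real) \<Rightarrow> 'g \<Rightarrow> real" where
  "leontief_bundle d E p j = E * d j / (\<Sum>k\<in>UNIV. d k * p k)"

section \<open>Optimality and uniqueness of the Leontief bundle\<close>

context
  fixes S :: "'g::finite set" and b d p :: "'g \<Rightarrow> real" and E :: real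
  assumes S: "S \<noteq> {}" and b: "\<And>j. j \<in> S \<Longrightarrow> 0 < b j" and E: "0 < E" and p: "\<And>j. 0 \<le> p j"
    and d: "\<And>j. d j = (if j \<in> S then 1 / b j else 0)" and agg: "0 < (\<Sum>k\<in>UNIV. d k * p k)"
begin

lemma leontief_bundle_utility: "leontief_utility S b (leontief_bundle d E p) = E / (\<Sum>k\<in>UNIV. d k * p k)"
proof -
  have "b j * leontief_bundle d E p j = E / (\<Sum>k\<in>UNIV. d k * p k)" if "j \<in> S" for j
    using b[OF that] that by (simp add: leontief_bundle_def d)
  then have "(\<lambda>j. b j * leontief_bundle d E p j) ` S = {E / (\<Sum>k\<in>UNIV. d k * p k)}"
    using S by auto
  then show ?thesis by (simp add: leontief_utility_def)
qed

lemma leontief_bundle_nonneg: "0 \<le> leontief_bundle d E p j"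
  using agg E b[of j] by (auto simp: leontief_bundle_def d)

lemma leontief_bundle_cost: "(\<Sum>j\<in>UNIV. p j * leontief_bundle d E p j) = E"
proof -
  have "(\<Sum>j\<in>UNIV. p j * leontief_bundle d E p j) = E * (\<Sum>j\<in>UNIV. d j * p j) / (\<Sum>k\<in>UNIV. d k * p k)"
    unfolding leontief_bundle_def sum_distrib_left sum_divide_distrib by (simp add: mult_ac)
  then show ?thesis using agg by simp
qed

lemma leontief_utility_ge_imp:
  assumes "\<And>j. 0 \<le> y j" "m \<le> leontief_utility S b y"
  shows "m * d j \<le> y j"
proof (cases "j \<in> S")
  case True
  then have "m \<le> b j * y j" using assms(2) S by (simp add: leontief_utility_def)
  then show ?thesis using b[OF True] True by (simp add: d field_simps)
qed (use assms in \<open>simp add: d\<close>)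

text \<open>A bundle of utility \<open>m\<close> dominates \<open>m * d\<close> in every good, so
  \<open>m\<close> times the cost of \<open>d\<close> is at most \<open>E\<close>.\<close>

lemma leontief_bundle_in_demand_set:
  "leontief_bundle d E p \<in> demand_set (leontief_utility S b) E p"
proof -
  have "leontief_utility S b y \<le> leontief_utility S b (leontief_bundle d E p)"
    if y: "\<And>j. 0 \<le> y j" "(\<Sum>j\<in>UNIV. p j * y j) \<le> E" for y
  proof -
    have "leontief_utility S b y * (\<Sum>j\<in>UNIV. d j * p j) = (\<Sum>j\<in>UNIV. p j * (leontief_utility S b y * d j))"
      unfolding sum_distrib_left by (simp add: mult_ac)
    also have "\<dots> \<le> (\<Sum>j\<in>UNIV. p j * y j)"
      using p y by (intro sum_mono mult_left_mono leontief_utility_ge_imp) auto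
    finally show ?thesis unfolding leontief_bundle_utility using y agg by (simp add: field_simps)
  qed
  then show ?thesis using leontief_bundle_nonneg leontief_bundle_cost unfolding demand_set_def by auto
qed

text \<open>An optimal \<open>y\<close> dominates the bundle in every good and costs no more;
  positive prices leave no room for a surplus.\<close>

lemma leontief_demand_unique:
  assumes y: "y \<in> demand_set (leontief_utility S b) E p" and pp: "\<And>j. 0 < p j"
  shows "y = leontief_bundle d E p"
proof
  fix j
  let ?x = "leontief_bundle d E p"
  have y0: "\<And>j. 0 \<le> y j" and cost: "(\<Sum>j\<in>UNIV. p j * y j) \<le> E"
    and opt: "leontief_utility S b ?x \<le> leontief_utility S b y"
    using y leontief_bundle_nonneg leontief_bundle_cost by (auto simp: demand_set_def)
  have "E / (\<Sum>k\<in>UNIV. d k * p k) * d j \<le> y j" for j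
    using y0 opt unfolding leontief_bundle_utility by (rule leontief_utility_ge_imp)
  then have le: "?x j \<le> y j" for j by (simp add: leontief_bundle_def)
  have nonneg: "0 \<le> p j * (y j - ?x j)" for j using le[of j] pp[of j] by simp
  have "(\<Sum>j\<in>UNIV. p j * (y j - ?x j)) \<le> 0"
    using cost leontief_bundle_cost by (simp add: right_diff_distrib sum_subtractf)
  then have "(\<Sum>j\<in>UNIV. p j * (y j - ?x j)) = 0" using nonneg by (intro order.antisym sum_nonneg) auto
  then have "p j * (y j - ?x j) = 0" using nonneg sum_nonneg_eq_0_iff[of UNIV "\<lambda>j. p j * (y j - ?x j)"] by simp
  then show "y j = ?x j" using pp[of j] by simp
qed

end

section \<open>From the definition of a run to the market model, and the final theorem\<close>

lemma (in ces_market) run_of_async_tatonnement: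
  assumes "0 < lam" "lam \<le> 1 / 23.46" and run: "async_tatonnement lam z T q p"
    and z: "\<And>pr j. (\<And>j. 0 < pr j) \<Longrightarrow> z pr j = spend pr j / pr j - 1"
  obtains resp where "tatonnement_run e \<theta> c lam z T q resp p"
proof -
  have "\<exists>zt. \<forall>j k. (\<exists>t1 t2. T j k < t1 \<and> t1 \<le> T j (Suc k) \<and> T j k < t2 \<and> t2 \<le> T j (Suc k) \<and>
                 z (p t1) j \<le> zt j k \<and> zt j k \<le> z (p t2) j) \<and>
        q j (Suc k) = q j k * (1 + lam * min (zt j k) 1 * (T j (Suc k) - T j k))"
    using run unfolding async_tatonnement_def by metis
  then obtain zt where zt: "\<And>j k. \<exists>t1 t2. T j k < t1 \<and> t1 \<le> T j (Suc k) \<and> T j k < t2 \<and> t2 \<le> T j (Suc k) \<and>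
                 z (p t1) j \<le> zt j k \<and> zt j k \<le> z (p t2) j"
      "\<And>j k. q j (Suc k) = q j k * (1 + lam * min (zt j k) 1 * (T j (Suc k) - T j k))"
    by metis
  have "tatonnement_run e \<theta> c lam z T q (\<lambda>j k. min (zt j k) 1) p"
  proof
    show "\<exists>t. T j k < t \<and> t \<le> T j (Suc k) \<and> min (z (p t) j) 1 \<le> min (zt j k) 1" for j k
      using zt(1)[of j k] by (meson min.mono order.refl)
    show "\<exists>t. T j k < t \<and> t \<le> T j (Suc k) \<and> min (zt j k) 1 \<le> min (z (p t) j) 1" for j k
      using zt(1)[of j k] by (meson min.mono order.refl)
    show "j = j'" if "T j (Suc k) = T j' (Suc k')" for j j' k k'
      using run that unfolding async_tatonnement_def by (metis le_add1 plus_1_eq_Suc)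
  qed (use assms zt(2) in \<open>auto simp: async_tatonnement_def\<close>)
  then show ?thesis using that by blast
qed

theorem mainTheorem6:
  fixes lam :: real
    and u :: "'b::finite \<Rightarrow> ('g::finite \<Rightarrow> real) \<Rightarrow> real"
    and e :: "'b \<Rightarrow> real"
    and x :: "'b \<Rightarrow> ('g \<Rightarrow> real) \<Rightarrow> 'g \<Rightarrow> real"
    and T :: "'g \<Rightarrow> nat \<Rightarrow> real"
    and q :: "'g \<Rightarrow> nat \<Rightarrow> real"
    and p :: "real \<Rightarrow> 'g \<Rightarrow> real"
  assumes lam_pos: "0 < lam" and lam_le: "lam \<le> 1 / 23.46"
    and budgets: "\<forall>i. e i > 0"
    and demand: "\<forall>i pr. (\<forall>j. pr j > 0) \<longrightarrow> x i pr \<in> demand_set (u i) (e i) pr"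
    and run: "async_tatonnement lam (excess_demand x) T q p"
  shows
    "((\<exists>a \<rho>. \<forall>i. \<rho> i \<le> 0 \<and> (\<forall>j. a i j \<ge> 0) \<and> (\<exists>j. a i j > 0) \<and>
                u i = ces_utility (a i) (\<rho> i)) \<longrightarrow>
        (\<exists>ps. market_equilibrium u e ps \<and> (\<forall>j. ((\<lambda>t. p t j) \<longlongrightarrow> ps j) at_top)))
     \<and>
     ((\<exists>S b. \<forall>i. S i \<noteq> {} \<and> (\<forall>j\<in>S i. b i j > 0) \<and>
                u i = leontief_utility (S i) (b i)) \<longrightarrow>
        (\<forall>ps s. filterlim s at_top sequentially \<longrightarrow>
               (\<forall>j. (\<lambda>n. p (s n) j) \<longlonglongrightarrow> ps j) \<longrightarrow> market_equilibrium u e ps))"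
proof (intro conjI impI allI)
  assume "\<exists>a \<rho>. \<forall>i. \<rho> i \<le> 0 \<and> (\<forall>j. a i j \<ge> 0) \<and> (\<exists>j. a i j > 0) \<and> u i = ces_utility (a i) (\<rho> i)"
  then obtain a \<rho> where rho: "\<And>i. \<rho> i \<le> 0" and a: "\<And>i j. 0 \<le> a i j" "\<And>i. \<exists>j. 0 < a i j"
    and u: "\<And>i. u i = ces_utility (a i) (\<rho> i)" by metis
  define \<sigma> where "\<sigma> i = 1 / (1 - \<rho> i)" for i
  define c where "c i j = a i j powr \<sigma> i" for i j
  have \<sigma>: "0 < \<sigma> i" "\<sigma> i \<le> 1" for i using rho[of i] by (auto simp: \<sigma>_def)
  \<comment> \<open>Elasticity \<open>\<sigma> i > 0\<close> corresponds to
    \<open>\<theta> i < 1\<close>, and \<open>0 powr \<sigma> i = 0\<close> leaves goods without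
    weight unwanted.\<close>
  interpret ces_market e "\<lambda>i. 1 - \<sigma> i" c
  proof
    show "\<exists>j. 0 < c i j" for i using a(2)[of i] by (metis c_def powr_gt_zero less_numeral_extra(3))
  qed (use budgets \<sigma> in \<open>auto simp: c_def less_imp_le\<close>)
  have c_pos: "0 < c i j \<longleftrightarrow> 0 < a i j" for i j using a(1)[of i j] by (auto simp: c_def)
  have bundle_eq: "ces_bundle (a i) (\<sigma> i) (e i) pr j = e i * share i pr j / pr j" for i pr j
    by (simp add: ces_bundle_def share_def agg_def c_def)
  have x_eq: "x i pr j = e i * share i pr j / pr j" if pr: "\<And>j. 0 < pr j" for i pr j
  proof -
    have "x i pr = ces_bundle (a i) (1 / (1 - \<rho> i)) (e i) pr"
    proof (rule ces_demand_unique)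
      show "x i pr \<in> demand_set (ces_utility (a i) (\<rho> i)) (e i) pr"
        using demand pr u[of i] by metis
    qed (use pr budgets a rho in \<open>auto simp: less_imp_le\<close>)
    then show ?thesis using bundle_eq[of i pr j] by (simp only: \<sigma>_def)
  qed
  have "excess_demand x pr j = spend pr j / pr j - 1" if "\<And>j. 0 < pr j" for pr j
    using x_eq[OF that] by (simp add: excess_demand_def spend_def sum_divide_distrib)
  then obtain resp where "tatonnement_run e (\<lambda>i. 1 - \<sigma> i) c lam (excess_demand x) T q resp p"
    using run_of_async_tatonnement[OF lam_pos lam_le run] by blast
  then interpret tatonnement_run e "\<lambda>i. 1 - \<sigma> i" c lam "excess_demand x" T q resp p .
  have "1 - \<sigma> i < 1" for i using \<sigma> by simp
  then obtain ps where ps: "\<And>j. wanted j \<Longrightarrow> 0 < ps j" "\<And>j. wanted j \<Longrightarrow> spend ps j = ps j"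
    "\<And>j. \<not> wanted j \<Longrightarrow> ps j = 0" "\<And>j. ((\<lambda>t. p t j) \<longlongrightarrow> ps j) at_top"
    using ces_convergence by blast
  have ps0: "0 \<le> ps j" for j using ps(1,3)[of j] by (cases "wanted j") auto
  \<comment> \<open>For an unwanted good the price is 0 and the quotient is 0, so its excess demand
    is -1, as equilibrium allows at price zero.\<close>
  define X where "X i j = e i * share i ps j / ps j" for i j
  have "X i \<in> demand_set (u i) (e i) ps" for i
  proof -
    have "ces_bundle (a i) (1 / (1 - \<rho> i)) (e i) ps \<in> demand_set (ces_utility (a i) (\<rho> i)) (e i) ps"
    proof (rule ces_bundle_in_demand_set)
      show "0 < ps j" if "0 < a i j" for j using that by (intro ps) (auto simp: wanted_def c_pos)
    qed (use a rho budgets ps0 in auto)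
    moreover have "ces_bundle (a i) (1 / (1 - \<rho> i)) (e i) ps = X i"
      using bundle_eq[of i ps] by (simp only: fun_eq_iff X_def \<sigma>_def) simp
    ultimately show ?thesis by (simp add: u)
  qed
  moreover have "(\<Sum>i\<in>UNIV. X i j) = spend ps j / ps j" for j
    by (simp add: X_def spend_def sum_divide_distrib)
  then have "(0 < ps j \<longrightarrow> (\<Sum>i\<in>UNIV. X i j) - 1 = 0) \<and> (ps j = 0 \<longrightarrow> (\<Sum>i\<in>UNIV. X i j) - 1 \<le> 0)" for j
    using ps(1-3)[of j] by (cases "wanted j") auto
  ultimately have "market_equilibrium u e ps" unfolding market_equilibrium_def using ps0 by blast
  then show "\<exists>ps. market_equilibrium u e ps \<and> (\<forall>j. ((\<lambda>t. p t j) \<longlongrightarrow> ps j) at_top)"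
    using ps(4) by blast
next
  fix ps :: "'g \<Rightarrow> real" and s :: "nat \<Rightarrow> real"
  assume "\<exists>S b. \<forall>i. S i \<noteq> {} \<and> (\<forall>j\<in>S i. b i j > 0) \<and> u i = leontief_utility (S i) (b i)"
    and s: "filterlim s at_top sequentially" and "\<forall>j. (\<lambda>n. p (s n) j) \<longlonglongrightarrow> ps j"
  then obtain S b where S: "\<And>i. S i \<noteq> {}" and b: "\<And>i j. j \<in> S i \<Longrightarrow> 0 < b i j"
    and u: "\<And>i. u i = leontief_utility (S i) (b i)" and lim: "\<And>j. (\<lambda>n. p (s n) j) \<longlonglongrightarrow> ps j" by metis
  define c where "c i j = (if j \<in> S i then 1 / b i j else 0)" for i j
  have c_in: "0 < c i j \<longleftrightarrow> j \<in> S i" for i j using b by (auto simp: c_def)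
  interpret leontief_market e "\<lambda>_. 1" c
  proof
    show "\<exists>j. 0 < c i j" for i using S[of i] by (auto simp: c_in)
  qed (use budgets b in \<open>auto simp: c_def less_imp_le\<close>)
  have bundle_eq: "leontief_bundle (c i) (e i) pr j = e i * c i j / agg i pr" if "\<And>j. 0 \<le> pr j" for i pr j
    using that by (simp add: leontief_bundle_def agg_linear)
  have x_eq: "x i pr j = e i * c i j / agg i pr" if pr: "\<And>j. 0 < pr j" for i pr j
  proof -
    have "0 < agg i pr" using pr by (intro agg_pos)
    then have agg: "0 < (\<Sum>j\<in>UNIV. c i j * pr j)" using pr by (simp add: agg_linear less_imp_le)
    have "x i pr = leontief_bundle (c i) (e i) pr"
    proof (rule leontief_demand_unique[of "S i" "b i"])
      show "x i pr \<in> demand_set (leontief_utility (S i) (b i)) (e i) pr"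
        using demand pr u[of i] by metis
    qed (use pr budgets S b agg in \<open>auto simp: less_imp_le c_def\<close>)
    then show ?thesis using pr by (simp add: bundle_eq less_imp_le)
  qed
  have "excess_demand x pr j = spend pr j / pr j - 1" if "\<And>j. 0 < pr j" for pr j
    using x_eq[OF that] spend_eq_leontief_demand[of pr j] that
    by (simp add: excess_demand_def leontief_demand_def)
  then obtain resp where "tatonnement_run e (\<lambda>_. 1) c lam (excess_demand x) T q resp p"
    using run_of_async_tatonnement[OF lam_pos lam_le run] by blast
  then interpret tatonnement_run e "\<lambda>_. 1" c lam "excess_demand x" T q resp p .
  interpret leontief_run e "\<lambda>_. 1" c lam "excess_demand x" T q resp p ..
  have ps0: "0 \<le> ps j" for j by (rule limit_nonneg[OF s lim])
  \<comment> \<open>Without a division by the price, since a good of limit price zero may still be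
    demanded.\<close>
  define X where "X i j = e i * c i j / agg i ps" for i j
  have "X i \<in> demand_set (u i) (e i) ps" for i
  proof -
    have "leontief_bundle (c i) (e i) ps \<in> demand_set (leontief_utility (S i) (b i)) (e i) ps"
      using S b budgets ps0 limit_agg(2)[OF s lim, of i]
      by (intro leontief_bundle_in_demand_set) (auto simp: c_def agg_linear)
    moreover have "leontief_bundle (c i) (e i) ps = X i"
      by (simp add: fun_eq_iff X_def bundle_eq ps0)
    ultimately show ?thesis by (simp add: u)
  qed
  moreover have "(\<Sum>i\<in>UNIV. X i j) = leontief_demand ps j" for j
    by (simp add: X_def leontief_demand_def)
  then have "(0 < ps j \<longrightarrow> (\<Sum>i\<in>UNIV. X i j) - 1 = 0) \<and> (ps j = 0 \<longrightarrow> (\<Sum>i\<in>UNIV. X i j) - 1 \<le> 0)" for j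
    using limit_demand_eq_1[OF s lim, of j] limit_demand_le_1[OF s lim, of j] by simp
  ultimately show "market_equilibrium u e ps" unfolding market_equilibrium_def using ps0 by blast
qed

end
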